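(* Fix $h>0$ and let $p,q:\mathbb{R}\to\mathbb{C}$ be $1$-periodic functions with $p,q\in AC_{\rm loc}(\mathbb{R})$ and $p',q'\in L^\infty(\mathbb{R})$. Moreover, assume $\overline{p}\,\overline{q}=pq$. Let $\sigma(\mathfrak{D})\subset\mathbb{C}$ be the $L^2(\mathbb{R})^2$-spectrum of the Dirac operator $\mathfrak{D}$ with potentials $p,q$ and semiclassical parameter $h$. Then $\sigma(\mathfrak{D})\subset\widetilde{\Lambda}^h(p,q)$, where $$\widetilde{\Lambda}^h(p,q):=\Big\{z\in\mathbb{C}:|\operatorname{Im} z|\le\left(\|p\|_\infty\|q\|_\infty\right)^{1/2}\Big\}\cap\Big\{z\in\mathbb{C}:|\operatorname{Re} z|\,|\operatorname{Im} z|\le c(h)\Big\}$$ and $$c(h):=\frac{h}{2}\left(\|p'\|_\infty\|q'\|_\infty\right)^{1/2}.$$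
   Context: The Dirac operator is the differential expression $\mathfrak{D}:= ih\sigma_3\partial_x + Q(x)$, $x\in\mathbb{R}$, where $i$ is the imaginary unit, $h>0$ is the semiclassical parameter, $\sigma_3=\begin{pmatrix}1&0\\0&-1\end{pmatrix}$ and $Q(x)=\begin{pmatrix}0&-iq(x)\\ ip(x)&0\end{pmatrix}$. It is realized as the densely and maximally defined closed operator $H\Psi=\mathfrak{D}\Psi$ in $L^2(\mathbb{R})^2=L^2(\mathbb{R};\mathbb{C}^2)$ with domain $\{\Psi\in L^2(\mathbb{R})^2:\Psi\in AC_{\rm loc}(\mathbb{R})^2,\ \mathfrak{D}\Psi\in L^2(\mathbb{R})^2\}$, where $AC_{\rm loc}(\mathbb{R})$ denotes the locally absolutely continuous complex-valued functions. $\sigma(\mathfrak{D})$ denotes the spectrum of this operator. $\|\cdot\|_\infty$ is the $L^\infty(\mathbb{R})$ (essential supremum) norm, and overbar denotes complex conjugation. *)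

theory Defs
  imports "HOL-Analysis.Analysis" "HOL-Probability.Essential_Supremum"
begin

section \<open>Locally absolutely continuous functions\<close>

text \<open>The usual \<open>\<epsilon>\<close>-\<open>\<delta>\<close> definition. A division of a set \<open>T\<close> is a finite family of non-overlapping
  compact intervals \<open>[Inf K, Sup K]\<close> with union \<open>T\<close>; as \<open>T\<close> is not required to be an interval,
  \<open>d\<close> ranges over all finite families of non-overlapping compact subintervals of \<open>[a, b]\<close>.\<close>

definition abs_continuous_on_interval :: "real \<Rightarrow> real \<Rightarrow> (real \<Rightarrow> complex) \<Rightarrow> bool" where
  "abs_continuous_on_interval a b f \<longleftrightarrow>
     (\<forall>\<epsilon>>0. \<exists>\<delta>>0. \<forall>d T. d division_of T \<and> T \<subseteq> {a..b} \<and> (\<Sum>K\<in>d. Sup K - Inf K) < \<delta> \<longrightarrow>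
        (\<Sum>K\<in>d. norm (f (Sup K) - f (Inf K))) < \<epsilon>)"

definition AC_loc :: "(real \<Rightarrow> complex) set" where
  "AC_loc = {f. \<forall>a b. abs_continuous_on_interval a b f}"

section \<open>The spaces \<open>L\<^sup>\<infinity>(\<real>)\<close> and \<open>L\<^sup>2(\<real>; \<complex>\<^sup>2)\<close>\<close>

text \<open>Elements of these spaces are represented by Lebesgue measurable functions; equality in the
  space is equality almost everywhere.

  A derivative is written \<^term>\<open>vector_derivative f (at x)\<close>, which is an unspecified constant
  at the points where \<open>f\<close> is not differentiable. For locally absolutely continuous \<open>f\<close> these points
  form a Lebesgue null set, so they affect none of the notions below.\<close>

definition Linf_seminorm :: "(real \<Rightarrow> complex) \<Rightarrow> ennreal" where
  "Linf_seminorm f = esssup lebesgue (\<lambda>x. ennreal (norm (f x)))"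

definition Linf :: "(real \<Rightarrow> complex) set" where
  "Linf = {f. f \<in> borel_measurable lebesgue \<and> Linf_seminorm f < \<infinity>}"

definition Linf_norm :: "(real \<Rightarrow> complex) \<Rightarrow> real" where
  "Linf_norm f = enn2real (Linf_seminorm f)"

definition L2 :: "(real \<Rightarrow> complex^2) set" where
  "L2 = {f. f \<in> borel_measurable lebesgue \<and> integrable lebesgue (\<lambda>x. (norm (f x))\<^sup>2)}"

definition L2_norm :: "(real \<Rightarrow> complex^2) \<Rightarrow> real" where
  "L2_norm f = sqrt (LINT x|lebesgue. (norm (f x))\<^sup>2)"

section \<open>Spectrum of an operator in \<open>L\<^sup>2(\<real>; \<complex>\<^sup>2)\<close>\<close>

text \<open>An operator is given by its domain \<open>D \<subseteq> L\<^sup>2\<close> and its action \<open>A\<close>. A point \<open>z\<close> is in the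
  resolvent set if \<open>A - z : D \<rightarrow> L\<^sup>2\<close> is injective (the operators are linear), surjective, and has
  a bounded inverse.\<close>

definition resolvent_set ::
    "(real \<Rightarrow> complex^2) set \<Rightarrow> ((real \<Rightarrow> complex^2) \<Rightarrow> real \<Rightarrow> complex^2) \<Rightarrow> complex set" where
  "resolvent_set D A = {z.
     (\<forall>\<Psi>\<in>D. (AE x in lebesgue. A \<Psi> x - z *s \<Psi> x = 0) \<longrightarrow> (AE x in lebesgue. \<Psi> x = 0)) \<and>
     (\<forall>F\<in>L2. \<exists>\<Psi>\<in>D. AE x in lebesgue. A \<Psi> x - z *s \<Psi> x = F x) \<and>
     (\<exists>C. \<forall>\<Psi>\<in>D. L2_norm \<Psi> \<le> C * L2_norm (\<lambda>x. A \<Psi> x - z *s \<Psi> x))}"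

definition spectrum ::
    "(real \<Rightarrow> complex^2) set \<Rightarrow> ((real \<Rightarrow> complex^2) \<Rightarrow> real \<Rightarrow> complex^2) \<Rightarrow> complex set" where
  "spectrum D A = - resolvent_set D A"

section \<open>The Dirac operator\<close>

definition sigma3 :: "complex^2^2" where
  "sigma3 = vector [vector [1, 0], vector [0, -1]]"

definition potential :: "(real \<Rightarrow> complex) \<Rightarrow> (real \<Rightarrow> complex) \<Rightarrow> real \<Rightarrow> complex^2^2" where
  "potential p q x = vector [vector [0, - \<i> * q x], vector [\<i> * p x, 0]]"

definition dirac_expr ::
    "real \<Rightarrow> (real \<Rightarrow> complex) \<Rightarrow> (real \<Rightarrow> complex) \<Rightarrow> (real \<Rightarrow> complex^2) \<Rightarrow> real \<Rightarrow> complex^2" where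
  "dirac_expr h p q \<Psi> x =
     (\<i> * complex_of_real h) *s (sigma3 *v vector_derivative \<Psi> (at x)) + potential p q x *v \<Psi> x"

definition dirac_domain ::
    "real \<Rightarrow> (real \<Rightarrow> complex) \<Rightarrow> (real \<Rightarrow> complex) \<Rightarrow> (real \<Rightarrow> complex^2) set" where
  "dirac_domain h p q =
     {\<Psi>. \<Psi> \<in> L2 \<and> (\<forall>i. (\<lambda>x. \<Psi> x $ i) \<in> AC_loc) \<and> dirac_expr h p q \<Psi> \<in> L2}"

definition dirac_spectrum ::
    "real \<Rightarrow> (real \<Rightarrow> complex) \<Rightarrow> (real \<Rightarrow> complex) \<Rightarrow> complex set" where
  "dirac_spectrum h p q = spectrum (dirac_domain h p q) (dirac_expr h p q)"

section \<open>The enclosing region\<close>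

definition c_bound :: "real \<Rightarrow> (real \<Rightarrow> complex) \<Rightarrow> (real \<Rightarrow> complex) \<Rightarrow> real" where
  "c_bound h p q =
     h / 2 * sqrt (Linf_norm (\<lambda>x. vector_derivative p (at x)) *
                   Linf_norm (\<lambda>x. vector_derivative q (at x)))"

definition Lambda_tilde ::
    "real \<Rightarrow> (real \<Rightarrow> complex) \<Rightarrow> (real \<Rightarrow> complex) \<Rightarrow> complex set" where
  "Lambda_tilde h p q =
     {z. \<bar>Im z\<bar> \<le> sqrt (Linf_norm p * Linf_norm q)} \<inter>
     {z. \<bar>Re z\<bar> * \<bar>Im z\<bar> \<le> c_bound h p q}"

end

theory Submission
  imports Defs
begin

text \<open>Write \<open>\<Psi> = (u, v)\<close> and \<open>F = (D - z)\<Psi>\<close>. The theorem says that \<open>z\<close> lies in the resolvent set as soon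
as it violates one of the two inequalities that define the region. Both inequalities come from an
energy identity on the whole line rather than from Floquet theory.

\<^item> The operator \<open>ih\<sigma>\<^sub>3\<partial>\<close> is symmetric, so the imaginary part of \<open>\<langle>F, \<Psi>\<rangle>\<close> only sees \<open>Im z\<close> and the
potential: \<open>|Im z| \<parallel>\<Psi>\<parallel>\<^sup>2 \<le> (\<parallel>p\<parallel> + \<parallel>q\<parallel>)/2 \<parallel>\<Psi>\<parallel>\<^sup>2 + \<parallel>F\<parallel> \<parallel>\<Psi>\<parallel>\<close> (lemma \<open>dirac_apriori_imaginary_part\<close>).

\<^item> Since \<open>\<sigma>\<^sub>3 Q + Q \<sigma>\<^sub>3 = 0\<close> and \<open>Q\<^sup>2 = pq\<close> is real, \<open>D\<^sup>2 = - h\<^sup>2\<partial>\<^sup>2 + pq + ih\<sigma>\<^sub>3 Q'\<close> has only \<open>ih\<sigma>\<^sub>3 Q'\<close> as a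
non-symmetric part, whereas \<open>Im (z\<^sup>2) = 2 Re z Im z\<close>. To stay inside the domain of the first-order
operator, \<open>\<langle>(D\<^sup>2 - z\<^sup>2)\<Psi>, \<Psi>\<rangle>\<close> is read as \<open>\<langle>F, (D\<^sup>* + cnj z)\<Psi>\<rangle>\<close>, and \<open>(D\<^sup>* + cnj z)\<Psi> = F + (Q\<^sup>* - Q + 2 Re z)\<Psi>\<close>,
so that the quadratic term in \<open>F\<close> is real and disappears (lemma \<open>dirac_apriori_square\<close>).

Replacing \<open>v\<close> by \<open>\<mu> v\<close> turns \<open>(p, q)\<close> into \<open>(\<mu> p, q / \<mu>)\<close>. Optimising over \<open>\<mu>\<close> replaces the arithmetic means
of the norms by geometric ones (lemmas \<open>weight_below_geometric_mean\<close>, \<open>dirac_coercive_scale\<close>).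

This bounds \<open>\<Psi>\<close> by \<open>F\<close>. Surjectivity follows by continuity: an inequality violated at \<open>z\<close> stays
violated when \<open>|Im z|\<close> grows with \<open>Re z\<close> fixed, and one constant serves the whole vertical ray. Far up the ray the
problem is a small perturbation of \<open>Q = 0\<close>, where it decouples into two scalar equations solved by
one-sided exponential integrals, and from there finitely many contractions of fixed size lead down to \<open>z\<close>
(lemmas \<open>dirac_coercive_ray\<close>, \<open>dirac_solvable_perturbation\<close>, \<open>dirac_solvable_of_coercive_ray\<close>).

All of this integrates by parts with functions that are merely locally absolutely continuous. The
first half of the text therefore shows that such functions are exactly the indefinite integrals of
locally integrable functions and are differentiable almost everywhere. If \<open>g\<close> is the upper limit of the
difference quotients of \<open>f\<close> along the steps \<open>1/(n+1)\<close>, then \<open>f - \<integral>g\<close> has, at almost every point, difference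
quotients over arbitrarily small intervals that are almost nonnegative, and others that are almost
nonpositive; a Vitali covering and absolute continuity make \<open>f - \<integral>g\<close> both increasing and decreasing.\<close>

section \<open>Differentiation of indefinite integrals\<close>

text \<open>By Henstock's lemma the total deviation over any fine tagged partial division is small. Each
exceptional point tags an interval that contributes at least \<open>c\<close> times its length, so a disjoint
family of such intervals has small total length, and the Vitali covering lemma enlarges it by a
fixed factor to a cover of the exceptional set.\<close>

lemma negligible_indefinite_integral_deviation:
  fixes f :: "real \<Rightarrow> 'a::euclidean_space"
  assumes f: "f integrable_on {a..b}" and c: "c > 0"
  defines "F \<equiv> \<lambda>x. integral {a..x} f"
  shows "negligible {x\<in>{a<..<b}. \<forall>\<delta>>0. \<exists>y\<in>{a..b}. y \<noteq> x \<and> \<bar>y - x\<bar> < \<delta> \<and>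
           norm (F y - F x - (y - x) *\<^sub>R f x) > c * \<bar>y - x\<bar>}" (is "negligible ?E")
proof (subst negligible_outer_le, intro allI impI)
  fix e :: real assume e: "e > 0"
  have F_diff: "integral {x..y} f = F y - F x" if "a \<le> x" "x \<le> y" "y \<le> b" for x y
  proof -
    have "f integrable_on {a..y}" 
      by (rule integrable_on_subinterval[OF f]) (use that in auto)
    from Henstock_Kurzweil_Integration.integral_combine[OF that(1,2) this] show ?thesis by (simp add: F_def algebra_simps)
  qed
  have "f integrable_on cbox a b" using f by simp
  moreover have "e * c / 10 > 0" using e c by simp
  ultimately obtain \<gamma> where \<gamma>: "gauge \<gamma>"
    and H: "\<And>p. \<lbrakk>p tagged_partial_division_of (cbox a b); \<gamma> fine p\<rbrakk> \<Longrightarrow>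
             sum (\<lambda>(x,k). norm(measure lborel k *\<^sub>R f x - integral k f)) p < e * c / 10"
    by (rule Henstock_lemma) blast
  have "\<exists>y\<in>{a..b}. y \<noteq> x \<and> \<bar>y - x\<bar> \<le> 1 \<and> cball x \<bar>y - x\<bar> \<subseteq> \<gamma> x \<and>
           norm (F y - F x - (y - x) *\<^sub>R f x) > c * \<bar>y - x\<bar>" if x: "x \<in> ?E" for x
  proof -
    from \<gamma> have "open (\<gamma> x)" "x \<in> \<gamma> x" by (auto simp: gauge_def)
    then obtain \<rho> where \<rho>: "\<rho> > 0" "cball x \<rho> \<subseteq> \<gamma> x" by (meson open_contains_cball)
    have "min \<rho> 1 > 0" using \<rho> by simp
    with x obtain y where y: "y\<in>{a..b}" "y \<noteq> x" "\<bar>y - x\<bar> < min \<rho> 1"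
       "norm (F y - F x - (y - x) *\<^sub>R f x) > c * \<bar>y - x\<bar>" by blast
    moreover have "cball x \<bar>y - x\<bar> \<subseteq> \<gamma> x" using \<rho> y(3)
      by (meson less_imp_le min_less_iff_conj order_trans subset_cball)
    ultimately show ?thesis by auto
  qed
  then have "\<forall>x\<in>?E. \<exists>y. y\<in>{a..b} \<and> y \<noteq> x \<and> \<bar>y - x\<bar> \<le> 1 \<and> cball x \<bar>y - x\<bar> \<subseteq> \<gamma> x \<and>
           norm (F y - F x - (y - x) *\<^sub>R f x) > c * \<bar>y - x\<bar>" unfolding Bex_def by simp
  from bchoice[OF this] obtain Y where Y': "\<forall>x\<in>?E. Y x \<in>{a..b} \<and> Y x \<noteq> x \<and> \<bar>Y x - x\<bar> \<le> 1 \<and> cball x \<bar>Y x - x\<bar> \<subseteq> \<gamma> x \<and>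
           norm (F (Y x) - F x - (Y x - x) *\<^sub>R f x) > c * \<bar>Y x - x\<bar>" ..
  have Y: "Y x \<in> {a..b}" "Y x \<noteq> x" "\<bar>Y x - x\<bar> \<le> 1" "cball x \<bar>Y x - x\<bar> \<subseteq> \<gamma> x"
      "norm (F (Y x) - F x - (Y x - x) *\<^sub>R f x) > c * \<bar>Y x - x\<bar>" if "x \<in> ?E" for x
    using bspec[OF Y' that] by simp_all
  \<comment> \<open>The interval between \<open>x\<close> and \<open>Y x\<close> is tagged by its endpoint \<open>x\<close> and lies in the ball of radius \<open>r x\<close>
    about \<open>x\<close>, so disjoint balls give non-overlapping tagged intervals.\<close>
  define r where "r = (\<lambda>x. \<bar>Y x - x\<bar>)"
  have "x \<in> cball x (r x)" for x by (simp add: r_def)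
  then have "?E \<subseteq> (\<Union>x\<in>?E. cball x (r x))" by blast
  moreover have "0 < r x \<and> r x \<le> 1" if "x \<in> ?E" for x
    using Y(2,3)[OF that] by (simp add: r_def)
  ultimately obtain C where C: "countable C" "C \<subseteq> ?E"
     "pairwise (\<lambda>i j. disjnt (cball i (r i)) (cball j (r j))) C"
     "?E \<subseteq> (\<Union>i\<in>C. cball i (5 * r i))"
    by (rule Vitali_covering_lemma_cballs)
  have bound: "(\<Sum>x\<in>D. 10 * r x) \<le> e" if D: "D \<subseteq> C" "finite D" for D
  proof -
    define I where "I = (\<lambda>x. {min x (Y x)..max x (Y x)})"
    define p where "p = (\<lambda>x. (x, I x)) ` D"
    have DE: "x \<in> ?E" if "x \<in> D" for x using that D C(2) by blast
    have Isub: "I x \<subseteq> cball x (r x)" for x by (auto simp: I_def r_def dist_real_def)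
    have Iab: "I x \<subseteq> {a..b}" if "x \<in> D" for x using Y(1)[OF DE[OF that]] DE[OF that] by (auto simp: I_def)
    have "p tagged_partial_division_of (cbox a b)"
      unfolding tagged_partial_division_of_def
    proof (intro conjI allI impI)
      show "finite p" using D by (simp add: p_def)
    next
      fix x K assume "(x, K) \<in> p"
      then have x: "x \<in> D" "K = I x" by (auto simp: p_def)
      then show "x \<in> K" "K \<subseteq> cbox a b" "\<exists>a b. K = cbox a b"
        using Iab[of x] by (auto simp: I_def)
    next
      fix x1 K1 x2 K2 assume *: "(x1, K1) \<in> p \<and> (x2, K2) \<in> p \<and> (x1, K1) \<noteq> (x2, K2)"
      then have **: "x1 \<in> C" "x2 \<in> C" "x1 \<noteq> x2" "K1 = I x1" "K2 = I x2" using D(1) by (auto simp: p_def)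
      then have "cball x1 (r x1) \<inter> cball x2 (r x2) = {}" using C(3) unfolding pairwise_def disjnt_def by blast
      then have "K1 \<inter> K2 = {}" using Isub[of x1] Isub[of x2] ** by blast
      then show "interior K1 \<inter> interior K2 = {}" using interior_subset by blast
    qed
    moreover have "\<gamma> fine p"
    proof (rule fineI)
      fix x K assume "(x, K) \<in> p"
      then have x: "x \<in> D" "K = I x" by (auto simp: p_def)
      show "K \<subseteq> \<gamma> x" using Y(4)[OF DE[OF x(1)]] Isub[of x] x(2) unfolding r_def by (rule_tac order_trans) simp_all
    qed
    ultimately have "sum (\<lambda>(x,k). norm(measure lborel k *\<^sub>R f x - integral k f)) p < e * c / 10" by (rule H)
    also have "sum (\<lambda>(x,k). norm(measure lborel k *\<^sub>R f x - integral k f)) p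
        = (\<Sum>x\<in>D. norm(measure lborel (I x) *\<^sub>R f x - integral (I x) f))"
      unfolding p_def by (subst sum.reindex) (auto simp: inj_on_def)
    finally have 1: "(\<Sum>x\<in>D. norm(measure lborel (I x) *\<^sub>R f x - integral (I x) f)) < e * c / 10" .
    have "c * r x \<le> norm(measure lborel (I x) *\<^sub>R f x - integral (I x) f)" if "x \<in> D" for x
    proof (cases "Y x \<ge> x")
      case True
      then have "measure lborel (I x) *\<^sub>R f x - integral (I x) f = -(F (Y x) - F x - (Y x - x) *\<^sub>R f x)"
        using F_diff[of x "Y x"] Y(1)[OF DE[OF that]] DE[OF that] by (simp add: I_def)
      then show ?thesis using Y(5)[OF DE[OF that]] by (simp only: norm_minus_cancel r_def)
    next
      case False
      then have "measure lborel (I x) *\<^sub>R f x - integral (I x) f = (F (Y x) - F x - (Y x - x) *\<^sub>R f x)"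
        using F_diff[of "Y x" x] Y(1)[OF DE[OF that]] DE[OF that] by (simp add: I_def algebra_simps)
      then show ?thesis using Y(5)[OF DE[OF that]] by (simp only: r_def)
    qed
    then have "(\<Sum>x\<in>D. c * r x) \<le> (\<Sum>x\<in>D. norm(measure lborel (I x) *\<^sub>R f x - integral (I x) f))" by (rule sum_mono)
    then have "c * (\<Sum>x\<in>D. r x) < e * c / 10" using 1 unfolding sum_distrib_left by (rule le_less_trans)
    also have "e * c / 10 = c * (e / 10)" by simp
    finally have "c * (\<Sum>x\<in>D. r x) < c * (e / 10)" .
    then have "(\<Sum>x\<in>D. r x) < e / 10" using c by (simp only: mult_less_cancel_left_pos)
    then show ?thesis by (simp add: sum_distrib_left[symmetric])
  qed
  \<comment> \<open>The covering lemma enlarges radii by \<open>5\<close>, and a ball has length twice its radius; this is the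
    factor \<open>10\<close> in the choice of \<open>\<gamma>\<close>.\<close>
  let ?T = "\<Union>i\<in>C. cball i (5 * r i)"
  have m: "measure lebesgue (\<Union>i\<in>D. cball i (5 * r i)) \<le> e" if D: "D \<subseteq> C" "finite D" for D
  proof -
    have "measure lebesgue (\<Union>i\<in>D. cball i (5 * r i)) \<le> (\<Sum>i\<in>D. measure lebesgue (cball i (5 * r i)))"
      using D by (intro measure_UNION_le) auto
    also have "\<dots> = (\<Sum>i\<in>D. 10 * r i)" by (intro sum.cong) (auto simp: cball_eq_atLeastAtMost r_def)
    also have "\<dots> \<le> e" by (rule bound[OF D])
    finally show ?thesis .
  qed
  show "\<exists>T. ?E \<subseteq> T \<and> T \<in> lmeasurable \<and> measure lebesgue T \<le> e"
    by (intro exI[of _ ?T] conjI C(4) fmeasurable_UN_bound[OF C(1) _ m] measure_UN_bound[OF C(1) _ m]) auto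
qed

text \<open>Lebesgue's differentiation theorem, obtained for Henstock-Kurzweil integrals by letting the constant \<open>c\<close>
of the previous lemma run through \<open>1, 1/2, 1/3, ...\<close>.\<close>

lemma indefinite_integral_has_vector_derivative_AE:
  fixes f :: "real \<Rightarrow> 'a::euclidean_space"
  assumes f: "f integrable_on {a..b}"
  shows "negligible {x\<in>{a<..<b}. \<not> ((\<lambda>x. integral {a..x} f) has_vector_derivative f x) (at x)}"
proof -
  define F where "F = (\<lambda>x. integral {a..x} f)"
  define E where "E = (\<lambda>c. {x\<in>{a<..<b}. \<forall>\<delta>>0. \<exists>y\<in>{a..b}. y \<noteq> x \<and> \<bar>y - x\<bar> < \<delta> \<and>
           norm (F y - F x - (y - x) *\<^sub>R f x) > c * \<bar>y - x\<bar>})"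
  have "negligible (\<Union>k. E (inverse (real (Suc k))))"
    unfolding E_def F_def
    by (intro negligible_Union_nat negligible_indefinite_integral_deviation f) simp
  moreover have "x \<in> (\<Union>k. E (inverse (real (Suc k))))" if x: "x \<in> {a<..<b}" and nd: "\<not> (F has_vector_derivative f x) (at x)" for x
  proof (rule ccontr)
    assume not: "x \<notin> (\<Union>k. E (inverse (real (Suc k))))"
    have "(F has_vector_derivative f x) (at x)"
      unfolding has_vector_derivative_def has_derivative_within_alt
    proof (intro conjI allI impI bounded_linear_scaleR_left)
      fix e :: real assume "e > 0"
      then obtain k where k: "inverse (real (Suc k)) < e" using reals_Archimedean by blast
      from not have "x \<notin> E (inverse (real (Suc k)))" by blast
      with x obtain \<delta> where \<delta>: "\<delta> > 0"
        and le: "\<And>y. y\<in>{a..b} \<Longrightarrow> y \<noteq> x \<Longrightarrow> \<bar>y - x\<bar> < \<delta> \<Longrightarrow>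
           norm (F y - F x - (y - x) *\<^sub>R f x) \<le> inverse (real (Suc k)) * \<bar>y - x\<bar>"
        unfolding E_def mem_Collect_eq by (meson not_less)
      show "\<exists>d>0. \<forall>y\<in>UNIV. norm (y - x) < d \<longrightarrow> norm (F y - F x - (y - x) *\<^sub>R f x) \<le> e * norm (y - x)"
      proof (intro exI[of _ "min \<delta> (min (x - a) (b - x))"] conjI ballI impI)
        fix y assume y: "norm (y - x) < min \<delta> (min (x - a) (b - x))"
        show "norm (F y - F x - (y - x) *\<^sub>R f x) \<le> e * norm (y - x)"
        proof (cases "y = x")
          case False
          then have "norm (F y - F x - (y - x) *\<^sub>R f x) \<le> inverse (real (Suc k)) * \<bar>y - x\<bar>"
            using y by (intro le) auto
          also have "\<dots> \<le> e * norm (y - x)"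
            unfolding real_norm_def using k by (intro mult_right_mono) auto
          finally show ?thesis .
        qed auto
      qed (use \<delta> x in auto)
    qed
    with nd show False by simp
  qed
  then have "{x\<in>{a<..<b}. \<not> (F has_vector_derivative f x) (at x)} \<subseteq> (\<Union>k. E (inverse (real (Suc k))))" by blast
  ultimately show ?thesis unfolding F_def by (rule negligible_subset)
qed

section \<open>Absolute continuity of indefinite integrals\<close>

text \<open>The part of \<open>norm g\<close> above height \<open>n\<close>. Below that height an integral is controlled by length alone,
and the remainder tends to zero by dominated convergence; together this gives absolute continuity.\<close>

lemma tendsto_integral_excess:
  fixes g :: "real \<Rightarrow> 'a::euclidean_space"
  assumes g: "g absolutely_integrable_on {a..b}"
  shows "(\<lambda>n. integral {a..b} (\<lambda>x. norm (g x) - min (real n) (norm (g x)))) \<longlonglongrightarrow> 0"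
    and "(\<lambda>x. norm (g x) - min (real n) (norm (g x))) integrable_on {a..b}"
proof -
  have n: "(\<lambda>x. norm (g x)) absolutely_integrable_on {a..b}"
    using g by (simp add: absolutely_integrable_on_def)
  have m: "(\<lambda>x. min (real n) (norm (g x))) absolutely_integrable_on {a..b}" for n
    by (intro absolutely_integrable_min_1 n) auto
  show i: "(\<lambda>x. norm (g x) - min (real n) (norm (g x))) integrable_on {a..b}" for n
    by (intro integrable_diff set_lebesgue_integral_eq_integral(1) n m)
  have "(\<lambda>n. integral {a..b} (\<lambda>x. norm (g x) - min (real n) (norm (g x)))) \<longlonglongrightarrow> integral {a..b} (\<lambda>x. 0::real)"
  proof (rule dominated_convergence(2)[OF i])
    show "(\<lambda>x. norm (g x)) integrable_on {a..b}" using n by (rule set_lebesgue_integral_eq_integral)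
    fix x
    have "eventually (\<lambda>n. norm (g x) - min (real n) (norm (g x)) = 0) sequentially"
      using eventually_ge_at_top[of "nat \<lceil>norm (g x)\<rceil>"]
      by eventually_elim (auto simp: min_def nat_ceiling_le_eq)
    then show "(\<lambda>n. norm (g x) - min (real n) (norm (g x))) \<longlonglongrightarrow> 0"
      by (rule tendsto_eventually)
  qed auto
  then show "(\<lambda>n. integral {a..b} (\<lambda>x. norm (g x) - min (real n) (norm (g x)))) \<longlonglongrightarrow> 0" by simp
qed

lemma sum_integral_norm_division_le:
  fixes g :: "real \<Rightarrow> 'a::euclidean_space"
  assumes g: "g absolutely_integrable_on {a..b}" and d: "d division_of T" "T \<subseteq> {a..b}"
  shows "(\<Sum>K\<in>d. norm (integral K g)) \<le> real n * (\<Sum>K\<in>d. measure lborel K) 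
     + integral {a..b} (\<lambda>x. norm (g x) - min (real n) (norm (g x)))"
proof -
  let ?e = "\<lambda>x. norm (g x) - min (real n) (norm (g x))"
  have n: "(\<lambda>x. norm (g x)) integrable_on {a..b}" "g integrable_on {a..b}"
    using g by (simp_all add: absolutely_integrable_on_def)
  have e: "?e integrable_on {a..b}" by (rule tendsto_integral_excess(2)[OF g])
  have sub: "h integrable_on K" if h: "h integrable_on {a..b}" and K: "K \<in> d" for K and h :: "real \<Rightarrow> 'b::banach"
  proof -
    obtain u v where uv: "K = {u..v}" using division_ofD(4)[OF d(1) K] by auto
    have "K \<subseteq> {a..b}" using division_ofD(2)[OF d(1) K] d(2) by blast
    then show ?thesis using integrable_on_subinterval[OF h, of u v] uv by auto
  qed
  have "norm (integral K g) \<le> real n * measure lborel K + integral K ?e" if K: "K \<in> d" for K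
  proof -
    obtain u v where uv: "K = cbox u v" using division_ofD(4)[OF d(1) K] by auto
    have "norm (integral K g) \<le> integral K (\<lambda>x. real n + ?e x)"
    proof (rule integral_norm_bound_integral)
      show "g integrable_on K" by (rule sub[OF n(2) K])
      show "(\<lambda>x. real n + ?e x) integrable_on K" using sub[OF e K] uv by (intro integrable_add integrable_const) auto
    qed (auto simp: min_def)
    also have "\<dots> = integral K (\<lambda>x. real n) + integral K ?e"
      using sub[OF e K] uv by (intro Henstock_Kurzweil_Integration.integral_add) auto
    finally show ?thesis using uv by (simp add: mult.commute)
  qed
  then have "(\<Sum>K\<in>d. norm (integral K g)) \<le> (\<Sum>K\<in>d. real n * measure lborel K + integral K ?e)" by (rule sum_mono)
  also have "\<dots> = real n * (\<Sum>K\<in>d. measure lborel K) + (\<Sum>K\<in>d. integral K ?e)"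
    by (simp add: sum.distrib sum_distrib_left)
  also have "(\<Sum>K\<in>d. integral K ?e) = integral T ?e"
    using integral_combine_division_topdown[of ?e "{a..b}"] e d has_integral_combine_division_topdown[OF e d] by (metis integral_unique)
  also have "\<dots> \<le> integral {a..b} ?e"
    using has_integral_combine_division_topdown[OF e d] e d
    by (intro integral_subset_le) (auto simp: has_integral_integrable min_def)
  finally show ?thesis by simp
qed

text \<open>The same condition as \<^const>\<open>abs_continuous_on_interval\<close>, for values in an arbitrary normed space: the
covering arguments below use the order of the real line and are applied to real and imaginary parts.\<close>

definition abs_cont_on :: "real \<Rightarrow> real \<Rightarrow> (real \<Rightarrow> 'a::real_normed_vector) \<Rightarrow> bool" where
  "abs_cont_on a b f \<longleftrightarrow>
     (\<forall>\<epsilon>>0. \<exists>\<delta>>0. \<forall>d T. d division_of T \<and> T \<subseteq> {a..b} \<and> (\<Sum>K\<in>d. Sup K - Inf K) < \<delta> \<longrightarrow>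
        (\<Sum>K\<in>d. norm (f (Sup K) - f (Inf K))) < \<epsilon>)"

lemma indefinite_integral_abs_cont_on:
  fixes g :: "real \<Rightarrow> 'a::euclidean_space"
  assumes g: "g absolutely_integrable_on {a..b}"
    and F: "\<And>u v. a \<le> u \<Longrightarrow> u \<le> v \<Longrightarrow> v \<le> b \<Longrightarrow> (g has_integral F v - F u) {u..v}"
  shows "abs_cont_on a b F"
  unfolding abs_cont_on_def
proof (intro allI impI)
  fix e :: real assume e: "e > 0"
  have "eventually (\<lambda>n. integral {a..b} (\<lambda>x. norm (g x) - min (real n) (norm (g x))) < e / 2) sequentially"
    using e by (intro order_tendstoD(2)[OF tendsto_integral_excess(1)[OF g]]) auto
  then obtain n where n: "integral {a..b} (\<lambda>x. norm (g x) - min (real n) (norm (g x))) < e / 2"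
    by (meson eventually_sequentially order_refl)
  show "\<exists>\<delta>>0. \<forall>d T. d division_of T \<and> T \<subseteq> {a..b} \<and> (\<Sum>K\<in>d. Sup K - Inf K) < \<delta> \<longrightarrow>
        (\<Sum>K\<in>d. norm (F (Sup K) - F (Inf K))) < e"
  proof (intro exI[of _ "e / 2 / (real n + 1)"] conjI allI impI; (elim conjE)?)
    fix d T assume d: "d division_of T" "T \<subseteq> {a..b}" and s: "(\<Sum>K\<in>d. Sup K - Inf K) < e / 2 / (real n + 1)"
    have K: "measure lborel K = Sup K - Inf K" "integral K g = F (Sup K) - F (Inf K)" if K: "K \<in> d" for K
    proof -
      obtain u v where uv: "K = {u..v}" using division_ofD(4)[OF d(1) K] by auto
      have "u \<le> v" using division_ofD(3)[OF d(1) K] uv by simp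
      have "{u..v} \<subseteq> {a..b}" using division_ofD(2)[OF d(1) K] d(2) uv by blast
      with \<open>u \<le> v\<close> have "a \<le> u" "v \<le> b" by auto
      then show "measure lborel K = Sup K - Inf K" "integral K g = F (Sup K) - F (Inf K)"
        using F[of u v] uv \<open>u \<le> v\<close> by (auto intro: integral_unique)
    qed
    have "(\<Sum>K\<in>d. norm (F (Sup K) - F (Inf K))) = (\<Sum>K\<in>d. norm (integral K g))"
      by (intro sum.cong) (auto simp: K)
    also have "\<dots> \<le> real n * (\<Sum>K\<in>d. measure lborel K) 
     + integral {a..b} (\<lambda>x. norm (g x) - min (real n) (norm (g x)))"
      by (rule sum_integral_norm_division_le[OF g d])
    also have "(\<Sum>K\<in>d. measure lborel K) = (\<Sum>K\<in>d. Sup K - Inf K)"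
      by (intro sum.cong) (auto simp: K)
    also have "real n * (\<Sum>K\<in>d. Sup K - Inf K) \<le> real n * (e / 2 / (real n + 1))"
      using s by (intro mult_left_mono) auto
    also have "\<dots> \<le> e / 2" using e by (simp add: field_simps)
    finally show "(\<Sum>K\<in>d. norm (F (Sup K) - F (Inf K))) < e" using n by simp
  qed (use e in auto)
qed

section \<open>Absolutely continuous functions as indefinite integrals\<close>

text \<open>A finite form of the Vitali covering theorem. An interval of the cover need only contain the point \<open>x\<close>,
because the theorem for balls asks for membership and not for centres; below, \<open>x\<close> is an endpoint.\<close>

lemma Vitali_finite_intervals:
  fixes E :: "real set" and P :: "real \<Rightarrow> real \<Rightarrow> bool"
  assumes E: "E \<in> sets lebesgue" "E \<subseteq> {a<..<b}" and \<eta>: "\<eta> > 0"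
    and cov: "\<And>x \<delta>. x \<in> E \<Longrightarrow> \<delta> > 0 \<Longrightarrow> \<exists>u v. u < v \<and> u \<le> x \<and> x \<le> v \<and> v - u < \<delta> \<and> P u v"
  obtains d where "d division_of \<Union>d" "\<Union>d \<subseteq> {a..b}"
    "\<And>K. K \<in> d \<Longrightarrow> Inf K < Sup K \<and> P (Inf K) (Sup K)" "measure lebesgue (E - \<Union>d) < \<eta>"
proof -
  define J where "J = {(u, v). u < v \<and> a \<le> u \<and> v \<le> b \<and> P u v}"
  define m where "m = (\<lambda>(u::real, v). (u + v) / 2)"
  define r where "r = (\<lambda>(u::real, v). (v - u) / 2)"
  define I where "I = (\<lambda>(u::real, v). {u..v})"
  have cball: "cball (m i) (r i) = I i" for i
    by (cases i) (auto simp: cball_eq_atLeastAtMost m_def r_def I_def field_simps)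
  have 1: "0 < r i" if "i \<in> J" for i using that by (auto simp: J_def r_def)
  have 2: "\<exists>i. i \<in> J \<and> x \<in> cball (m i) (r i) \<and> r i < \<delta>" if x: "x \<in> E" and \<delta>: "0 < \<delta>" for x \<delta>
  proof -
    from x E(2) have ab: "a < x" "x < b" by auto
    then have "min \<delta> (min (x - a) (b - x)) > 0" using \<delta> by simp
    from cov[OF x this] obtain u v where uv: "u < v" "u \<le> x" "x \<le> v" "v - u < min \<delta> (min (x - a) (b - x))" "P u v"
      by blast
    then have "(u, v) \<in> J \<and> x \<in> cball (m (u, v)) (r (u, v)) \<and> r (u, v) < \<delta>"
      unfolding cball by (auto simp: J_def r_def I_def)
    then show ?thesis by blast
  qed
  from Vitali_covering_theorem_cballs[OF 1 2]
  obtain C where C: "countable C" "C \<subseteq> J" "pairwise (\<lambda>i j. disjnt (I i) (I j)) C"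
     "negligible (E - (\<Union>i \<in> C. I i))" unfolding cball by blast
  have fin: "\<exists>D. finite D \<and> D \<subseteq> C \<and> measure lebesgue (E - (\<Union>i\<in>D. I i)) < \<eta>"
  proof (cases "C = {}")
    case True
    then have "measure lebesgue E = 0" using C(4) by (simp add: negligible_iff_measure)
    then show ?thesis using \<eta> by (intro exI[of _ "{}"]) auto
  next
    case False
    define A where "A = (\<lambda>n. E - (\<Union>i\<in>from_nat_into C ` {..n::nat}. I i))"
    have Is: "I i \<in> sets lebesgue" for i by (cases i) (simp add: I_def)
    have "(\<lambda>n. measure lebesgue (A n)) \<longlonglongrightarrow> measure lebesgue (\<Inter>n. A n)"
    proof (rule Lim_measure_decseq)
      show "range A \<subseteq> sets lebesgue" unfolding A_def by (intro image_subsetI sets.Diff E sets.finite_UN Is) auto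
      show "decseq A" unfolding A_def decseq_def by force
      fix n
      have "emeasure lebesgue (A n) \<le> emeasure lebesgue {a..b}"
        using E(2) by (intro emeasure_mono) (auto simp: A_def)
      also have "\<dots> < \<infinity>" by (simp add: emeasure_lborel_Icc_eq)
      finally show "emeasure lebesgue (A n) \<noteq> \<infinity>" by simp
    qed
    also have "(\<Inter>n. A n) = E - (\<Union>i \<in> C. I i)"
    proof -
      have "(\<Union>n. from_nat_into C ` {..n}) = range (from_nat_into C)" by blast
      then have "(\<Union>n. from_nat_into C ` {..n}) = C" using range_from_nat_into[OF False C(1)] by simp
      moreover have "(\<Inter>n. A n) = E - (\<Union>i\<in>(\<Union>n. from_nat_into C ` {..n}). I i)" unfolding A_def by blast
      ultimately show ?thesis by simp
    qed
    also have "measure lebesgue \<dots> = 0" using C(4) by (simp add: negligible_iff_measure)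
    finally have "eventually (\<lambda>n. measure lebesgue (A n) < \<eta>) sequentially"
      using \<eta> by (rule order_tendstoD)
    then obtain n where n: "measure lebesgue (A n) < \<eta>" by (meson eventually_sequentially order_refl)
    show ?thesis using n from_nat_into[OF False]
      by (intro exI[of _ "from_nat_into C ` {..n}"]) (auto simp: A_def)
  qed
  then obtain D where D: "finite D" "D \<subseteq> C" "measure lebesgue (E - (\<Union>i\<in>D. I i)) < \<eta>" by blast
  have DJ: "D \<subseteq> J" using D C by blast
  have ival: "\<exists>u v. K = {u..v} \<and> u < v \<and> a \<le> u \<and> v \<le> b \<and> P u v" if "K \<in> I ` D" for K
    using that DJ by (auto simp: I_def J_def)
  show thesis
  proof
    show "I ` D division_of \<Union>(I ` D)"
      unfolding division_of_def
    proof (intro conjI ballI impI)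
      show "finite (I ` D)" using D by simp
    next
      fix K assume K: "K \<in> I ` D"
      then show "K \<subseteq> \<Union>(I ` D)" by blast
      from ival[OF K] show "K \<noteq> {}" "\<exists>a b. K = cbox a b" by auto
    next
      fix K1 K2 assume "K1 \<in> I ` D" "K2 \<in> I ` D" "K1 \<noteq> K2"
      then obtain i j where "i \<in> D" "j \<in> D" "K1 = I i" "K2 = I j" "i \<noteq> j" by (metis imageE)
      then have "K1 \<inter> K2 = {}" using pairwiseD[OF C(3), of i j] D(2) by (auto simp: disjnt_def)
      then show "interior K1 \<inter> interior K2 = {}" using interior_subset by blast
    qed simp
    show "\<Union>(I ` D) \<subseteq> {a..b}"
    proof (rule Union_least)
      show "K \<subseteq> {a..b}" if "K \<in> I ` D" for K using ival[OF that] by auto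
    qed
    show "Inf K < Sup K \<and> P (Inf K) (Sup K)" if "K \<in> I ` D" for K using ival[OF that] by auto
    show "measure lebesgue (E - \<Union>(I ` D)) < \<eta>" using D by simp
  qed
qed

lemma sum_increments_division:
  fixes f :: "real \<Rightarrow> 'a::real_normed_vector"
  assumes "a \<le> b" "d division_of {a..b}"
  shows "(\<Sum>K\<in>d. f (Sup K) - f (Inf K)) = f b - f a"
proof -
  let ?p = "(\<lambda>K. (Inf K, K)) ` d"
  have "?p tagged_division_of {a..b}"
    unfolding tagged_division_of_def tagged_partial_division_of_def
  proof (intro conjI allI impI)
    show "finite ?p" using assms(2) by (simp add: division_of_finite)
  next
    fix x K assume "(x, K) \<in> ?p"
    then have K: "K \<in> d" "x = Inf K" by auto
    obtain u v where uv: "K = cbox u v" using division_ofD(4)[OF assms(2) K(1)] by blast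
    then show "x \<in> K" "K \<subseteq> {a..b}" "\<exists>a b. K = cbox a b"
      using division_ofD(2,3)[OF assms(2) K(1)] K(2) by auto
  next
    fix x1 K1 x2 K2 assume "(x1, K1) \<in> ?p \<and> (x2, K2) \<in> ?p \<and> (x1, K1) \<noteq> (x2, K2)"
    then show "interior K1 \<inter> interior K2 = {}" using division_ofD(5)[OF assms(2)] by auto
  next
    have "{K. \<exists>x. (x, K) \<in> ?p} = d" by auto
    then show "\<Union>{K. \<exists>x. (x, K) \<in> ?p} = {a..b}" using division_ofD(6)[OF assms(2)] by simp
  qed
  from additive_tagged_division_1[OF assms(1) this, of f]
  show ?thesis by (subst (asm) sum.reindex) (auto simp: inj_on_def)
qed

lemma division_interval:
  assumes "d division_of T" "K \<in> d"
  shows "measure lborel K = Sup K - (Inf K :: real)" "Inf K \<le> Sup K" "K = {Inf K..Sup K}"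
proof -
  obtain u v where uv: "K = {u..v}" using division_ofD(4)[OF assms] by auto
  have "u \<le> v" using division_ofD(3)[OF assms] uv by simp
  then show "measure lborel K = Sup K - Inf K" "Inf K \<le> Sup K" "K = {Inf K..Sup K}" using uv by auto
qed

text \<open>If the intervals of \<open>d\<close> fill \<open>[a, b]\<close> up to a small length, the gaps form a division of small total
length, and absolute continuity bounds the increments over the gaps.\<close>

lemma abs_cont_on_increment_approx:
  fixes f :: "real \<Rightarrow> 'a::real_normed_vector"
  assumes f: "abs_cont_on a b f" and ab: "a \<le> b" and \<epsilon>: "\<epsilon> > 0"
  obtains \<eta> where "\<eta> > 0" "\<And>d. d division_of \<Union>d \<Longrightarrow> \<Union>d \<subseteq> {a..b} \<Longrightarrow> b - a - (\<Sum>K\<in>d. Sup K - Inf K) < \<eta> \<Longrightarrow>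
     norm (f b - f a - (\<Sum>K\<in>d. f (Sup K) - f (Inf K))) < \<epsilon>"
proof -
  from f \<epsilon> obtain \<eta> where \<eta>: "\<eta> > 0" 
    and H: "\<And>d T. d division_of T \<Longrightarrow> T \<subseteq> {a..b} \<Longrightarrow> (\<Sum>K\<in>d. Sup K - Inf K) < \<eta> \<Longrightarrow>
        (\<Sum>K\<in>d. norm (f (Sup K) - f (Inf K))) < \<epsilon>"
    unfolding abs_cont_on_def by meson
  show thesis
  proof (rule that[OF \<eta>])
    fix d :: "real set set" assume d: "d division_of \<Union>d" "\<Union>d \<subseteq> {a..b}" and m: "b - a - (\<Sum>K\<in>d. Sup K - Inf K) < \<eta>"
    have "\<Union>d \<subseteq> cbox a b" using d(2) by simp
    then obtain q where "d \<subseteq> q" "q division_of cbox a b"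
      by (rule partial_division_extend_interval[OF d(1)])
    then have q: "d \<subseteq> q" "q division_of {a..b}" by simp_all
    have fq: "finite q" using q by (simp add: division_of_finite)
    have r: "(q - d) division_of \<Union>(q - d)" 
    proof (rule division_of_subset)
      show "q division_of \<Union>q" using q(2) by (simp only: division_ofD(6)[OF q(2)])
    qed auto
    have split: "(\<Sum>K\<in>q. F K) = (\<Sum>K\<in>d. F K) + (\<Sum>K\<in>q - d. F K)" for F :: "real set \<Rightarrow> 'c::ab_group_add"
      using sum.subset_diff[OF q(1) fq, of F] by (simp add: add.commute)
    have "(\<Sum>K\<in>q. Sup K - Inf K) = b - a" using sum_increments_division[OF ab q(2), of "\<lambda>x. x"] .
    with m have "(\<Sum>K\<in>q-d. Sup K - Inf K) < \<eta>" by (simp add: split)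
    moreover have "\<Union>(q - d) \<subseteq> {a..b}" using q(2) by blast
    ultimately have "(\<Sum>K\<in>q-d. norm (f (Sup K) - f (Inf K))) < \<epsilon>" using H[OF r] by blast
    moreover have "f b - f a - (\<Sum>K\<in>d. f (Sup K) - f (Inf K)) = (\<Sum>K\<in>q-d. f (Sup K) - f (Inf K))"
      using sum_increments_division[OF ab q(2), of f] by (simp add: split algebra_simps)
    ultimately show "norm (f b - f a - (\<Sum>K\<in>d. f (Sup K) - f (Inf K))) < \<epsilon>"
      using norm_sum[of "\<lambda>K. f (Sup K) - f (Inf K)" "q - d"] by simp
  qed
qed

lemma measure_Union_division:
  fixes d :: "real set set"
  assumes "d division_of \<Union>d"
  shows "measure lebesgue (\<Union>d) \<le> (\<Sum>K\<in>d. Sup K - Inf K)" "\<Union>d \<in> sets lebesgue"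
proof -
  have K: "K \<in> sets lebesgue" "emeasure lebesgue K < \<infinity>" if "K \<in> d" for K using division_ofD(4)[OF assms that] by (auto simp: emeasure_lborel_Icc_eq)
  show "\<Union>d \<in> sets lebesgue" using K division_of_finite[OF assms] by blast
  have "measure lebesgue (\<Union>K\<in>d. K) \<le> (\<Sum>K\<in>d. measure lebesgue K)"
    using K division_of_finite[OF assms] by (intro measure_UNION_le) auto
  also have "\<dots> = (\<Sum>K\<in>d. Sup K - Inf K)"
    using division_interval(1)[OF assms] division_ofD(4)[OF assms]
    by (intro sum.cong) (fastforce simp: measure_completion)+
  finally show "measure lebesgue (\<Union>d) \<le> (\<Sum>K\<in>d. Sup K - Inf K)" by simp
qed

text \<open>The uniqueness principle. Almost all of \<open>[a, b]\<close> is filled by disjoint intervals on which \<open>f\<close> loses at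
most \<open>\<epsilon>\<close> times their length, and the rest hardly contributes. Only some small intervals at \<open>x\<close> are
assumed to be good, which is all that an upper limit of difference quotients provides.\<close>

lemma abs_cont_on_nonneg_quotients_imp_le:
  fixes f :: "real \<Rightarrow> real"
  assumes f: "abs_cont_on a b f" and ab: "a < b" and N: "negligible N"
    and cov: "\<And>x \<epsilon> \<delta>. x \<in> {a<..<b} - N \<Longrightarrow> \<epsilon> > 0 \<Longrightarrow> \<delta> > 0 \<Longrightarrow>
        \<exists>u v. u < v \<and> u \<le> x \<and> x \<le> v \<and> v - u < \<delta> \<and> f v - f u \<ge> - \<epsilon> * (v - u)"
  shows "f a \<le> f b"
proof (rule field_le_epsilon)
  fix e :: real assume e: "e > 0"
  define \<epsilon> where "\<epsilon> = e / 2 / (b - a)"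
  have \<epsilon>: "\<epsilon> > 0" using e ab by (simp add: \<epsilon>_def)
  have e2: "e / 2 > 0" using e by simp
  obtain \<eta> where \<eta>: "\<eta> > 0" and H: "\<And>d. d division_of \<Union>d \<Longrightarrow> \<Union>d \<subseteq> {a..b} \<Longrightarrow> b - a - (\<Sum>K\<in>d. Sup K - Inf K) < \<eta> \<Longrightarrow>
     norm (f b - f a - (\<Sum>K\<in>d. f (Sup K) - f (Inf K))) < e / 2"
    using abs_cont_on_increment_approx[OF f less_imp_le[OF ab] e2] by blast
  let ?E = "{a<..<b} - N"
  have E: "?E \<in> sets lebesgue" using N by (simp add: negligible_imp_sets sets.Diff)
  obtain d where d: "d division_of \<Union>d" "\<Union>d \<subseteq> {a..b}"
    "\<And>K. K \<in> d \<Longrightarrow> Inf K < Sup K \<and> f (Sup K) - f (Inf K) \<ge> - \<epsilon> * (Sup K - Inf K)" "measure lebesgue (?E - \<Union>d) < \<eta>"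
    by (rule Vitali_finite_intervals[where P = "\<lambda>u v. f v - f u \<ge> - \<epsilon> * (v - u)", OF E Diff_subset \<eta> cov[OF _ \<epsilon>]]) (assumption | rule that)+
  have "b - a = measure lebesgue ?E"
  proof -
    have "negligible ({a<..<b} - ?E \<union> (?E - {a<..<b}))" by (rule negligible_subset[OF N]) auto
    then have "measure lebesgue ?E = measure lebesgue {a<..<b}"
      by (intro measure_negligible_symdiff) auto
    then show ?thesis using ab by simp
  qed
  also have "\<dots> \<le> measure lebesgue ((?E - \<Union>d) \<union> \<Union>d)"
  proof (rule measure_mono_fmeasurable)
    show "?E - \<Union>d \<union> \<Union>d \<in> lmeasurable"
    proof (rule fmeasurableI2[of "{a..b}"])
      show "?E - \<Union>d \<union> \<Union>d \<subseteq> {a..b}" using d(2) by auto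
      show "?E - \<Union>d \<union> \<Union>d \<in> sets lebesgue"
        using E measure_Union_division(2)[OF d(1)] by (metis sets.Diff sets.Un)
    qed auto
  qed (use E in auto)
  also have "\<dots> \<le> measure lebesgue (?E - \<Union>d) + measure lebesgue (\<Union>d)"
    using E measure_Union_division(2)[OF d(1)] by (intro measure_Un_le) auto
  also have "\<dots> < \<eta> + (\<Sum>K\<in>d. Sup K - Inf K)" using d(4) measure_Union_division(1)[OF d(1)] by simp
  finally have 1: "norm (f b - f a - (\<Sum>K\<in>d. f (Sup K) - f (Inf K))) < e / 2" by (intro H d) simp
  have "(\<Sum>K\<in>d. measure lborel K) \<le> measure lborel {a..b}"
    using subadditive_content_division[OF d(1), of a b] d(2) by simp
  then have "(\<Sum>K\<in>d. Sup K - Inf K) \<le> b - a" 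
    using division_interval(1)[OF d(1)] ab by simp
  then have "\<epsilon> * (\<Sum>K\<in>d. Sup K - Inf K) \<le> \<epsilon> * (b - a)" using \<epsilon> by (intro mult_left_mono) auto
  also have "\<epsilon> * (b - a) = e / 2" using ab by (simp add: \<epsilon>_def field_simps)
  finally have "- (e / 2) \<le> - \<epsilon> * (\<Sum>K\<in>d. Sup K - Inf K)" by simp
  also have "\<dots> \<le> (\<Sum>K\<in>d. f (Sup K) - f (Inf K))"
    unfolding sum_distrib_left using d(3) by (intro sum_mono) auto
  finally show "f a \<le> f b + e" using 1 unfolding real_norm_def by linarith
qed

text \<open>A density that is exceeded by difference quotients of \<open>f\<close> cannot have a larger integral than the
increments of \<open>f\<close> can reach. Since \<open>\<integral>h\<close> is itself differentiable with derivative \<open>h\<close>, intervals on which \<open>f\<close>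
grows almost as fast as \<open>h x\<close> are intervals on which \<open>f\<close> grows almost as much as \<open>\<integral>h\<close>. This shows that
the candidate density of an absolutely continuous function is integrable.\<close>

lemma integral_le_variation:
  fixes f h :: "real \<Rightarrow> real"
  assumes ab: "a < b" and V: "\<And>d. d division_of \<Union>d \<Longrightarrow> \<Union>d \<subseteq> {a..b} \<Longrightarrow> (\<Sum>K\<in>d. f (Sup K) - f (Inf K)) \<le> V"
    and h: "h \<in> borel_measurable lebesgue" "\<And>x. 0 \<le> h x" "\<And>x. h x \<le> c" and N: "negligible N"
    and cov: "\<And>x \<epsilon> \<delta>. x \<in> {a<..<b} - N \<Longrightarrow> h x > 0 \<Longrightarrow> \<epsilon> > 0 \<Longrightarrow> \<delta> > 0 \<Longrightarrow>
        \<exists>u v. u < v \<and> u \<le> x \<and> x \<le> v \<and> v - u < \<delta> \<and> f v - f u \<ge> (h x - \<epsilon>) * (v - u)"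
  shows "integral {a..b} h \<le> V" "h absolutely_integrable_on {a..b}"
proof -
  have c0: "c \<ge> 0" using h(2,3) order_trans by blast
  have hint: "set_integrable lebesgue S h" if "S \<in> sets lebesgue" "S \<subseteq> {a..b}" for S
    unfolding set_integrable_def
  proof (rule Bochner_Integration.integrable_bound[of _ "\<lambda>x. indicator {a..b} x *\<^sub>R c"])
    show "integrable lebesgue (\<lambda>x. indicator {a..b} x *\<^sub>R c)"
      by (intro integrable_scaleR_left impI integrable_real_indicator) (auto simp: emeasure_lborel_Icc_eq)
    show "(\<lambda>x. indicator S x *\<^sub>R h x) \<in> borel_measurable lebesgue" using h(1) that by measurable
    show "AE x in lebesgue. norm (indicator S x *\<^sub>R h x) \<le> norm (indicator {a..b} x *\<^sub>R c)"
      using h(2,3) c0 that(2) by (intro AE_I2) (auto simp: indicator_def)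
  qed
  show habs: "h absolutely_integrable_on {a..b}" by (intro hint) auto
  have hi: "h integrable_on {a..b}" using habs by (rule set_lebesgue_integral_eq_integral)
  define H where "H = (\<lambda>x. integral {a..x} h)"
  define N2 where "N2 = {x\<in>{a<..<b}. \<not> (H has_vector_derivative h x) (at x)}"
  have N2: "negligible N2" unfolding N2_def H_def by (rule indefinite_integral_has_vector_derivative_AE[OF hi])
  define E where "E = ({a<..<b} \<inter> {x. h x > 0}) - (N \<union> N2)"
  have "{x \<in> space lebesgue. h x > 0} \<in> sets lebesgue" using h(1) by measurable
  then have "{x. h x > 0} \<in> sets lebesgue" by simp
  then have E: "E \<in> sets lebesgue" "E \<subseteq> {a<..<b}"
    using negligible_imp_sets[OF negligible_Un[OF N N2]] unfolding E_def by (auto intro!: sets.Diff sets.Int)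
  have H_diff: "integral {x..y} h = H y - H x" if "a \<le> x" "x \<le> y" "y \<le> b" for x y
  proof -
    have "h integrable_on {a..y}" by (rule integrable_on_subinterval[OF hi]) (use that in auto)
    from Henstock_Kurzweil_Integration.integral_combine[OF that(1,2) this] show ?thesis by (simp add: H_def algebra_simps)
  qed
  show "integral {a..b} h \<le> V"
  proof (rule field_le_epsilon)
    fix e :: real assume e: "e > 0"
    define \<epsilon> where "\<epsilon> = e / 4 / (b - a)"
    have \<epsilon>: "\<epsilon> > 0" using e ab by (simp add: \<epsilon>_def)
    define \<eta> where "\<eta> = e / 2 / (c + 1)"
    have \<eta>: "\<eta> > 0" using e c0 by (simp add: \<eta>_def)
    have cov': "\<exists>u v. u < v \<and> u \<le> x \<and> x \<le> v \<and> v - u < \<delta> \<and> f v - f u \<ge> H v - H u - 2 * \<epsilon> * (v - u)"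
      if x: "x \<in> E" and \<delta>: "\<delta> > 0" for x \<delta>
    proof -
      from x have x': "x \<in> {a<..<b} - N" "h x > 0" "(H has_vector_derivative h x) (at x)"
        by (auto simp: E_def N2_def)
      from x'(3) \<epsilon> obtain \<delta>2 where \<delta>2: "\<delta>2 > 0"
        and lin: "\<And>y. norm (y - x) < \<delta>2 \<Longrightarrow> norm (H y - H x - (y - x) *\<^sub>R h x) \<le> \<epsilon> * norm (y - x)"
        unfolding has_vector_derivative_def has_derivative_within_alt by blast
      have "min \<delta> \<delta>2 > 0" using \<delta> \<delta>2 by simp
      from cov[OF x'(1,2) \<epsilon> this] obtain u v where uv: "u < v" "u \<le> x" "x \<le> v" "v - u < min \<delta> \<delta>2"
        "f v - f u \<ge> (h x - \<epsilon>) * (v - u)" by blast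
      have "H v - H x - (v - x) * h x \<le> \<epsilon> * (v - x)" using lin[of v] uv by auto
      moreover have "- (H u - H x - (u - x) * h x) \<le> \<epsilon> * (x - u)" using lin[of u] uv by auto
      ultimately have "H v - H u \<le> (h x + \<epsilon>) * (v - u)" by (simp add: algebra_simps)
      then have "f v - f u \<ge> H v - H u - 2 * \<epsilon> * (v - u)" using uv(5) by (simp add: algebra_simps)
      then show ?thesis using uv by auto
    qed
    obtain d where d: "d division_of \<Union>d" "\<Union>d \<subseteq> {a..b}"
      "\<And>K. K \<in> d \<Longrightarrow> Inf K < Sup K \<and> f (Sup K) - f (Inf K) \<ge> H (Sup K) - H (Inf K) - 2 * \<epsilon> * (Sup K - Inf K)"
      "measure lebesgue (E - \<Union>d) < \<eta>"
      by (rule Vitali_finite_intervals[where P = "\<lambda>u v. f v - f u \<ge> H v - H u - 2 * \<epsilon> * (v - u)", OF E \<eta> cov'])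
         (assumption | rule that)+
    have Ud: "\<Union>d \<in> sets lebesgue" by (rule measure_Union_division[OF d(1)])
    have "(\<Sum>K\<in>d. measure lborel K) \<le> measure lborel {a..b}"
      using subadditive_content_division[OF d(1), of a b] d(2) by simp
    then have "(\<Sum>K\<in>d. Sup K - Inf K) \<le> b - a" 
      using division_interval(1)[OF d(1)] ab by simp
    then have "2 * \<epsilon> * (\<Sum>K\<in>d. Sup K - Inf K) \<le> 2 * \<epsilon> * (b - a)" using \<epsilon> by (intro mult_left_mono) auto
    also have "2 * \<epsilon> * (b - a) = e / 2" using ab by (simp add: \<epsilon>_def field_simps)
    finally have s1: "2 * \<epsilon> * (\<Sum>K\<in>d. Sup K - Inf K) \<le> e / 2" .
    have "integral (\<Union>d) h = (\<Sum>K\<in>d. integral K h)"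
      using has_integral_combine_division_topdown[OF hi d(1,2)] by (rule integral_unique)
    also have "\<dots> = (\<Sum>K\<in>d. H (Sup K) - H (Inf K))"
    proof (rule sum.cong[OF refl])
      fix K assume K: "K \<in> d"
      note dm = division_interval[OF d(1) K]
      have "K \<subseteq> {a..b}" using K d(2) by blast
      then have "a \<le> Inf K" "Sup K \<le> b" using dm(2) by (subst (asm) dm(3), simp)+
      then show "integral K h = H (Sup K) - H (Inf K)" using H_diff[of "Inf K" "Sup K"] dm(2,3) by simp
    qed
    also have "\<dots> \<le> (\<Sum>K\<in>d. f (Sup K) - f (Inf K) + 2 * \<epsilon> * (Sup K - Inf K))"
      using d(3) by (intro sum_mono) (simp add: algebra_simps)
    also have "\<dots> = (\<Sum>K\<in>d. f (Sup K) - f (Inf K)) + 2 * \<epsilon> * (\<Sum>K\<in>d. Sup K - Inf K)"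
      by (simp only: sum.distrib sum_distrib_left)
    also have "\<dots> \<le> V + e / 2" using V[OF d(1,2)] s1 by simp
    finally have s2: "integral (\<Union>d) h \<le> V + e / 2" .
    have EU: "E - \<Union>d \<in> sets lebesgue" using E Ud by blast
    have fin: "emeasure lebesgue (E - \<Union>d) < \<infinity>"
    proof -
      have "emeasure lebesgue (E - \<Union>d) \<le> emeasure lebesgue {a..b}" using E by (intro emeasure_mono) auto
      then show ?thesis by (simp add: emeasure_lborel_Icc_eq le_less_trans)
    qed
    have "integral {a..b} h = (LINT x|lebesgue. indicator {a..b} x *\<^sub>R h x)"
      using set_lebesgue_integral_eq_integral(2)[OF habs] by (simp add: set_lebesgue_integral_def)
    also have "\<dots> \<le> (LINT x|lebesgue. indicator (\<Union>d) x *\<^sub>R h x + c * indicator (E - \<Union>d) x)"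
    proof (rule integral_mono_AE)
      have "negligible (N \<union> N2 \<union> {a, b})" using N N2 by (intro negligible_Un) auto
      then have "AE x in lebesgue. x \<notin> N \<union> N2 \<union> {a, b}" by (simp only: negligible_iff_null_sets AE_not_in)
      then show "AE x in lebesgue. indicator {a..b} x *\<^sub>R h x \<le> indicator (\<Union>d) x *\<^sub>R h x + c * indicator (E - \<Union>d) x"
      proof eventually_elim
        case (elim x)
        show ?case
        proof (cases "x \<in> \<Union>d \<or> x \<notin> {a..b} \<or> h x \<le> 0")
          case True then show ?thesis using h(2)[of x] d(2) c0 by (auto simp: indicator_def)
        next
          case False
          then have "x \<in> E - \<Union>d" using elim by (auto simp: E_def)
          then show ?thesis using False h(3)[of x] by (auto simp: indicator_def)
        qed
      qed
      show "integrable lebesgue (\<lambda>x. indicator {a..b} x *\<^sub>R h x)" using habs by (simp add: set_integrable_def)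
      show "integrable lebesgue (\<lambda>x. indicator (\<Union>d) x *\<^sub>R h x + c * indicator (E - \<Union>d) x)"
        using hint[OF Ud d(2)] EU fin
        by (intro Bochner_Integration.integrable_add integrable_mult_right impI integrable_real_indicator) (auto simp: set_integrable_def)
    qed
    also have "\<dots> = (LINT x|lebesgue. indicator (\<Union>d) x *\<^sub>R h x) + c * measure lebesgue (E - \<Union>d)"
      using hint[OF Ud d(2)] EU fin
      by (subst Bochner_Integration.integral_add) (auto simp: set_integrable_def intro!: integrable_mult_right integrable_real_indicator)
    also have "(LINT x|lebesgue. indicator (\<Union>d) x *\<^sub>R h x) = integral (\<Union>d) h"
      using set_lebesgue_integral_eq_integral(2)[OF hint[OF Ud d(2)]] by (simp add: set_lebesgue_integral_def)
    also have "c * measure lebesgue (E - \<Union>d) \<le> c * \<eta>" using d(4) c0 by (intro mult_left_mono) auto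
    also have "c * \<eta> \<le> e / 2" using e c0 by (simp add: \<eta>_def field_simps)
    finally show "integral {a..b} h \<le> V + e" using s2 by simp
  qed
qed

lemma abs_cont_onE:
  assumes "abs_cont_on a b f" "\<epsilon> > 0"
  obtains \<delta> where "\<delta> > 0" "\<And>d T. d division_of T \<Longrightarrow> T \<subseteq> {a..b} \<Longrightarrow> (\<Sum>K\<in>d. Sup K - Inf K) < \<delta> \<Longrightarrow>
        (\<Sum>K\<in>d. norm (f (Sup K) - f (Inf K))) < \<epsilon>"
  using assms unfolding abs_cont_on_def by meson

lemma abs_cont_on_diff:
  assumes "abs_cont_on a b f" "abs_cont_on a b g"
  shows "abs_cont_on a b (\<lambda>x. f x - g x)"
  unfolding abs_cont_on_def
proof (intro allI impI)
  fix \<epsilon> :: real assume "\<epsilon> > 0"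
  then have "\<epsilon> / 2 > 0" by simp
  from abs_cont_onE[OF assms(1) this] obtain \<delta>1 where "\<delta>1 > 0" and
     1: "\<And>d T. d division_of T \<Longrightarrow> T \<subseteq> {a..b} \<Longrightarrow> (\<Sum>K\<in>d. Sup K - Inf K) < \<delta>1 \<Longrightarrow>
        (\<Sum>K\<in>d. norm (f (Sup K) - f (Inf K))) < \<epsilon> / 2" by blast
  from abs_cont_onE[OF assms(2) \<open>\<epsilon> / 2 > 0\<close>] obtain \<delta>2 where "\<delta>2 > 0" and
     2: "\<And>d T. d division_of T \<Longrightarrow> T \<subseteq> {a..b} \<Longrightarrow> (\<Sum>K\<in>d. Sup K - Inf K) < \<delta>2 \<Longrightarrow>
        (\<Sum>K\<in>d. norm (g (Sup K) - g (Inf K))) < \<epsilon> / 2" by blast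
  note \<delta> = \<open>\<delta>1 > 0\<close> \<open>\<delta>2 > 0\<close>
  show "\<exists>\<delta>>0. \<forall>d T. d division_of T \<and> T \<subseteq> {a..b} \<and> (\<Sum>K\<in>d. Sup K - Inf K) < \<delta> \<longrightarrow>
        (\<Sum>K\<in>d. norm (f (Sup K) - g (Sup K) - (f (Inf K) - g (Inf K)))) < \<epsilon>"
  proof (intro exI[of _ "min \<delta>1 \<delta>2"] conjI allI impI; (elim conjE)?)
    fix d T assume d: "d division_of T" "T \<subseteq> {a..b}" "(\<Sum>K\<in>d. Sup K - Inf K) < min \<delta>1 \<delta>2"
    have "(\<Sum>K\<in>d. norm (f (Sup K) - g (Sup K) - (f (Inf K) - g (Inf K)))) \<le>
       (\<Sum>K\<in>d. norm (f (Sup K) - f (Inf K)) + norm (g (Sup K) - g (Inf K)))"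
    proof (rule sum_mono)
      fix K
      have "f (Sup K) - g (Sup K) - (f (Inf K) - g (Inf K)) = (f (Sup K) - f (Inf K)) - (g (Sup K) - g (Inf K))" by simp
      then show "norm (f (Sup K) - g (Sup K) - (f (Inf K) - g (Inf K))) \<le> norm (f (Sup K) - f (Inf K)) + norm (g (Sup K) - g (Inf K))"
        by (metis norm_triangle_ineq4)
    qed
    then show "(\<Sum>K\<in>d. norm (f (Sup K) - g (Sup K) - (f (Inf K) - g (Inf K)))) < \<epsilon>"
      using 1[OF d(1,2)] 2[OF d(1,2)] d(3) by (simp add: sum.distrib)
  qed (use \<delta> in auto)
qed

lemma abs_cont_on_imp_continuous:
  assumes "\<And>a b. abs_cont_on a b f"
  shows "continuous_on UNIV f"
  unfolding continuous_on_iff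
proof (intro ballI allI impI)
  fix x e :: real assume "e > 0"
  with assms[of "x - 1" "x + 1"] obtain \<delta> where \<delta>: "\<delta> > 0" and
     1: "\<And>d T. d division_of T \<Longrightarrow> T \<subseteq> {x-1..x+1} \<Longrightarrow> (\<Sum>K\<in>d. Sup K - Inf K) < \<delta> \<Longrightarrow>
        (\<Sum>K\<in>d. norm (f (Sup K) - f (Inf K))) < e"
    unfolding abs_cont_on_def by meson
  show "\<exists>d>0. \<forall>x'\<in>UNIV. dist x' x < d \<longrightarrow> dist (f x') (f x) < e"
  proof (intro exI[of _ "min \<delta> 1"] conjI ballI impI)
    fix y assume y: "dist y x < min \<delta> 1"
    have "{cbox (min x y) (max x y)} division_of cbox (min x y) (max x y)" by (rule division_of_self) auto
    moreover have "cbox (min x y) (max x y) \<subseteq> {x - 1..x + 1}" using y by (auto simp: dist_real_def)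
    moreover have "(\<Sum>K\<in>{cbox (min x y) (max x y)}. Sup K - Inf K) < \<delta>" using y by (auto simp: dist_real_def max_def min_def split: if_splits)
    ultimately have "(\<Sum>K\<in>{cbox (min x y) (max x y)}. norm (f (Sup K) - f (Inf K))) < e" by (rule 1)
    then have "norm (f (max x y) - f (min x y)) < e" by simp
    then show "dist (f y) (f x) < e" by (cases "x \<le> y") (auto simp: dist_norm norm_minus_commute max_def min_def)
  qed (use \<delta> in auto)
qed

text \<open>An upper limit along a fixed sequence of steps, instead of a Dini derivate, makes \<open>G\<close> measurable by
  construction. It may be infinite; \<open>g\<close> then has the default value zero, which happens on a null set only.\<close>

context
  fixes f :: "real \<Rightarrow> real" and s :: "nat \<Rightarrow> real" and G :: "real \<Rightarrow> ereal" and g :: "real \<Rightarrow> real"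
  assumes f: "\<And>a b. abs_cont_on a b f"
  defines "s \<equiv> \<lambda>n. inverse (real (Suc n))"
  defines "G \<equiv> \<lambda>x. limsup (\<lambda>n. ereal ((f (x + s n) - f x) / s n))"
  defines "g \<equiv> \<lambda>x. real_of_ereal (G x)"
begin

lemma quotient_limsup_measurable: "G \<in> borel_measurable borel"
proof -
  have c: "continuous_on UNIV f" by (rule abs_cont_on_imp_continuous[OF f])
  have "(\<lambda>x. (f (x + s n) - f x) / s n) \<in> borel_measurable borel" for n
    by (intro borel_measurable_continuous_onI continuous_intros continuous_on_subset[OF c] continuous_on_compose2[OF c])
       (auto simp: s_def)
  then show ?thesis unfolding G_def by measurable
qed

lemma quotient_limsup_gt:
  assumes "G x > ereal c" "\<delta> > 0"
  shows "\<exists>u v. u < v \<and> u \<le> x \<and> x \<le> v \<and> v - u < \<delta> \<and> f v - f u \<ge> c * (v - u)"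
proof (rule ccontr)
  assume no: "\<not> ?thesis"
  have "s \<longlonglongrightarrow> 0" unfolding s_def by (rule LIMSEQ_inverse_real_of_nat)
  then have "eventually (\<lambda>n. s n < \<delta>) sequentially" using assms(2) by (rule order_tendstoD)
  then have "eventually (\<lambda>n. ereal ((f (x + s n) - f x) / s n) \<le> ereal c) sequentially"
  proof eventually_elim
    case (elim n)
    have "s n > 0" by (simp add: s_def)
    moreover have "\<not> (f (x + s n) - f x \<ge> c * (x + s n - x))"
    proof
      assume "f (x + s n) - f x \<ge> c * (x + s n - x)"
      then have "x < x + s n \<and> x \<le> x \<and> x \<le> x + s n \<and> x + s n - x < \<delta> \<and> f (x + s n) - f x \<ge> c * (x + s n - x)"
        using elim \<open>s n > 0\<close> by simp
      then show False using no by blast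
    qed
    ultimately show ?case by (simp add: divide_le_eq)
  qed
  then have "G x \<le> ereal c" unfolding G_def by (rule Limsup_bounded)
  with assms(1) show False by simp
qed

lemma quotient_limsup_lt:
  assumes "G x < ereal c" "\<delta> > 0"
  shows "\<exists>u v. u < v \<and> u \<le> x \<and> x \<le> v \<and> v - u < \<delta> \<and> f v - f u \<le> c * (v - u)"
proof -
  have "s \<longlonglongrightarrow> 0" unfolding s_def by (rule LIMSEQ_inverse_real_of_nat)
  then have "eventually (\<lambda>n. s n < \<delta>) sequentially" using assms(2) by (rule order_tendstoD)
  moreover have "eventually (\<lambda>n. ereal ((f (x + s n) - f x) / s n) < ereal c) sequentially"
    using assms(1) unfolding G_def by (rule Limsup_lessD)
  ultimately have "eventually (\<lambda>n. s n < \<delta> \<and> (f (x + s n) - f x) / s n < c) sequentially"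
    by eventually_elim simp
  then obtain n where n: "s n < \<delta>" "(f (x + s n) - f x) / s n < c"
    using eventually_happens'[OF sequentially_bot] by fast
  have "s n > 0" by (simp add: s_def)
  have "f (x + s n) - f x \<le> c * (x + s n - x)" using n(2) \<open>s n > 0\<close> by (simp add: divide_less_eq)
  then show ?thesis using n(1) \<open>s n > 0\<close> by (intro exI[of _ x] exI[of _ "x + s n"]) simp
qed

text \<open>On an interval so short that all increments of \<open>f\<close> add up to at most \<open>1\<close>, the comparison of
densities with increments bounds the integrals of the truncations of the positive and the negative part of \<open>G\<close>; monotone convergence
removes the truncation. In particular \<open>G\<close> is finite almost everywhere.\<close>

lemma quotient_limsup_locally_integrable:
  assumes xy: "x < y" and V: "\<And>d. d division_of \<Union>d \<Longrightarrow> \<Union>d \<subseteq> {x..y} \<Longrightarrow> (\<Sum>K\<in>d. \<bar>f (Sup K) - f (Inf K)\<bar>) \<le> 1"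
  shows "g absolutely_integrable_on {x..y}" "negligible {t\<in>{x..y}. \<bar>G t\<bar> = \<infinity>}"
proof -
  have Gm: "G \<in> borel_measurable lebesgue" using quotient_limsup_measurable by (simp add: measurable_completion)
  define hp where "hp = (\<lambda>n t. real_of_ereal (min (ereal (real n)) (max 0 (G t))))"
  define hm where "hm = (\<lambda>n t. real_of_ereal (min (ereal (real n)) (max 0 (- G t))))"
  have hpm: "hp n \<in> borel_measurable lebesgue" "hm n \<in> borel_measurable lebesgue" for n
    unfolding hp_def hm_def using Gm by measurable
  have hp0: "0 \<le> hp n t" "hp n t \<le> real n" "0 \<le> hm n t" "hm n t \<le> real n" for n t
    unfolding hp_def hm_def by (cases "G t"; auto simp: min_def max_def zero_ereal_def)+
  have Gp: "G t > ereal (hp n t - \<epsilon>)" if "hp n t > 0" "\<epsilon> > 0" for n t \<epsilon>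
    using that unfolding hp_def by (cases "G t") (auto simp: min_def max_def zero_ereal_def split: if_splits)
  have Gn: "G t < ereal (- (hm n t - \<epsilon>))" if "hm n t > 0" "\<epsilon> > 0" for n t \<epsilon>
    using that unfolding hm_def by (cases "G t") (auto simp: min_def max_def zero_ereal_def split: if_splits)
  have Vp: "(\<Sum>K\<in>d. f (Sup K) - f (Inf K)) \<le> 1" "(\<Sum>K\<in>d. - f (Sup K) - - f (Inf K)) \<le> 1"
    if "d division_of \<Union>d" "\<Union>d \<subseteq> {x..y}" for d
  proof -
    have "(\<Sum>K\<in>d. f (Sup K) - f (Inf K)) \<le> (\<Sum>K\<in>d. \<bar>f (Sup K) - f (Inf K)\<bar>)" 
         "(\<Sum>K\<in>d. - f (Sup K) - - f (Inf K)) \<le> (\<Sum>K\<in>d. \<bar>f (Sup K) - f (Inf K)\<bar>)" by (intro sum_mono; simp)+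
    then show "(\<Sum>K\<in>d. f (Sup K) - f (Inf K)) \<le> 1" "(\<Sum>K\<in>d. - f (Sup K) - - f (Inf K)) \<le> 1" using V[OF that] by linarith+
  qed
  have ip: "integral {x..y} (hp n) \<le> 1 \<and> hp n absolutely_integrable_on {x..y}" for n
    using integral_le_variation[OF xy Vp(1) hpm(1) hp0(1,2) negligible_empty quotient_limsup_gt[OF Gp]] by simp
  have covm: "\<exists>u v. u < v \<and> u \<le> t \<and> t \<le> v \<and> v - u < \<delta> \<and> - f v - - f u \<ge> (hm n t - \<epsilon>) * (v - u)"
    if "hm n t > 0" "\<epsilon> > 0" "\<delta> > 0" for n t \<epsilon> \<delta>
    using quotient_limsup_lt[OF Gn[OF that(1,2)] that(3)] by (auto simp: algebra_simps)
  have im: "integral {x..y} (hm n) \<le> 1 \<and> hm n absolutely_integrable_on {x..y}" for n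
    using integral_le_variation[OF xy Vp(2) hpm(2) hp0(3,4) negligible_empty covm] by simp
  \<comment> \<open>\<open>k n\<close> is \<open>|G|\<close> cut off at height \<open>n\<close>, so its supremum detects the points where \<open>G\<close> is infinite.\<close>
  define k where "k = (\<lambda>n t. ennreal (indicator {x..y} t *\<^sub>R (hp n t + hm n t)))"
  have km: "k n \<in> borel_measurable lebesgue" for n unfolding k_def using hpm[of n] by (intro measurable_compose[OF _ measurable_ennreal] borel_measurable_scaleR borel_measurable_add borel_measurable_indicator) auto
  have kint: "(\<integral>\<^sup>+t. k n t \<partial>lebesgue) \<le> 2" for n
  proof -
    have a: "(\<lambda>t. hp n t + hm n t) absolutely_integrable_on {x..y}" using ip im by (intro set_integral_add) auto
    have "(\<integral>\<^sup>+t. k n t \<partial>lebesgue) = ennreal (LINT t|lebesgue. indicator {x..y} t *\<^sub>R (hp n t + hm n t))"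
      unfolding k_def using a hp0 by (intro nn_integral_eq_integral) (auto simp: set_integrable_def)
    also have "(LINT t|lebesgue. indicator {x..y} t *\<^sub>R (hp n t + hm n t)) = integral {x..y} (\<lambda>t. hp n t + hm n t)"
      using set_lebesgue_integral_eq_integral(2)[OF a] by (simp add: set_lebesgue_integral_def)
    also have "\<dots> = integral {x..y} (hp n) + integral {x..y} (hm n)"
      using ip im by (intro Henstock_Kurzweil_Integration.integral_add set_lebesgue_integral_eq_integral(1)) auto
    also have "\<dots> \<le> 2" using ip[of n] im[of n] by linarith
    finally show ?thesis by (simp add: ennreal_leI flip: ennreal_numeral)
  qed
  have "incseq k"
  proof (intro incseq_SucI le_funI)
    fix n t
    have "hp n t \<le> hp (Suc n) t" "hm n t \<le> hm (Suc n) t"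
      unfolding hp_def hm_def by (cases "G t"; auto simp: min_def max_def zero_ereal_def)+
    then show "k n t \<le> k (Suc n) t" unfolding k_def by (intro ennreal_leI scaleR_left_mono add_mono) auto
  qed
  define S where "S = (\<lambda>t. SUP n. k n t)"
  have Sm: "S \<in> borel_measurable lebesgue" unfolding S_def using km by measurable
  have "(\<integral>\<^sup>+t. S t \<partial>lebesgue) = (SUP n. \<integral>\<^sup>+t. k n t \<partial>lebesgue)"
    unfolding S_def by (rule nn_integral_monotone_convergence_SUP[OF \<open>incseq k\<close> km])
  also have "\<dots> \<le> 2" using kint by (rule SUP_least)
  finally have Sint: "(\<integral>\<^sup>+t. S t \<partial>lebesgue) \<le> 2" .
  then have "(\<integral>\<^sup>+t. S t \<partial>lebesgue) \<noteq> \<infinity>" by (auto simp: top_unique)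
  then have AE: "AE t in lebesgue. S t \<noteq> \<infinity>" by (intro nn_integral_noteq_infinite Sm)
  have inf: "S t = \<infinity>" if t: "t \<in> {x..y}" "\<bar>G t\<bar> = \<infinity>" for t
  proof -
    have "k n t = ennreal (real n)" for n
      using t unfolding k_def hp_def hm_def by (cases "G t") (auto simp: min_def max_def zero_ereal_def)
    then have "S t = (SUP n. of_nat n)" unfolding S_def by (simp add: ennreal_of_nat_eq_real_of_nat)
    then show ?thesis by (simp add: ennreal_SUP_of_nat_eq_top)
  qed
  have bd: "ennreal (norm (indicator {x..y} t *\<^sub>R g t)) \<le> S t" for t
  proof (cases "t \<in> {x..y} \<and> \<bar>G t\<bar> \<noteq> \<infinity>")
    case True
    obtain n where "\<bar>g t\<bar> \<le> real n" using real_arch_simple by blast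
    then have "k n t = ennreal \<bar>g t\<bar>"
      using True unfolding k_def hp_def hm_def g_def by (cases "G t") (auto simp: min_def max_def zero_ereal_def)
    then have "ennreal \<bar>g t\<bar> \<le> S t" unfolding S_def by (metis SUP_upper UNIV_I)
    then show ?thesis using True by simp
  next
    case False
    then show ?thesis using inf[of t] by (cases "t \<in> {x..y}") auto
  qed
  show "negligible {t\<in>{x..y}. \<bar>G t\<bar> = \<infinity>}"
  proof -
    have "AE t in lebesgue. t \<notin> {t\<in>{x..y}. \<bar>G t\<bar> = \<infinity>}" using AE inf by auto
    moreover have "(\<lambda>t. \<bar>G t\<bar>) -` {\<infinity>} \<inter> space lebesgue \<in> sets lebesgue"
      using Gm by (intro measurable_sets[where A=borel] borel_measurable_ereal_abs) auto
    then have "{x..y} \<inter> ((\<lambda>t. \<bar>G t\<bar>) -` {\<infinity>} \<inter> space lebesgue) \<in> sets lebesgue" by (intro sets.Int) auto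
    moreover have "{x..y} \<inter> ((\<lambda>t. \<bar>G t\<bar>) -` {\<infinity>} \<inter> space lebesgue) = {t\<in>{x..y}. \<bar>G t\<bar> = \<infinity>}" by auto
    ultimately show ?thesis unfolding negligible_iff_null_sets by (simp only: AE_iff_null_sets)
  qed
  show "g absolutely_integrable_on {x..y}"
    unfolding set_integrable_def
  proof (rule integrableI_bounded)
    show "(\<lambda>t. indicator {x..y} t *\<^sub>R g t) \<in> borel_measurable lebesgue" unfolding g_def
      by (intro borel_measurable_scaleR borel_measurable_indicator borel_measurable_real_of_ereal Gm) auto
    have "(\<integral>\<^sup>+t. ennreal (norm (indicator {x..y} t *\<^sub>R g t)) \<partial>lebesgue) \<le> (\<integral>\<^sup>+t. S t \<partial>lebesgue)"
      using bd by (intro nn_integral_mono) auto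
    also have "\<dots> < \<infinity>" using Sint by (auto simp: le_less_trans)
    finally show "(\<integral>\<^sup>+t. ennreal (norm (indicator {x..y} t *\<^sub>R g t)) \<partial>lebesgue) < \<infinity>" .
  qed
qed

text \<open>Absolute continuity with \<open>\<epsilon> = 1\<close> supplies a length below which the local statement applies, and
finitely many such intervals cover \<open>[a, b]\<close>.\<close>

lemma quotient_limsup_integrable:
  assumes "a \<le> b"
  shows "g absolutely_integrable_on {a..b}" "negligible {t\<in>{a..b}. \<bar>G t\<bar> = \<infinity>}"
proof -
  obtain \<delta> where \<delta>: "\<delta> > 0" and
     v: "\<And>d T. d division_of T \<Longrightarrow> T \<subseteq> {a..b} \<Longrightarrow> (\<Sum>K\<in>d. Sup K - Inf K) < \<delta> \<Longrightarrow>
        (\<Sum>K\<in>d. norm (f (Sup K) - f (Inf K))) < 1"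
    using abs_cont_onE[OF f, of 1 a b] by auto
  have loc: "g absolutely_integrable_on {x..y} \<and> negligible {t\<in>{x..y}. \<bar>G t\<bar> = \<infinity>}"
    if xy: "a \<le> x" "x < y" "y \<le> b" "y - x < \<delta>" for x y
  proof -
    have "(\<Sum>K\<in>d. \<bar>f (Sup K) - f (Inf K)\<bar>) \<le> 1" if d: "d division_of \<Union>d" "\<Union>d \<subseteq> {x..y}" for d
    proof -
      have "(\<Sum>K\<in>d. measure lborel K) \<le> measure lborel {x..y}"
        using subadditive_content_division[OF d(1), of x y] d(2) by simp
      then have "(\<Sum>K\<in>d. Sup K - Inf K) < \<delta>" using division_interval(1)[OF d(1)] xy by simp
      moreover have "\<Union>d \<subseteq> {a..b}" using d(2) xy by (rule_tac order_trans) auto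
      ultimately show ?thesis using v[OF d(1)] by fastforce
    qed
    then show ?thesis using quotient_limsup_locally_integrable[OF xy(2)] by blast
  qed
  have "g absolutely_integrable_on {a..y} \<and> negligible {t\<in>{a..y}. \<bar>G t\<bar> = \<infinity>}"
    if "a \<le> y" "y \<le> b" "y \<le> a + real n * (\<delta> / 2)" for n y
    using that
  proof (induction n arbitrary: y)
    case 0
    then have "y = a" by simp
    have "{t \<in> {a..a}. \<bar>G t\<bar> = \<infinity>} \<subseteq> {a}" by auto
    then have "negligible {t \<in> {a..a}. \<bar>G t\<bar> = \<infinity>}" using negligible_subset negligible_sing by blast
    moreover have "g absolutely_integrable_on cbox a a" unfolding absolutely_integrable_on_def by (intro conjI integrable_on_refl)
    ultimately show ?case using \<open>y = a\<close> by simp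
  next
    case (Suc n)
    define y0 where "y0 = a + real n * (\<delta> / 2)"
    show ?case
    proof (cases "y \<le> y0")
      case True
      then show ?thesis using Suc unfolding y0_def by blast
    next
      case False
      have y0: "a \<le> y0" "y0 < y" "y - y0 < \<delta>" "y0 \<le> b" using False Suc.prems \<delta> by (auto simp: y0_def field_simps)
      have 1: "g absolutely_integrable_on {a..y0} \<and> negligible {t\<in>{a..y0}. \<bar>G t\<bar> = \<infinity>}"
        using y0 by (intro Suc.IH) (auto simp: y0_def)
      have 2: "g absolutely_integrable_on {y0..y} \<and> negligible {t\<in>{y0..y}. \<bar>G t\<bar> = \<infinity>}"
        using y0 Suc.prems by (intro loc) auto
      have "{a..y} = {a..y0} \<union> {y0..y}" using y0 by auto
      moreover have "{t\<in>{a..y}. \<bar>G t\<bar> = \<infinity>} = {t\<in>{a..y0}. \<bar>G t\<bar> = \<infinity>} \<union> {t\<in>{y0..y}. \<bar>G t\<bar> = \<infinity>}" using y0 by auto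
      ultimately show ?thesis using 1 2 by (simp add: set_integrable_Un negligible_Un del: ivl_disj_un)
    qed
  qed
  moreover obtain n where "b \<le> a + real n * (\<delta> / 2)"
  proof -
    obtain n where "(b - a) / (\<delta> / 2) \<le> real n" using real_arch_simple by blast
    then have "b - a \<le> real n * (\<delta> / 2)" using \<delta> by (simp add: divide_le_eq)
    then show thesis by (intro that[of n]) linarith
  qed
  ultimately show "g absolutely_integrable_on {a..b}" "negligible {t\<in>{a..b}. \<bar>G t\<bar> = \<infinity>}"
    using assms by blast+
qed

text \<open>Off a null set \<open>I = \<integral>g\<close> has derivative \<open>g x\<close>, while \<open>f\<close> has difference quotients close to \<open>g x\<close> at
arbitrarily small scales. Hence the uniqueness principle applies to \<open>f - I\<close> and to \<open>I - f\<close>.\<close>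

lemma quotient_limsup_integral:
  assumes "a \<le> b"
  shows "(g has_integral f b - f a) {a..b}"
proof (cases "a = b")
  case False
  with assms have ab: "a < b" by simp
  note g = quotient_limsup_integrable[OF assms]
  have gi: "g integrable_on {a..b}" using g(1) by (rule set_lebesgue_integral_eq_integral)
  define I where "I = (\<lambda>x. integral {a..x} g)"
  define N2 where "N2 = {x\<in>{a<..<b}. \<not> (I has_vector_derivative g x) (at x)}"
  have N2: "negligible N2" unfolding N2_def I_def by (rule indefinite_integral_has_vector_derivative_AE[OF gi])
  define N where "N = {t\<in>{a..b}. \<bar>G t\<bar> = \<infinity>} \<union> N2"
  have N: "negligible N" unfolding N_def using N2 g(2) by (rule negligible_Un[rotated])
  have I_diff: "(g has_integral I v - I u) {u..v}" if "a \<le> u" "u \<le> v" "v \<le> b" for u v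
  proof -
    have uv: "g integrable_on {a..v}" "g integrable_on {u..v}" by (rule integrable_on_subinterval[OF gi]; use that in auto)+
    from Henstock_Kurzweil_Integration.integral_combine[OF that(1,2) uv(1)] show ?thesis
      using integrable_integral[OF uv(2)] by (metis I_def add_diff_cancel_left')
  qed
  have I: "abs_cont_on a b I" by (rule indefinite_integral_abs_cont_on[OF g(1) I_diff])
  have lin: "\<exists>\<delta>'>0. \<forall>u v. u \<le> x \<and> x \<le> v \<and> v - u < \<delta>' \<longrightarrow> \<bar>I v - I u - g x * (v - u)\<bar> \<le> \<epsilon> * (v - u)"
    if x: "x \<in> {a<..<b} - N" and \<epsilon>: "\<epsilon> > 0" for x \<epsilon>
  proof -
    have "(I has_vector_derivative g x) (at x)" using x by (auto simp: N_def N2_def)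
    with \<epsilon> obtain \<delta> where \<delta>: "\<delta> > 0"
      and l: "\<And>y. norm (y - x) < \<delta> \<Longrightarrow> norm (I y - I x - (y - x) *\<^sub>R g x) \<le> \<epsilon> * norm (y - x)"
      unfolding has_vector_derivative_def has_derivative_within_alt by blast
    show ?thesis
    proof (intro exI[of _ \<delta>] conjI allI impI \<delta>; elim conjE)
      fix u v assume uv: "u \<le> x" "x \<le> v" "v - u < \<delta>"
      have "\<bar>I v - I x - (v - x) * g x\<bar> \<le> \<epsilon> * (v - x)" using l[of v] uv by auto
      moreover have "\<bar>I u - I x - (u - x) * g x\<bar> \<le> \<epsilon> * (x - u)" using l[of u] uv by auto
      ultimately show "\<bar>I v - I u - g x * (v - u)\<bar> \<le> \<epsilon> * (v - u)"
        unfolding abs_le_iff by (simp add: algebra_simps)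
    qed
  qed
  have "f a - I a \<le> f b - I b"
  proof (rule abs_cont_on_nonneg_quotients_imp_le[OF abs_cont_on_diff[OF f I] ab N])
    fix x \<epsilon> \<delta> :: real assume x: "x \<in> {a<..<b} - N" and \<epsilon>: "\<epsilon> > 0" and \<delta>: "\<delta> > 0"
    then have e2: "\<epsilon> / 2 > 0" by simp
    from lin[OF x e2] obtain \<delta>' where d': "\<delta>' > 0" and
      l: "\<And>u v. u \<le> x \<Longrightarrow> x \<le> v \<Longrightarrow> v - u < \<delta>' \<Longrightarrow> \<bar>I v - I u - g x * (v - u)\<bar> \<le> \<epsilon> / 2 * (v - u)" by blast
    have "\<bar>G x\<bar> \<noteq> \<infinity>" using x by (auto simp: N_def)
    then have "G x > ereal (g x - \<epsilon> / 2)" using \<epsilon> by (cases "G x") (auto simp: g_def)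
    moreover have "min \<delta> \<delta>' > 0" using \<delta> d' by simp
    ultimately obtain u v where uv: "u < v" "u \<le> x" "x \<le> v" "v - u < min \<delta> \<delta>'" "f v - f u \<ge> (g x - \<epsilon> / 2) * (v - u)"
      using quotient_limsup_gt by blast
    have "I v - I u - g x * (v - u) \<le> \<epsilon> / 2 * (v - u)"
      by (rule order_trans[OF abs_ge_self l]) (use uv in auto)
    then have "- \<epsilon> * (v - u) \<le> f v - I v - (f u - I u)" using uv(5) by (simp add: field_simps)
    then show "\<exists>u v. u < v \<and> u \<le> x \<and> x \<le> v \<and> v - u < \<delta> \<and> f v - I v - (f u - I u) \<ge> - \<epsilon> * (v - u)"
      using uv by auto
  qed
  moreover have "I a - f a \<le> I b - f b"
  proof (rule abs_cont_on_nonneg_quotients_imp_le[OF abs_cont_on_diff[OF I f] ab N])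
    fix x \<epsilon> \<delta> :: real assume x: "x \<in> {a<..<b} - N" and \<epsilon>: "\<epsilon> > 0" and \<delta>: "\<delta> > 0"
    then have e2: "\<epsilon> / 2 > 0" by simp
    from lin[OF x e2] obtain \<delta>' where d': "\<delta>' > 0" and
      l: "\<And>u v. u \<le> x \<Longrightarrow> x \<le> v \<Longrightarrow> v - u < \<delta>' \<Longrightarrow> \<bar>I v - I u - g x * (v - u)\<bar> \<le> \<epsilon> / 2 * (v - u)" by blast
    have "\<bar>G x\<bar> \<noteq> \<infinity>" using x by (auto simp: N_def)
    then have "G x < ereal (g x + \<epsilon> / 2)" using \<epsilon> by (cases "G x") (auto simp: g_def)
    moreover have "min \<delta> \<delta>' > 0" using \<delta> d' by simp
    ultimately obtain u v where uv: "u < v" "u \<le> x" "x \<le> v" "v - u < min \<delta> \<delta>'" "f v - f u \<le> (g x + \<epsilon> / 2) * (v - u)"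
      using quotient_limsup_lt by blast
    have "- (I v - I u - g x * (v - u)) \<le> \<epsilon> / 2 * (v - u)"
      by (rule order_trans[OF abs_ge_minus_self l]) (use uv in auto)
    then have "- \<epsilon> * (v - u) \<le> I v - f v - (I u - f u)" using uv(5) by (simp add: field_simps)
    then show "\<exists>u v. u < v \<and> u \<le> x \<and> x \<le> v \<and> v - u < \<delta> \<and> I v - f v - (I u - f u) \<ge> - \<epsilon> * (v - u)"
      using uv by auto
  qed
  ultimately have "I b - I a = f b - f a" by simp
  then show ?thesis using I_diff[of a b] ab by simp
qed (use has_integral_refl(2) in \<open>simp add: has_integral_refl\<close>)

end

lemma abs_cont_on_obtain_density:
  fixes f :: "real \<Rightarrow> real"
  assumes "\<And>a b. abs_cont_on a b f"
  obtains g where "\<And>a b. g absolutely_integrable_on {a..b}" "\<And>a b. a \<le> b \<Longrightarrow> (g has_integral f b - f a) {a..b}"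
proof -
  let ?g = "\<lambda>x. real_of_ereal (limsup (\<lambda>n. ereal ((f (x + inverse (real (Suc n))) - f x) / inverse (real (Suc n)))))"
  have "?g absolutely_integrable_on {a..b}" for a b
    by (cases "a \<le> b") (use quotient_limsup_integrable(1)[OF assms] in \<open>auto simp: absolutely_integrable_on_def\<close>)
  with quotient_limsup_integral[OF assms] show thesis by (intro that[of ?g])
qed

section \<open>Calculus of locally absolutely continuous functions\<close>

lemma AC_loc_iff: "f \<in> AC_loc \<longleftrightarrow> (\<forall>a b. abs_cont_on a b f)"
  by (simp add: AC_loc_def abs_continuous_on_interval_def abs_cont_on_def)

lemma AC_loc_continuous: "f \<in> AC_loc \<Longrightarrow> continuous_on UNIV f"
  by (intro abs_cont_on_imp_continuous) (simp add: AC_loc_iff)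

text \<open>Closure of absolute continuity under Lipschitz images, used for conjugates, constant multiples and
real and imaginary parts.\<close>

lemma abs_cont_on_dominated:
  fixes f :: "real \<Rightarrow> 'a::real_normed_vector" and g :: "real \<Rightarrow> 'b::real_normed_vector"
  assumes f: "abs_cont_on a b f" and le: "\<And>x y. x \<in> {a..b} \<Longrightarrow> y \<in> {a..b} \<Longrightarrow> norm (g x - g y) \<le> C * norm (f x - f y)"
  shows "abs_cont_on a b g"
  unfolding abs_cont_on_def
proof (intro allI impI)
  fix \<epsilon> :: real assume \<epsilon>: "\<epsilon> > 0"
  then have "\<epsilon> / (\<bar>C\<bar> + 1) > 0" by simp
  from abs_cont_onE[OF f this] obtain \<delta> where \<delta>: "\<delta> > 0" and
    v: "\<And>d T. d division_of T \<Longrightarrow> T \<subseteq> {a..b} \<Longrightarrow> (\<Sum>K\<in>d. Sup K - Inf K) < \<delta> \<Longrightarrow>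
        (\<Sum>K\<in>d. norm (f (Sup K) - f (Inf K))) < \<epsilon> / (\<bar>C\<bar> + 1)" by blast
  show "\<exists>\<delta>>0. \<forall>d T. d division_of T \<and> T \<subseteq> {a..b} \<and> (\<Sum>K\<in>d. Sup K - Inf K) < \<delta> \<longrightarrow>
        (\<Sum>K\<in>d. norm (g (Sup K) - g (Inf K))) < \<epsilon>"
  proof (intro exI[of _ \<delta>] conjI allI impI \<delta>; elim conjE)
    fix d T assume d: "d division_of T" "T \<subseteq> {a..b}" "(\<Sum>K\<in>d. Sup K - Inf K) < \<delta>"
    have "(\<Sum>K\<in>d. norm (g (Sup K) - g (Inf K))) \<le> (\<Sum>K\<in>d. (\<bar>C\<bar> + 1) * norm (f (Sup K) - f (Inf K)))"
    proof (rule sum_mono)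
      fix K assume K: "K \<in> d"
      note dm = division_interval[OF d(1) K]
      have "K \<subseteq> {a..b}" using division_ofD(2)[OF d(1) K] d(2) by blast
      then have "Inf K \<in> {a..b}" "Sup K \<in> {a..b}" using dm(2) by (subst (asm) dm(3), simp)+
      from le[OF this(2,1)] have "norm (g (Sup K) - g (Inf K)) \<le> C * norm (f (Sup K) - f (Inf K))" .
      also have "\<dots> \<le> (\<bar>C\<bar> + 1) * norm (f (Sup K) - f (Inf K))" by (intro mult_right_mono) auto
      finally show "norm (g (Sup K) - g (Inf K)) \<le> (\<bar>C\<bar> + 1) * norm (f (Sup K) - f (Inf K))" .
    qed
    also have "\<dots> = (\<bar>C\<bar> + 1) * (\<Sum>K\<in>d. norm (f (Sup K) - f (Inf K)))" by (simp add: sum_distrib_left)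
    also have "\<dots> < (\<bar>C\<bar> + 1) * (\<epsilon> / (\<bar>C\<bar> + 1))" using v[OF d] by (intro mult_strict_left_mono) auto
    also have "\<dots> = \<epsilon>" by simp
    finally show "(\<Sum>K\<in>d. norm (g (Sup K) - g (Inf K))) < \<epsilon>" .
  qed
qed

lemma abs_cont_on_mult:
  fixes f g :: "real \<Rightarrow> 'a::real_normed_algebra"
  assumes f: "abs_cont_on a b f" and g: "abs_cont_on a b g"
    and B: "\<And>x. x \<in> {a..b} \<Longrightarrow> norm (f x) \<le> B" "\<And>x. x \<in> {a..b} \<Longrightarrow> norm (g x) \<le> B"
  shows "abs_cont_on a b (\<lambda>x. f x * g x)"
  unfolding abs_cont_on_def
proof (intro allI impI)
  fix \<epsilon> :: real assume \<epsilon>: "\<epsilon> > 0"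
  then have e2: "\<epsilon> / 2 / (\<bar>B\<bar> + 1) > 0" by simp
  from abs_cont_onE[OF f e2] obtain \<delta>1 where \<delta>1: "\<delta>1 > 0" and
    1: "\<And>d T. d division_of T \<Longrightarrow> T \<subseteq> {a..b} \<Longrightarrow> (\<Sum>K\<in>d. Sup K - Inf K) < \<delta>1 \<Longrightarrow>
        (\<Sum>K\<in>d. norm (f (Sup K) - f (Inf K))) < \<epsilon> / 2 / (\<bar>B\<bar> + 1)" by blast
  from abs_cont_onE[OF g e2] obtain \<delta>2 where \<delta>2: "\<delta>2 > 0" and
    2: "\<And>d T. d division_of T \<Longrightarrow> T \<subseteq> {a..b} \<Longrightarrow> (\<Sum>K\<in>d. Sup K - Inf K) < \<delta>2 \<Longrightarrow>
        (\<Sum>K\<in>d. norm (g (Sup K) - g (Inf K))) < \<epsilon> / 2 / (\<bar>B\<bar> + 1)" by blast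
  show "\<exists>\<delta>>0. \<forall>d T. d division_of T \<and> T \<subseteq> {a..b} \<and> (\<Sum>K\<in>d. Sup K - Inf K) < \<delta> \<longrightarrow>
        (\<Sum>K\<in>d. norm (f (Sup K) * g (Sup K) - f (Inf K) * g (Inf K))) < \<epsilon>"
  proof (intro exI[of _ "min \<delta>1 \<delta>2"] conjI allI impI; (elim conjE)?)
    fix d T assume d: "d division_of T" "T \<subseteq> {a..b}" and s: "(\<Sum>K\<in>d. Sup K - Inf K) < min \<delta>1 \<delta>2"
    have "(\<Sum>K\<in>d. norm (f (Sup K) * g (Sup K) - f (Inf K) * g (Inf K)))
       \<le> (\<Sum>K\<in>d. (\<bar>B\<bar> + 1) * norm (f (Sup K) - f (Inf K)) + (\<bar>B\<bar> + 1) * norm (g (Sup K) - g (Inf K)))"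
    proof (rule sum_mono)
      fix K assume K: "K \<in> d"
      note dm = division_interval[OF d(1) K]
      have "K \<subseteq> {a..b}" using division_ofD(2)[OF d(1) K] d(2) by blast
      then have m: "Inf K \<in> {a..b}" "Sup K \<in> {a..b}" using dm(2) by (subst (asm) dm(3), simp)+
      have "f (Sup K) * g (Sup K) - f (Inf K) * g (Inf K)
          = (f (Sup K) - f (Inf K)) * g (Sup K) + f (Inf K) * (g (Sup K) - g (Inf K))" by (simp add: algebra_simps)
      also have "norm \<dots> \<le> norm (f (Sup K) - f (Inf K)) * norm (g (Sup K)) + norm (f (Inf K)) * norm (g (Sup K) - g (Inf K))"
        by (intro norm_triangle_le add_mono norm_mult_ineq)
      also have "\<dots> \<le> norm (f (Sup K) - f (Inf K)) * (\<bar>B\<bar> + 1) + (\<bar>B\<bar> + 1) * norm (g (Sup K) - g (Inf K))"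
        using B(1)[OF m(1)] B(2)[OF m(2)] by (intro add_mono mult_left_mono mult_right_mono) auto
      finally show "norm (f (Sup K) * g (Sup K) - f (Inf K) * g (Inf K))
        \<le> (\<bar>B\<bar> + 1) * norm (f (Sup K) - f (Inf K)) + (\<bar>B\<bar> + 1) * norm (g (Sup K) - g (Inf K))" by (simp add: mult.commute)
    qed
    also have "\<dots> = (\<bar>B\<bar> + 1) * ((\<Sum>K\<in>d. norm (f (Sup K) - f (Inf K))) + (\<Sum>K\<in>d. norm (g (Sup K) - g (Inf K))))"
      by (simp add: sum_distrib_left sum.distrib distrib_left)
    also have "\<dots> < (\<bar>B\<bar> + 1) * (\<epsilon> / 2 / (\<bar>B\<bar> + 1) + \<epsilon> / 2 / (\<bar>B\<bar> + 1))"
      using 1[OF d] 2[OF d] s by (intro mult_strict_left_mono add_strict_mono) auto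
    also have "\<dots> = \<epsilon>"
    proof -
      have "c * (\<epsilon> / 2 / c + \<epsilon> / 2 / c) = \<epsilon>" if "c > 0" for c using that by (simp add: field_simps)
      then show ?thesis by (metis abs_add_one_gt_zero add.commute)
    qed
    finally show "(\<Sum>K\<in>d. norm (f (Sup K) * g (Sup K) - f (Inf K) * g (Inf K))) < \<epsilon>" .
  qed (use \<delta>1 \<delta>2 in auto)
qed

lemma AC_loc_mult:
  assumes "f \<in> AC_loc" "g \<in> AC_loc"
  shows "(\<lambda>x. f x * g x) \<in> AC_loc"
  unfolding AC_loc_iff
proof (intro allI)
  fix a b
  have "bounded (f ` {a..b})" "bounded (g ` {a..b})"
    using assms by (auto intro!: compact_imp_bounded compact_continuous_image intro: continuous_on_subset[OF AC_loc_continuous])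
  then obtain B1 B2 where "\<forall>x\<in>{a..b}. norm (f x) \<le> B1" "\<forall>x\<in>{a..b}. norm (g x) \<le> B2"
    by (auto simp: bounded_iff)
  then show "abs_cont_on a b (\<lambda>x. f x * g x)"
    using assms by (intro abs_cont_on_mult[where B = "max B1 B2"]) (auto simp: AC_loc_iff le_max_iff_disj)
qed

lemma AC_loc_cnj:
  assumes "f \<in> AC_loc"
  shows "(\<lambda>x. cnj (f x)) \<in> AC_loc"
  unfolding AC_loc_iff
proof (intro allI)
  fix a b
  show "abs_cont_on a b (\<lambda>x. cnj (f x))"
  proof (rule abs_cont_on_dominated[where f = f and C = 1])
    show "norm (cnj (f x) - cnj (f y)) \<le> 1 * norm (f x - f y)" for x y
      by (metis complex_cnj_diff complex_mod_cnj mult_1 order_refl)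
  qed (use assms in \<open>simp add: AC_loc_iff\<close>)
qed

lemma AC_loc_cmult:
  assumes "f \<in> AC_loc"
  shows "(\<lambda>x. c * f x) \<in> AC_loc"
  unfolding AC_loc_iff
proof (intro allI)
  fix a b
  show "abs_cont_on a b (\<lambda>x. c * f x)"
  proof (rule abs_cont_on_dominated[where f = f and C = "norm c"])
    show "norm (c * f x - c * f y) \<le> norm c * norm (f x - f y)" for x y
      by (metis right_diff_distrib norm_mult order_refl)
  qed (use assms in \<open>simp add: AC_loc_iff\<close>)
qed

lemma AC_loc_diff: "f \<in> AC_loc \<Longrightarrow> g \<in> AC_loc \<Longrightarrow> (\<lambda>x. f x - g x) \<in> AC_loc"
  by (simp add: AC_loc_iff abs_cont_on_diff)

lemma AC_loc_add: "f \<in> AC_loc \<Longrightarrow> g \<in> AC_loc \<Longrightarrow> (\<lambda>x. f x + g x) \<in> AC_loc"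
  using AC_loc_diff[of f "\<lambda>x. - 1 * g x"] AC_loc_cmult[of g "- 1"] by simp

lemma indefinite_integral_AC_loc:
  fixes g :: "real \<Rightarrow> complex"
  assumes "\<And>a b. g absolutely_integrable_on {a..b}"
    and "\<And>a b. a \<le> b \<Longrightarrow> (g has_integral F b - F a) {a..b}"
  shows "F \<in> AC_loc"
  unfolding AC_loc_iff by (intro allI indefinite_integral_abs_cont_on[OF assms])

lemma AE_lebesgue_iff_negligible: "(AE x in lebesgue. P x) \<longleftrightarrow> negligible {x. \<not> P x}"
  by (auto simp: eventually_ae_filter simp flip: negligible_iff_null_sets intro: negligible_subset)

lemma indefinite_integral_derivative_AE:
  fixes g :: "real \<Rightarrow> 'a::euclidean_space"
  assumes g: "\<And>a b. a \<le> b \<Longrightarrow> (g has_integral F b - F a) {a..b}"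
  shows "AE x in lebesgue. (F has_vector_derivative g x) (at x)"
proof -
  define N where "N = (\<lambda>n::nat. {x\<in>{- real n<..<real n}. \<not> ((\<lambda>x. integral {- real n..x} g) has_vector_derivative g x) (at x)})"
  have "negligible (N n)" for n
    unfolding N_def by (rule indefinite_integral_has_vector_derivative_AE) (use g[of "- real n" "real n"] in auto)
  then have "negligible (\<Union>n. N n)" by (rule negligible_Union_nat)
  moreover have "(F has_vector_derivative g x) (at x)" if x: "x \<notin> (\<Union>n. N n)" for x
  proof -
    obtain n where n: "\<bar>x\<bar> < real n" using reals_Archimedean2 by blast
    then have xn: "x \<in> {- real n<..<real n}" by auto
    moreover have "x \<notin> N n" using x by blast
    ultimately have "((\<lambda>x. integral {- real n..x} g) has_vector_derivative g x) (at x)" by (simp add: N_def)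
    then have "((\<lambda>x. F (- real n) + integral {- real n..x} g) has_vector_derivative g x) (at x)"
      by (intro derivative_eq_intros) auto
    then show ?thesis
    proof (rule has_vector_derivative_transform_within_open[where S = "{- real n<..<real n}"])
      fix y assume "y \<in> {- real n<..<real n}"
      then show "F (- real n) + integral {- real n..y} g = F y"
        using integral_unique[OF g[of "- real n" y]] by simp
    qed (use xn in auto)
  qed
  then have "{x. \<not> (F has_vector_derivative g x) (at x)} \<subseteq> (\<Union>n. N n)" by blast
  ultimately show ?thesis unfolding AE_lebesgue_iff_negligible using negligible_subset by blast
qed

lemma AC_loc_obtain_density:
  assumes f: "f \<in> AC_loc"
  obtains g where "\<And>a b. g absolutely_integrable_on {a..b}" "\<And>a b. a \<le> b \<Longrightarrow> (g has_integral f b - f a) {a..b}"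
    "AE x in lebesgue. (f has_vector_derivative g x) (at x)"
proof -
  have re: "abs_cont_on a b (\<lambda>x. Re (f x))" and im: "abs_cont_on a b (\<lambda>x. Im (f x))" for a b
  proof -
    have ac: "abs_cont_on a b f" using f by (simp add: AC_loc_iff)
    show "abs_cont_on a b (\<lambda>x. Re (f x))"
      by (rule abs_cont_on_dominated[OF ac, where C = 1])
         (metis abs_Re_le_cmod minus_complex.simps(1) mult_1 real_norm_def)
    show "abs_cont_on a b (\<lambda>x. Im (f x))"
      by (rule abs_cont_on_dominated[OF ac, where C = 1])
         (metis abs_Im_le_cmod minus_complex.simps(2) mult_1 real_norm_def)
  qed
  obtain g1 where g1: "\<And>a b. g1 absolutely_integrable_on {a..b}" "\<And>a b. a \<le> b \<Longrightarrow> (g1 has_integral Re (f b) - Re (f a)) {a..b}"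
    using abs_cont_on_obtain_density[OF re] by blast
  obtain g2 where g2: "\<And>a b. g2 absolutely_integrable_on {a..b}" "\<And>a b. a \<le> b \<Longrightarrow> (g2 has_integral Im (f b) - Im (f a)) {a..b}"
    using abs_cont_on_obtain_density[OF im] by blast
  define g where "g = (\<lambda>x. complex_of_real (g1 x) + \<i> * complex_of_real (g2 x))"
  have a: "g absolutely_integrable_on {a..b}" for a b
    unfolding g_def
    using absolutely_integrable_linear[OF g1(1) bounded_linear_of_real, of a b]
      absolutely_integrable_linear[OF g2(1) bounded_linear_compose[OF bounded_linear_mult_right[of \<i>] bounded_linear_of_real], of a b]
    by (intro set_integral_add) (auto simp: o_def)
  have h: "(g has_integral f b - f a) {a..b}" if "a \<le> b" for a b
  proof -
    have "(g has_integral complex_of_real (Re (f b) - Re (f a)) + \<i> * complex_of_real (Im (f b) - Im (f a))) {a..b}"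
      unfolding g_def
      using has_integral_linear[OF g1(2)[OF that] bounded_linear_of_real]
      has_integral_linear[OF g2(2)[OF that] bounded_linear_compose[OF bounded_linear_mult_right[of \<i>] bounded_linear_of_real]]
      by (intro has_integral_add) (auto simp: o_def)
    also have "complex_of_real (Re (f b) - Re (f a)) + \<i> * complex_of_real (Im (f b) - Im (f a)) = f b - f a"
      by (simp add: complex_eq_iff)
    finally show ?thesis .
  qed
  show thesis by (rule that[OF a h indefinite_integral_derivative_AE[OF h]])
qed

lemma AC_loc_vector_derivative_AE:
  assumes "f \<in> AC_loc"
  shows "AE x in lebesgue. (f has_vector_derivative vector_derivative f (at x)) (at x)"
proof -
  obtain g where "AE x in lebesgue. (f has_vector_derivative g x) (at x)"
    by (rule AC_loc_obtain_density[OF assms]) (rule that)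
  then show ?thesis by eventually_elim (simp add: vector_derivative_at)
qed

text \<open>The fundamental theorem of calculus in the form used below: any function that is almost everywhere the
derivative can serve as the integrand.\<close>

lemma AC_loc_ftc:
  assumes f: "f \<in> AC_loc" and g: "AE x in lebesgue. (f has_vector_derivative g x) (at x)"
  shows "g absolutely_integrable_on {a..b}" "a \<le> b \<Longrightarrow> (g has_integral f b - f a) {a..b}"
proof -
  obtain k where k: "\<And>a b. k absolutely_integrable_on {a..b}" "\<And>a b. a \<le> b \<Longrightarrow> (k has_integral f b - f a) {a..b}"
    "AE x in lebesgue. (f has_vector_derivative k x) (at x)"
    by (rule AC_loc_obtain_density[OF f]) (rule that)
  from g k(3) have "AE x in lebesgue. g x = k x"
    by eventually_elim (auto dest: vector_derivative_unique_at)
  then have N: "negligible {x. g x \<noteq> k x}" by (simp add: AE_lebesgue_iff_negligible)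
  show "g absolutely_integrable_on {a..b}"
    by (rule absolutely_integrable_spike[OF k(1) N]) auto
  show "(g has_integral f b - f a) {a..b}" if "a \<le> b"
    by (rule has_integral_spike[OF N _ k(2)[OF that]]) auto
qed

lemma AC_loc_reflect:
  assumes f: "f \<in> AC_loc"
  shows "(\<lambda>x. f (- x)) \<in> AC_loc"
proof -
  obtain g where g: "\<And>a b. g absolutely_integrable_on {a..b}" "\<And>a b. a \<le> b \<Longrightarrow> (g has_integral f b - f a) {a..b}"
    by (rule AC_loc_obtain_density[OF f]) (rule that)
  show ?thesis
  proof (rule indefinite_integral_AC_loc[where g = "\<lambda>x. - g (- x)"])
    fix a b
    have "g absolutely_integrable_on {- b..- a}" by (rule g)
    then show "(\<lambda>x. - g (- x)) absolutely_integrable_on {a..b}"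
      using Henstock_Kurzweil_Integration.integrable_reflect_real[where f = g and a = "-b" and b = "-a"] Henstock_Kurzweil_Integration.integrable_reflect_real[where f = "\<lambda>x. norm (g x)" and a = "-b" and b = "-a"]
      unfolding absolutely_integrable_on_def norm_minus_cancel by (simp add: integrable_neg)
  next
    fix a b :: real assume "a \<le> b"
    then have "(g has_integral f (- a) - f (- b)) {- b..- a}" by (intro g) auto
    then have "((\<lambda>x. g (- x)) has_integral f (- a) - f (- b)) {a..b}"
      using has_integral_reflect_real[where f = g and a = "-b" and b = "-a"] by simp
    then show "((\<lambda>x. - g (- x)) has_integral f (- b) - f (- a)) {a..b}"
      by (drule_tac has_integral_neg) simp
  qed
qed

lemma AC_loc_exp: "(\<lambda>x. exp (c * complex_of_real x)) \<in> AC_loc"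
proof (rule indefinite_integral_AC_loc[where g = "\<lambda>x. c * exp (c * complex_of_real x)"])
  show "(\<lambda>x. c * exp (c * complex_of_real x)) absolutely_integrable_on {a..b}" for a b
    unfolding box_real[symmetric] by (intro absolutely_integrable_continuous continuous_intros)
  show "((\<lambda>x. c * exp (c * complex_of_real x)) has_integral exp (c * complex_of_real b) - exp (c * complex_of_real a)) {a..b}"
    if "a \<le> b" for a b
  proof (rule fundamental_theorem_of_calculus[OF that])
    fix x
    have "((\<lambda>z. exp (c * z)) has_field_derivative c * exp (c * complex_of_real x)) (at (complex_of_real x))"
      by (auto intro!: derivative_eq_intros)
    then show "((\<lambda>x. exp (c * complex_of_real x)) has_vector_derivative c * exp (c * complex_of_real x)) (at x within {a..b})"
      by (rule has_vector_derivative_real_field)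
  qed
qed

lemma AC_loc_measurable: "f \<in> AC_loc \<Longrightarrow> f \<in> borel_measurable lebesgue"
  using borel_measurable_continuous_onI[OF AC_loc_continuous] by (simp add: measurable_completion)

lemma set_integrable_lebesgue_of_integrable:
  "integrable lebesgue g \<Longrightarrow> S \<in> sets lebesgue \<Longrightarrow> set_integrable lebesgue S g"
  for g :: "real \<Rightarrow> 'a::euclidean_space"
  unfolding set_integrable_def by (rule integrable_mult_indicator)

lemma AC_loc_increment:
  assumes "w \<in> AC_loc" "AE x in lebesgue. (w has_vector_derivative g x) (at x)" "a \<le> b"
  shows "(LINT x:{a..b}|lebesgue. g x) = w b - w a"
  using set_lebesgue_integral_eq_integral(2)[OF AC_loc_ftc(1)[OF assms(1,2)]]
    integral_unique[OF AC_loc_ftc(2)[OF assms]] by simp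

lemma integrable_bounded_below_emeasure_finite:
  fixes k :: "real \<Rightarrow> 'a::euclidean_space"
  assumes k: "integrable lebesgue k" and S: "S \<in> sets lebesgue" and e: "e > 0" "\<And>x. x \<in> S \<Longrightarrow> norm (k x) \<ge> e"
  shows "emeasure lebesgue S < \<infinity>"
proof -
  have "integrable lebesgue (indicator S :: real \<Rightarrow> real)"
  proof (rule Bochner_Integration.integrable_bound)
    show "integrable lebesgue (\<lambda>x. norm (k x) / e)" using k by simp
    show "AE x in lebesgue. norm (indicator S x :: real) \<le> norm (norm (k x) / e)"
      using e by (intro AE_I2) (auto simp: indicator_def)
  qed (use S in simp)
  then show ?thesis using S by (simp add: integrable_indicator_iff)
qed

lemma emeasure_lebesgue_halfline:
  "emeasure lebesgue {x::real..} = \<infinity>" "emeasure lebesgue {..x::real} = \<infinity>"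
proof -
  have "of_nat n \<le> emeasure lebesgue {x..}" "of_nat n \<le> emeasure lebesgue {..x}" for n
  proof -
    have "of_nat n = emeasure lebesgue {x..x + real n}" "of_nat n = emeasure lebesgue {x - real n..x}"
      by (simp_all add: ennreal_of_nat_eq_real_of_nat)
    moreover have "emeasure lebesgue {x..x + real n} \<le> emeasure lebesgue {x..}"
      "emeasure lebesgue {x - real n..x} \<le> emeasure lebesgue {..x}" by (intro emeasure_mono; auto)+
    ultimately show "of_nat n \<le> emeasure lebesgue {x..}" "of_nat n \<le> emeasure lebesgue {..x}" by simp_all
  qed
  then show "emeasure lebesgue {x::real..} = \<infinity>" "emeasure lebesgue {..x::real} = \<infinity>"
    by (metis ennreal_SUP_of_nat_eq_top SUP_least infinity_ennreal_def top.extremum_unique)+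
qed

text \<open>The integration by parts on the whole line behind every energy estimate. An integrable derivative
gives \<open>w\<close> limits at both ends, and integrability of \<open>w\<close> forces these limits to vanish.\<close>

lemma AC_loc_integral_derivative_eq_0:
  fixes w g :: "real \<Rightarrow> complex"
  assumes w: "w \<in> AC_loc" "integrable lebesgue w" and g: "integrable lebesgue g"
    and d: "AE x in lebesgue. (w has_vector_derivative g x) (at x)"
  shows "(LINT x|lebesgue. g x) = 0"
proof -
  define c1 where "c1 = (LINT x:{0..}|lebesgue. g x)"
  define c2 where "c2 = (LINT x:{..0}|lebesgue. g x)"
  have m: "g \<in> borel_measurable lebesgue" using g by auto
  have l1: "((\<lambda>t. LINT x:{0..t}|lebesgue. g x) \<longlongrightarrow> c1) at_top"
    unfolding c1_def set_lebesgue_integral_def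
  proof (rule integral_dominated_convergence_at_top[where w = "\<lambda>x. norm (g x)"])
    show "AE x in lebesgue. ((\<lambda>t. indicat_real {0..t} x *\<^sub>R g x) \<longlongrightarrow> indicat_real {0..} x *\<^sub>R g x) at_top"
    proof (intro AE_I2 tendsto_eventually)
      fix x :: real
      show "eventually (\<lambda>t. indicat_real {0..t} x *\<^sub>R g x = indicat_real {0..} x *\<^sub>R g x) at_top"
        using eventually_ge_at_top[of x] by eventually_elim (auto simp: indicator_def)
    qed
    show "\<forall>\<^sub>F t in at_top. AE x in lebesgue. norm (indicat_real {0..t} x *\<^sub>R g x) \<le> norm (g x)"
      by (auto intro!: always_eventually AE_I2 simp: indicator_def)
  qed (use g m in \<open>auto intro!: borel_measurable_scaleR borel_measurable_indicator\<close>)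
  have l2: "((\<lambda>t. LINT x:{-t..0}|lebesgue. g x) \<longlongrightarrow> c2) at_top"
    unfolding c2_def set_lebesgue_integral_def
  proof (rule integral_dominated_convergence_at_top[where w = "\<lambda>x. norm (g x)"])
    show "AE x in lebesgue. ((\<lambda>t. indicat_real {-t..0} x *\<^sub>R g x) \<longlongrightarrow> indicat_real {..0} x *\<^sub>R g x) at_top"
    proof (intro AE_I2 tendsto_eventually)
      fix x :: real
      show "eventually (\<lambda>t. indicat_real {-t..0} x *\<^sub>R g x = indicat_real {..0} x *\<^sub>R g x) at_top"
        using eventually_ge_at_top[of "-x"] by eventually_elim (auto simp: indicator_def)
    qed
    show "\<forall>\<^sub>F t in at_top. AE x in lebesgue. norm (indicat_real {-t..0} x *\<^sub>R g x) \<le> norm (g x)"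
      by (auto intro!: always_eventually AE_I2 simp: indicator_def)
  qed (use g m in \<open>auto intro!: borel_measurable_scaleR borel_measurable_indicator\<close>)
  have l1': "(w \<longlongrightarrow> w 0 + c1) at_top"
  proof (rule Lim_transform_eventually)
    show "((\<lambda>t. w 0 + (LINT x:{0..t}|lebesgue. g x)) \<longlongrightarrow> w 0 + c1) at_top" by (intro tendsto_add tendsto_const l1)
    show "\<forall>\<^sub>F t in at_top. w 0 + (LINT x:{0..t}|lebesgue. g x) = w t"
      using eventually_ge_at_top[of 0] by eventually_elim (simp add: AC_loc_increment[OF w(1) d])
  qed
  have l2': "((\<lambda>t. w (- t)) \<longlongrightarrow> w 0 - c2) at_top"
  proof (rule Lim_transform_eventually)
    show "((\<lambda>t. w 0 - (LINT x:{-t..0}|lebesgue. g x)) \<longlongrightarrow> w 0 - c2) at_top" by (intro tendsto_diff tendsto_const l2)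
    show "\<forall>\<^sub>F t in at_top. w 0 - (LINT x:{-t..0}|lebesgue. g x) = w (- t)"
      using eventually_ge_at_top[of 0] by eventually_elim (simp add: AC_loc_increment[OF w(1) d])
  qed
  have "w 0 + c1 = 0"
  proof (rule ccontr)
    assume nz: "w 0 + c1 \<noteq> 0"
    then have "eventually (\<lambda>t. norm (w t) > norm (w 0 + c1) / 2) at_top"
      by (intro order_tendstoD(1)[OF tendsto_norm[OF l1']]) auto
    then obtain X where "\<And>t. t \<ge> X \<Longrightarrow> norm (w t) > norm (w 0 + c1) / 2"
      unfolding eventually_at_top_linorder by blast
    then have "emeasure lebesgue {X..} < \<infinity>" using nz
      by (intro integrable_bounded_below_emeasure_finite[OF w(2), where e = "norm (w 0 + c1) / 2"]) (auto simp: less_imp_le)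
    then show False by (simp add: emeasure_lebesgue_halfline)
  qed
  moreover have "w 0 - c2 = 0"
  proof (rule ccontr)
    assume nz: "w 0 - c2 \<noteq> 0"
    then have "eventually (\<lambda>t. norm (w (- t)) > norm (w 0 - c2) / 2) at_top"
      by (intro order_tendstoD(1)[OF tendsto_norm[OF l2']]) auto
    then obtain X where X: "\<And>t. t \<ge> X \<Longrightarrow> norm (w (- t)) > norm (w 0 - c2) / 2"
      unfolding eventually_at_top_linorder by blast
    have "norm (w t) \<ge> norm (w 0 - c2) / 2" if "t \<in> {..-X}" for t using X[of "-t"] that by simp
    then have "emeasure lebesgue {..-X} < \<infinity>" using nz
      by (intro integrable_bounded_below_emeasure_finite[OF w(2), where e = "norm (w 0 - c2) / 2"]) auto
    then show False by (simp add: emeasure_lebesgue_halfline)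
  qed
  moreover have "(LINT x|lebesgue. g x) = c2 + c1"
  proof -
    have "(LINT x|lebesgue. g x) = (LINT x|lebesgue. indicator {..0} x *\<^sub>R g x + indicator {0..} x *\<^sub>R g x)"
    proof (rule integral_cong_AE)
      have "AE x in lebesgue. x \<notin> {0::real}" by (rule AE_not_in) (simp add: negligible_iff_null_sets[symmetric])
      then show "AE x in lebesgue. g x = indicator {..0} x *\<^sub>R g x + indicator {0..} x *\<^sub>R g x"
        by eventually_elim (auto simp: indicator_def)
    qed (use m in \<open>auto intro!: borel_measurable_add borel_measurable_scaleR borel_measurable_indicator\<close>)
    also have "\<dots> = c2 + c1" unfolding c1_def c2_def set_lebesgue_integral_def
      by (intro Bochner_Integration.integral_add integrable_mult_indicator g) auto
    finally show ?thesis .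
  qed
  ultimately show ?thesis by (simp add: add_eq_0_iff)
qed

section \<open>Square integrable functions and contractions\<close>

definition sq_integrable :: "(real \<Rightarrow> 'a::euclidean_space) \<Rightarrow> bool" where
  "sq_integrable f \<longleftrightarrow> f \<in> borel_measurable lebesgue \<and> integrable lebesgue (\<lambda>x. (norm (f x))\<^sup>2)"

lemma sq_integrable_bound:
  assumes "f \<in> borel_measurable lebesgue" "integrable lebesgue k" "AE x in lebesgue. (norm (f x))\<^sup>2 \<le> k x"
  shows "sq_integrable f"
  unfolding sq_integrable_def
proof (intro conjI)
  show "integrable lebesgue (\<lambda>x. (norm (f x))\<^sup>2)"
  proof (rule Bochner_Integration.integrable_bound[OF assms(2)])
    show "AE x in lebesgue. norm ((norm (f x))\<^sup>2) \<le> norm (k x)"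
      using assms(3) by eventually_elim auto
  qed (use assms(1) in measurable)
qed (fact assms(1))

lemma norm_add_squared_le: "(norm (x + y))\<^sup>2 \<le> 2 * (norm x)\<^sup>2 + 2 * (norm y)\<^sup>2" for x y :: "'a::real_normed_vector"
proof -
  have "(norm (x + y))\<^sup>2 \<le> (norm x + norm y)\<^sup>2" by (intro power_mono norm_triangle_ineq) auto
  also have "\<dots> \<le> 2 * (norm x)\<^sup>2 + 2 * (norm y)\<^sup>2"
    using sum_squares_bound[of "norm x" "norm y"] by (simp add: power2_sum)
  finally show ?thesis .
qed

lemma sq_integrable_add:
  assumes "sq_integrable f" "sq_integrable g"
  shows "sq_integrable (\<lambda>x. f x + g x)"
  by (rule sq_integrable_bound[where k = "\<lambda>x. 2 * (norm (f x))\<^sup>2 + 2 * (norm (g x))\<^sup>2"])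
     (use assms in \<open>auto simp: sq_integrable_def norm_add_squared_le\<close>)

lemma sq_integrable_uminus: "sq_integrable f \<Longrightarrow> sq_integrable (\<lambda>x. - f x)"
  by (simp add: sq_integrable_def)

lemma sq_integrable_diff:
  assumes "sq_integrable f" "sq_integrable g"
  shows "sq_integrable (\<lambda>x. f x - g x)"
  using sq_integrable_add[OF assms(1) sq_integrable_uminus[OF assms(2)]] by simp

lemma sq_integrable_bounded_mult_AE:
  fixes f m :: "real \<Rightarrow> complex"
  assumes "sq_integrable f" "m \<in> borel_measurable lebesgue" "AE x in lebesgue. norm (m x) \<le> B"
  shows "sq_integrable (\<lambda>x. m x * f x)"
proof (rule sq_integrable_bound[where k = "\<lambda>x. B\<^sup>2 * (norm (f x))\<^sup>2"])
  show "AE x in lebesgue. (norm (m x * f x))\<^sup>2 \<le> B\<^sup>2 * (norm (f x))\<^sup>2"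
    using assms(3) by eventually_elim (simp add: norm_mult power_mult_distrib mult_right_mono power_mono)
qed (use assms in \<open>auto simp: sq_integrable_def\<close>)

lemma sq_integrable_cmult: "sq_integrable f \<Longrightarrow> sq_integrable (\<lambda>x. c * f x)" for c :: complex
  by (rule sq_integrable_bounded_mult_AE[where B = "norm c"]) auto

lemma sq_integrable_cnj: "sq_integrable f \<Longrightarrow> sq_integrable (\<lambda>x. cnj (f x))"
  unfolding sq_integrable_def by (auto intro: measurable_compose[OF _ borel_measurable_continuous_onI[OF continuous_on_cnj[OF continuous_on_id]]])

lemma integrable_mult_sq_integrable:
  fixes f g :: "real \<Rightarrow> complex"
  assumes "sq_integrable f" "sq_integrable g"
  shows "integrable lebesgue (\<lambda>x. f x * g x)"
proof (rule Bochner_Integration.integrable_bound[where f = "\<lambda>x. (norm (f x))\<^sup>2 + (norm (g x))\<^sup>2"])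
  show "AE x in lebesgue. norm (f x * g x) \<le> norm ((norm (f x))\<^sup>2 + (norm (g x))\<^sup>2)"
  proof (intro AE_I2)
    fix x
    have "norm (f x) * norm (g x) \<le> 2 * norm (f x) * norm (g x)" by simp
    also have "\<dots> \<le> (norm (f x))\<^sup>2 + (norm (g x))\<^sup>2" by (rule sum_squares_bound)
    finally show "norm (f x * g x) \<le> norm ((norm (f x))\<^sup>2 + (norm (g x))\<^sup>2)" by (simp add: norm_mult)
  qed
qed (use assms in \<open>auto simp: sq_integrable_def\<close>)

text \<open>Banach's fixed point theorem in \<open>L\<^sup>2\<close>, with equality almost everywhere. The proof contains the completeness of \<open>L\<^sup>2\<close>: the
squared increments \<open>(norm (d n))\<^sup>2\<close> of the Picard iteration have integrals of order \<open>k\<^sup>n\<close>, so they remain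
summable after division by \<open>(sqrt k)\<^sup>n\<close>, and the sum \<open>g\<close> is an integrable function that dominates the
squared distance of the iterates to their pointwise limit.\<close>

lemma sq_integrable_contraction_fixed_point:
  fixes T :: "(real \<Rightarrow> 'a::euclidean_space) \<Rightarrow> real \<Rightarrow> 'a"
  assumes T: "\<And>f. sq_integrable f \<Longrightarrow> sq_integrable (T f)"
    and lip: "\<And>f g. sq_integrable f \<Longrightarrow> sq_integrable g \<Longrightarrow>
       (LINT x|lebesgue. (norm (T f x - T g x))\<^sup>2) \<le> k * (LINT x|lebesgue. (norm (f x - g x))\<^sup>2)"
    and k: "0 < k" "k < 1"
  obtains u where "sq_integrable u" "AE x in lebesgue. T u x = u x"
proof -
  define U where "U = (\<lambda>n. (T ^^ n) (\<lambda>_. 0))"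
  define d where "d = (\<lambda>n x. U (Suc n) x - U n x)"
  define I where "I = (\<lambda>n. LINT x|lebesgue. (norm (d n x))\<^sup>2)"
  define r where "r = sqrt k"
  define q where "q = sqrt r"
  have r: "0 < r" "r < 1" "r * r = k" using k by (auto simp: r_def real_sqrt_lt_1_iff)
  have q: "0 < q" "q < 1" "q\<^sup>2 = r" using r by (auto simp: q_def)
  have qn: "(q ^ n)\<^sup>2 = r ^ n" for n
    unfolding q(3)[symmetric] power_mult[symmetric] by (simp only: mult.commute)
  have sqU: "sq_integrable (U n)" for n
    by (induction n) (auto simp: U_def T, simp add: sq_integrable_def)
  have U_Suc: "U (Suc n) = T (U n)" for n by (simp add: U_def)
  have sqd: "sq_integrable (d n)" for n unfolding d_def by (intro sq_integrable_diff sqU)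
  have I_Suc: "I (Suc n) \<le> k * I n" for n
    using lip[OF sqU[of "Suc n"] sqU[of n]] by (simp add: I_def d_def U_Suc)
  have I_le: "I n \<le> I 0 * k ^ n" for n
  proof (induction n)
    case (Suc n)
    have "I (Suc n) \<le> k * (I 0 * k ^ n)" using I_Suc[of n] Suc k mult_left_mono[OF Suc, of k] by linarith
    then show ?case by (simp add: algebra_simps)
  qed simp
  define f where "f = (\<lambda>n x. (norm (d n x))\<^sup>2 / r ^ n)"
  have f0: "0 \<le> f n x" for n x using r by (simp add: f_def)
  have fint: "integrable lebesgue (f n)" for n
    unfolding f_def using sqd[of n] by (auto simp: sq_integrable_def)
  have fI: "(LINT x|lebesgue. f n x) \<le> I 0 * r ^ n" for n
  proof -
    have "(LINT x|lebesgue. f n x) = I n / r ^ n" by (simp add: f_def I_def)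
    also have "\<dots> \<le> I 0 * k ^ n / r ^ n" using I_le r by (intro divide_right_mono) auto
    also have "\<dots> = I 0 * r ^ n" using r by (simp add: r(3)[symmetric] power_mult_distrib)
    finally show ?thesis .
  qed
  have sumI: "summable (\<lambda>n. LINT x|lebesgue. norm (f n x))"
  proof (rule summable_comparison_test')
    show "summable (\<lambda>n. I 0 * r ^ n)" using r by (intro summable_mult summable_geometric) auto
    show "norm (LINT x|lebesgue. norm (f n x)) \<le> I 0 * r ^ n" for n
      using fI[of n] f0 by (simp add: integral_nonneg_AE)
  qed
  have sumAE: "AE x in lebesgue. summable (\<lambda>n. f n x)"
  proof -
    have "(\<integral>\<^sup>+x. (\<Sum>n. ennreal (f n x)) \<partial>lebesgue) = (\<Sum>n. \<integral>\<^sup>+x. ennreal (f n x) \<partial>lebesgue)"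
      using fint by (intro nn_integral_suminf) auto
    also have "\<dots> = (\<Sum>n. ennreal (LINT x|lebesgue. f n x))"
      using fint f0 by (intro arg_cong[where f = suminf] ext nn_integral_eq_integral) auto
    also have "\<dots> \<noteq> \<infinity>"
      using sumI f0 by (simp add: ennreal_suminf_neq_top integral_nonneg_AE)
    finally have "AE x in lebesgue. (\<Sum>n. ennreal (f n x)) \<noteq> \<infinity>"
      using fint by (intro nn_integral_noteq_infinite) auto
    then show ?thesis by eventually_elim (use f0 in \<open>auto intro: summable_suminf_not_top\<close>)
  qed
  define g where "g = (\<lambda>x. \<Sum>n. f n x)"
  have gint: "integrable lebesgue g"
    unfolding g_def
  proof (rule integrable_suminf[OF fint _ sumI])
    show "AE x in lebesgue. summable (\<lambda>i. norm (f i x))" using sumAE by eventually_elim (use f0 in simp)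
  qed
  define u where "u = (\<lambda>x. lim (\<lambda>n. U n x))"
  have um: "u \<in> borel_measurable lebesgue"
    unfolding u_def using sqU by (intro borel_measurable_lim_metric) (auto simp: sq_integrable_def)
  have key: "AE x in lebesgue. \<forall>n. (norm (u x - U n x))\<^sup>2 \<le> g x * (r ^ n / (1 - q)\<^sup>2)"
    using sumAE
  proof eventually_elim
    case (elim x)
    have g0: "g x \<ge> 0" unfolding g_def using elim f0 by (intro suminf_nonneg) auto
    have dle: "norm (d n x) \<le> sqrt (g x) * q ^ n" for n
    proof -
      have "f n x \<le> g x" unfolding g_def using sum_le_suminf[OF elim, of "{n}"] f0 by simp
      then have "(norm (d n x))\<^sup>2 \<le> g x * r ^ n" using r by (simp add: f_def divide_le_eq)
      also have "\<dots> = (sqrt (g x) * q ^ n)\<^sup>2"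
        using g0 by (simp add: power_mult_distrib qn)
      finally show ?thesis by (rule power2_le_imp_le) (use g0 q in auto)
    qed
    have sg: "summable (\<lambda>n. sqrt (g x) * q ^ n)" using q by (intro summable_mult summable_geometric) auto
    have sd: "summable (\<lambda>n. norm (d n x))"
      by (rule summable_comparison_test'[OF sg]) (use dle in auto)
    have part: "(\<Sum>i<n. d i x) = U n x" for n
      by (induction n) (simp_all add: d_def, simp add: U_def)
    have lim: "u x = (\<Sum>i. d i x)"
    proof -
      have "(\<lambda>n. \<Sum>i<n. d i x) \<longlonglongrightarrow> (\<Sum>i. d i x)" using summable_norm_cancel[OF sd] by (rule summable_LIMSEQ)
      then show ?thesis unfolding part u_def by (rule limI)
    qed
    show ?case
    proof
      fix n
      have "u x - U n x = (\<Sum>i. d (i + n) x)"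
        using suminf_split_initial_segment[OF summable_norm_cancel[OF sd], of n] by (simp add: part lim)
      also have "norm \<dots> \<le> (\<Sum>i. norm (d (i + n) x))"
        using sd by (intro summable_norm) (simp add: summable_iff_shift[of "\<lambda>i. norm (d i x)"])
      also have "\<dots> \<le> (\<Sum>i. sqrt (g x) * q ^ n * q ^ i)"
      proof (rule suminf_le)
        show "norm (d (i + n) x) \<le> sqrt (g x) * q ^ n * q ^ i" for i
          using dle[of "i + n"] by (simp add: power_add mult.assoc mult.commute[of "q ^ i"])
        show "summable (\<lambda>i. norm (d (i + n) x))" using sd by (simp add: summable_iff_shift[of "\<lambda>i. norm (d i x)"])
        show "summable (\<lambda>i. sqrt (g x) * q ^ n * q ^ i)" using q by (intro summable_mult summable_geometric) auto
      qed
      also have "\<dots> = sqrt (g x) * q ^ n * (1 / (1 - q))"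
        using q by (subst suminf_mult) (auto simp: suminf_geometric)
      finally have "norm (u x - U n x) \<le> sqrt (g x) * q ^ n * (1 / (1 - q))" .
      then have "(norm (u x - U n x))\<^sup>2 \<le> (sqrt (g x) * q ^ n * (1 / (1 - q)))\<^sup>2" by (intro power_mono) auto
      also have "\<dots> = g x * (r ^ n / (1 - q)\<^sup>2)"
        using g0 by (simp add: power_mult_distrib power_divide qn)
      finally show "(norm (u x - U n x))\<^sup>2 \<le> g x * (r ^ n / (1 - q)\<^sup>2)" .
    qed
  qed
  have sqdiff: "sq_integrable (\<lambda>x. u x - U n x)" for n
  proof (rule sq_integrable_bound)
    show "(\<lambda>x. u x - U n x) \<in> borel_measurable lebesgue"
      using um sqU[of n] by (auto simp: sq_integrable_def)
    show "integrable lebesgue (\<lambda>x. g x * (r ^ n / (1 - q)\<^sup>2))" using gint by simp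
    show "AE x in lebesgue. (norm (u x - U n x))\<^sup>2 \<le> g x * (r ^ n / (1 - q)\<^sup>2)" using key by eventually_elim blast
  qed
  have "U 0 = (\<lambda>_. 0)" by (simp add: U_def)
  then have squ: "sq_integrable u" using sqdiff[of 0] by simp
  define J where "J = (\<lambda>n. LINT x|lebesgue. (norm (u x - U n x))\<^sup>2)"
  have J0: "0 \<le> J n" for n unfolding J_def by (intro integral_nonneg_AE) auto
  have "J n \<le> (LINT x|lebesgue. g x) / (1 - q)\<^sup>2 * r ^ n" for n
  proof -
    have "J n \<le> (LINT x|lebesgue. g x * (r ^ n / (1 - q)\<^sup>2))"
      unfolding J_def
    proof (rule integral_mono_AE)
      show "AE x in lebesgue. (norm (u x - U n x))\<^sup>2 \<le> g x * (r ^ n / (1 - q)\<^sup>2)" using key by eventually_elim blast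
    qed (use sqdiff[of n] gint in \<open>auto simp: sq_integrable_def\<close>)
    also have "\<dots> = (LINT x|lebesgue. g x) * (r ^ n / (1 - q)\<^sup>2)" by simp
    finally show ?thesis by simp
  qed
  then have Jle: "norm (J n) \<le> (LINT x|lebesgue. g x) / (1 - q)\<^sup>2 * r ^ n" for n using J0 by simp
  have Jlim: "J \<longlonglongrightarrow> 0"
  proof (rule Lim_null_comparison[OF always_eventually[OF allI[OF Jle]]])
    show "(\<lambda>n. (LINT x|lebesgue. g x) / (1 - q)\<^sup>2 * r ^ n) \<longlonglongrightarrow> 0"
      using r by (intro tendsto_mult_right_zero LIMSEQ_realpow_zero) auto
  qed
  define R where "R = (LINT x|lebesgue. (norm (T u x - u x))\<^sup>2)"
  have sqTu: "sq_integrable (\<lambda>x. T u x - u x)" by (intro sq_integrable_diff T squ)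
  have "R \<le> 2 * k * J n + 2 * J (Suc n)" for n
  proof -
    have s1: "sq_integrable (\<lambda>x. T u x - U (Suc n) x)" by (intro sq_integrable_diff T squ sqU)
    have "R \<le> (LINT x|lebesgue. 2 * (norm (T u x - U (Suc n) x))\<^sup>2 + 2 * (norm (u x - U (Suc n) x))\<^sup>2)"
      unfolding R_def
    proof (rule integral_mono_AE)
      show "AE x in lebesgue. (norm (T u x - u x))\<^sup>2 \<le> 2 * (norm (T u x - U (Suc n) x))\<^sup>2 + 2 * (norm (u x - U (Suc n) x))\<^sup>2"
      proof (intro AE_I2)
        fix x
        show "(norm (T u x - u x))\<^sup>2 \<le> 2 * (norm (T u x - U (Suc n) x))\<^sup>2 + 2 * (norm (u x - U (Suc n) x))\<^sup>2"
          using norm_add_squared_le[of "T u x - U (Suc n) x" "U (Suc n) x - u x"] by (simp add: norm_minus_commute)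
      qed
    qed (use sqTu s1 sqdiff[of "Suc n"] in \<open>auto simp: sq_integrable_def\<close>)
    also have "\<dots> = 2 * (LINT x|lebesgue. (norm (T u x - T (U n) x))\<^sup>2) + 2 * J (Suc n)"
      using s1 sqdiff[of "Suc n"] unfolding J_def U_Suc
      by (subst Bochner_Integration.integral_add) (auto simp: sq_integrable_def)
    also have "\<dots> \<le> 2 * (k * J n) + 2 * J (Suc n)" using lip[OF squ sqU[of n]] by (simp add: J_def)
    finally show ?thesis by simp
  qed
  moreover have "(\<lambda>n. 2 * k * J n + 2 * J (Suc n)) \<longlonglongrightarrow> 2 * k * 0 + 2 * 0"
    by (intro tendsto_add tendsto_mult_left Jlim LIMSEQ_Suc[OF Jlim])
  ultimately have "R \<le> 0" by (intro LIMSEQ_le_const[where X = "\<lambda>n. 2 * k * J n + 2 * J (Suc n)"]) auto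
  moreover have "R \<ge> 0" unfolding R_def by (intro integral_nonneg_AE) auto
  ultimately have "R = 0" by simp
  then have "AE x in lebesgue. (norm (T u x - u x))\<^sup>2 = 0"
    using sqTu unfolding R_def by (subst (asm) integral_nonneg_eq_0_iff_AE) (auto simp: sq_integrable_def)
  then have "AE x in lebesgue. T u x = u x" by simp
  with squ show thesis by (rule that)
qed

section \<open>A first-order equation on the line\<close>

lemma weighted_young_inequality: "a * b \<le> c / 2 * a\<^sup>2 + b\<^sup>2 / (2 * c)" if "c > 0" for a b c :: real
proof -
  have "0 \<le> (c * a - b)\<^sup>2 / (2 * c)" using that by simp
  also have "\<dots> = c / 2 * a\<^sup>2 + b\<^sup>2 / (2 * c) - a * b" using that by (simp add: power2_eq_square field_simps)
  finally show ?thesis by simp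
qed

lemma has_vector_derivative_mult_cnj:
  assumes "(f has_vector_derivative f') (at x)" "(g has_vector_derivative g') (at x)"
  shows "((\<lambda>x. f x * cnj (g x)) has_vector_derivative f' * cnj (g x) + f x * cnj g') (at x)"
  using has_vector_derivative_mult[OF assms(1) has_vector_derivative_cnj[OF assms(2)]] by (simp add: add.commute)

text \<open>Reflection exchanges the two signs of the real part of \<open>a\<close> in the equation \<open>\<phi>' + a \<phi> = f\<close>.\<close>

lemma sq_integrable_reflect:
  assumes "sq_integrable f"
  shows "sq_integrable (\<lambda>x :: real. f (- x))"
  unfolding sq_integrable_def
proof
  have "(\<lambda>x :: real. - x) = (*\<^sub>R) (- 1)" by auto
  then have "(\<lambda>x :: real. - x) \<in> lebesgue \<rightarrow>\<^sub>M lebesgue" using lebesgue_measurable_scaling[of "- 1 :: real"] by metis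
  then show "(\<lambda>x. f (- x)) \<in> borel_measurable lebesgue"
    using assms unfolding sq_integrable_def by (metis measurable_compose)
  have "(\<lambda>x. (norm (f x))\<^sup>2) absolutely_integrable_on UNIV"
    using assms by (simp add: sq_integrable_def set_integrable_def)
  then have "(\<lambda>x. (norm (f (- x)))\<^sup>2) absolutely_integrable_on UNIV"
    using has_absolute_integral_reflect_real[of UNIV UNIV "\<lambda>x. (norm (f x))\<^sup>2"] by auto
  then show "integrable lebesgue (\<lambda>x. (norm (f (- x)))\<^sup>2)" by (simp add: set_integrable_def)
qed

lemma exp_minus_integrable_halfline:
  fixes \<alpha> x :: real
  assumes "\<alpha> > 0"
  shows "integrable lebesgue (\<lambda>y. indicator {x..} y *\<^sub>R exp (- \<alpha> * y))" 
    "(LINT y|lebesgue. indicator {x..} y *\<^sub>R exp (- \<alpha> * y)) = exp (- \<alpha> * x) / \<alpha>"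
proof -
  have hi: "((\<lambda>y. exp (- \<alpha> * y)) has_integral exp (- \<alpha> * x) / \<alpha>) {x..}"
    by (rule has_integral_exp_minus_to_infinity[OF assms])
  then have a: "(\<lambda>y. exp (- \<alpha> * y)) absolutely_integrable_on {x..}"
    by (intro nonnegative_absolutely_integrable_1) (auto simp: has_integral_integrable)
  then show "integrable lebesgue (\<lambda>y. indicator {x..} y *\<^sub>R exp (- \<alpha> * y))" by (simp add: set_integrable_def)
  show "(LINT y|lebesgue. indicator {x..} y *\<^sub>R exp (- \<alpha> * y)) = exp (- \<alpha> * x) / \<alpha>"
    using set_lebesgue_integral_eq_integral(2)[OF a] integral_unique[OF hi] by (simp add: set_lebesgue_integral_def)
qed

text \<open>When homogeneous solutions grow to the right, the bounded solution integrates from the right end: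
\<open>\<phi> x = - \<integral> exp (a (y - x)) f y dy\<close> over \<open>y \<ge> x\<close>. That \<open>\<phi>\<close> is square integrable follows from the energy
identity for \<open>|\<phi>|\<^sup>2\<close>, whose boundary terms are controlled because \<open>\<phi>\<close> is bounded.\<close>

lemma sq_integrable_first_order_ode_growing:
  fixes f :: "real \<Rightarrow> complex"
  assumes f: "sq_integrable f" and a: "Re a < 0"
  obtains \<phi> where "\<phi> \<in> AC_loc" "sq_integrable \<phi>" "AE x in lebesgue. (\<phi> has_vector_derivative f x - a * \<phi> x) (at x)"
proof -
  define \<alpha> where "\<alpha> = - Re a"
  have \<alpha>: "\<alpha> > 0" using a by (simp add: \<alpha>_def)
  have fm: "f \<in> borel_measurable lebesgue" and f2: "integrable lebesgue (\<lambda>x. (norm (f x))\<^sup>2)"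
    using f by (auto simp: sq_integrable_def)
  define F where "F = (LINT x|lebesgue. (norm (f x))\<^sup>2)"
  have expm: "(\<lambda>y. exp (c * complex_of_real (y - x))) \<in> borel_measurable lebesgue" for c x
    by (intro measurable_completion) (simp add: borel_measurable_continuous_onI continuous_intros)
  define k where "k = (\<lambda>x y. indicator {x..} y *\<^sub>R (exp (a * complex_of_real (y - x)) * f y))"
  have km: "k x \<in> borel_measurable lebesgue" for x
    unfolding k_def using fm expm by (intro borel_measurable_scaleR borel_measurable_indicator borel_measurable_times) auto
  \<comment> \<open>An integrable majorant of \<open>k x\<close>, from \<open>2 s t \<le> s\<^sup>2 + t\<^sup>2\<close>; its integral does not depend on \<open>x\<close>, which
    bounds \<open>\<phi>\<close> uniformly.\<close>
  define b where "b = (\<lambda>x y. (exp (2 * \<alpha> * x) * (indicator {x..} y *\<^sub>R exp (- (2 * \<alpha>) * y)) + (norm (f y))\<^sup>2) / 2)"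
  have b: "integrable lebesgue (b x)" "(LINT y|lebesgue. b x y) = (1 / (2 * \<alpha>) + F) / 2" for x
  proof -
    have a2: "2 * \<alpha> > 0" using \<alpha> by simp
    note e = exp_minus_integrable_halfline[OF a2, of x]
    show "integrable lebesgue (b x)" unfolding b_def using e(1) f2
      by (intro Bochner_Integration.integrable_divide Bochner_Integration.integrable_add integrable_mult_right) auto
    have "(LINT y|lebesgue. b x y) = (exp (2 * \<alpha> * x) * (exp (- (2 * \<alpha>) * x) / (2 * \<alpha>)) + F) / 2"
      unfolding b_def F_def e(2)[symmetric] using e(1) f2
      by (simp only: Bochner_Integration.integral_divide_zero Bochner_Integration.integral_add integrable_mult_right integral_mult_right_zero)
    also have "exp (2 * \<alpha> * x) * (exp (- (2 * \<alpha>) * x) / (2 * \<alpha>)) = 1 / (2 * \<alpha>)"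
      by (simp add: exp_minus field_simps)
    finally show "(LINT y|lebesgue. b x y) = (1 / (2 * \<alpha>) + F) / 2" .
  qed
  have kb: "norm (k x y) \<le> b x y" for x y
  proof (cases "x \<le> y")
    case True
    have "norm (k x y) = exp (- \<alpha> * (y - x)) * norm (f y)" using True by (simp add: k_def norm_mult \<alpha>_def)
    also have "\<dots> \<le> ((exp (- \<alpha> * (y - x)))\<^sup>2 + (norm (f y))\<^sup>2) / 2"
      using sum_squares_bound[of "exp (- \<alpha> * (y - x))" "norm (f y)"] by simp
    also have "(exp (- \<alpha> * (y - x)))\<^sup>2 = exp (2 * \<alpha> * x) * exp (- (2 * \<alpha>) * y)"
      unfolding exp_add[symmetric] exp_double[symmetric] by (simp add: algebra_simps)
    finally show ?thesis using True by (simp add: b_def)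
  qed (simp add: k_def b_def)
  have kint: "integrable lebesgue (k x)" for x
    by (rule Bochner_Integration.integrable_bound[OF b(1)[of x] km]) (use kb[of x] in \<open>auto intro!: AE_I2 order_trans[OF kb abs_ge_self]\<close>)
  define \<phi> where "\<phi> = (\<lambda>x. - (LINT y|lebesgue. k x y))"
  define B where "B = (1 / (2 * \<alpha>) + F) / 2"
  have \<phi>_bound: "norm (\<phi> x) \<le> B" for x
  proof -
    have "norm (\<phi> x) \<le> (LINT y|lebesgue. norm (k x y))" unfolding \<phi>_def by (simp add: integral_norm_bound)
    also have "\<dots> \<le> (LINT y|lebesgue. b x y)" by (intro integral_mono kint integrable_norm b kb)
    finally show ?thesis by (simp add: b(2) B_def)
  qed
  define g where "g = (\<lambda>y. exp (a * complex_of_real y) * f y)"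
  define G where "G = (\<lambda>x. exp (a * complex_of_real x) * \<phi> x)"
  have gk: "indicator {x..} y *\<^sub>R g y = exp (a * complex_of_real x) * k x y" for x y
    by (simp add: g_def k_def indicator_def exp_diff right_diff_distrib)
  have gint: "set_integrable lebesgue {x..} g" for x
    unfolding set_integrable_def gk using kint by simp
  have GT: "G x = - (LINT y:{x..}|lebesgue. g y)" for x
    unfolding G_def \<phi>_def set_lebesgue_integral_def gk by simp
  have gabs: "g absolutely_integrable_on {s..t}" for s t
    by (rule set_integrable_subset[OF gint[of s]]) auto
  have Ginc: "(g has_integral G t - G s) {s..t}" if "s \<le> t" for s t
  proof -
    have "(LINT y:{s..}|lebesgue. g y) = (LINT y:{s..t}|lebesgue. g y) + (LINT y:{t..}|lebesgue. g y)"
    proof -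
      have "(LINT y:{s..}|lebesgue. g y) = (LINT y|lebesgue. indicator {s..t} y *\<^sub>R g y + indicator {t..} y *\<^sub>R g y)"
        unfolding set_lebesgue_integral_def
      proof (rule integral_cong_AE)
        have "AE y in lebesgue. y \<notin> {t}" by (rule AE_not_in) (simp add: negligible_iff_null_sets[symmetric])
        then show "AE y in lebesgue. indicator {s..} y *\<^sub>R g y = indicator {s..t} y *\<^sub>R g y + indicator {t..} y *\<^sub>R g y"
          by eventually_elim (use that in \<open>auto simp: indicator_def\<close>)
      qed (use gint[of s] gint[of t] gabs[of s t] in \<open>auto simp: set_integrable_def\<close>)
      also have "\<dots> = (LINT y:{s..t}|lebesgue. g y) + (LINT y:{t..}|lebesgue. g y)"
        unfolding set_lebesgue_integral_def using gint[of t] gabs[of s t]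
        by (intro Bochner_Integration.integral_add) (auto simp: set_integrable_def)
      finally show ?thesis .
    qed
    then have "G t - G s = (LINT y:{s..t}|lebesgue. g y)" by (simp add: GT)
    then show ?thesis using has_integral_set_lebesgue[OF gabs[of s t]] by simp
  qed
  have GAC: "G \<in> AC_loc" by (rule indefinite_integral_AC_loc[OF gabs Ginc])
  have Gd: "AE x in lebesgue. (G has_vector_derivative g x) (at x)" by (rule indefinite_integral_derivative_AE[OF Ginc])
  have \<phi>G: "\<phi> = (\<lambda>x. exp (- a * complex_of_real x) * G x)"
    by (rule ext) (simp add: G_def mult.assoc[symmetric] exp_add[symmetric])
  have \<phi>AC: "\<phi> \<in> AC_loc" unfolding \<phi>G by (intro AC_loc_mult AC_loc_exp GAC)
  have \<phi>d: "AE x in lebesgue. (\<phi> has_vector_derivative f x - a * \<phi> x) (at x)"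
    using Gd
  proof eventually_elim
    case (elim x)
    have "((\<lambda>z. exp (- a * z)) has_field_derivative - a * exp (- a * complex_of_real x)) (at (complex_of_real x))"
      by (auto intro!: derivative_eq_intros)
    then have "((\<lambda>x. exp (- a * complex_of_real x)) has_vector_derivative - a * exp (- a * complex_of_real x)) (at x)"
      by (rule has_vector_derivative_real_field)
    from has_vector_derivative_mult[OF this elim]
    have "(\<phi> has_vector_derivative exp (- a * complex_of_real x) * g x + - a * exp (- a * complex_of_real x) * G x) (at x)"
      unfolding \<phi>G .
    also have "exp (- a * complex_of_real x) * g x + - a * exp (- a * complex_of_real x) * G x = f x - a * \<phi> x"
      unfolding g_def G_def by (simp add: exp_minus field_simps)
    finally show ?case .
  qed
  have \<phi>m: "\<phi> \<in> borel_measurable lebesgue" by (rule AC_loc_measurable[OF \<phi>AC])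
  define w where "w = (\<lambda>x. \<phi> x * cnj (\<phi> x))"
  define dw where "dw = (\<lambda>x. (f x - a * \<phi> x) * cnj (\<phi> x) + \<phi> x * cnj (f x - a * \<phi> x))"
  have wAC: "w \<in> AC_loc" unfolding w_def by (intro AC_loc_mult AC_loc_cnj \<phi>AC)
  have wd: "AE x in lebesgue. (w has_vector_derivative dw x) (at x)"
    using \<phi>d unfolding w_def dw_def by eventually_elim (rule has_vector_derivative_mult_cnj)
  have pw: "\<alpha> * (norm (\<phi> x))\<^sup>2 \<le> Re (dw x) + (norm (f x))\<^sup>2 / \<alpha>" for x
  proof -
    have "Re (dw x) = 2 * \<alpha> * (norm (\<phi> x))\<^sup>2 + 2 * Re (f x * cnj (\<phi> x))"
      unfolding dw_def \<alpha>_def cmod_power2 by (simp add: power2_eq_square algebra_simps)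
    moreover have "- Re (f x * cnj (\<phi> x)) \<le> norm (\<phi> x) * norm (f x)"
      using abs_Re_le_cmod[of "f x * cnj (\<phi> x)"] by (simp add: norm_mult mult.commute)
    moreover have "norm (\<phi> x) * norm (f x) \<le> \<alpha> / 2 * (norm (\<phi> x))\<^sup>2 + (norm (f x))\<^sup>2 / (2 * \<alpha>)" by (rule weighted_young_inequality[OF \<alpha>])
    ultimately show ?thesis by (simp add: field_simps)
  qed
  define C where "C = (B\<^sup>2 + F / \<alpha>) / \<alpha>"
  have loc: "(\<integral>\<^sup>+x. ennreal (indicator {- real n..real n} x *\<^sub>R (norm (\<phi> x))\<^sup>2) \<partial>lebesgue) \<le> ennreal C" for n
  proof -
    let ?S = "{- real n..real n}"
    have c: "continuous_on UNIV \<phi>" by (rule AC_loc_continuous[OF \<phi>AC])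
    have i1: "set_integrable lebesgue ?S (\<lambda>x. (norm (\<phi> x))\<^sup>2)"
      using absolutely_integrable_continuous[of "- real n" "real n" "\<lambda>x. (norm (\<phi> x))\<^sup>2"]
      by (simp add: continuous_intros continuous_on_subset[OF c])
    have i2: "set_integrable lebesgue ?S dw" by (rule AC_loc_ftc(1)[OF wAC wd])
    have i3: "set_integrable lebesgue ?S (\<lambda>x. (norm (f x))\<^sup>2)"
      using f2 by (intro set_integrable_lebesgue_of_integrable) auto
    have j2: "set_integrable lebesgue ?S (\<lambda>x. Re (dw x))"
      using integrable_Re[OF i2[unfolded set_integrable_def]] by (simp add: set_integrable_def)
    have j3: "set_integrable lebesgue ?S (\<lambda>x. (norm (f x))\<^sup>2 / \<alpha>)"
      using i3 by (simp add: set_integrable_def)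
    have "\<alpha> * (LINT x:?S|lebesgue. (norm (\<phi> x))\<^sup>2) = (LINT x:?S|lebesgue. \<alpha> * (norm (\<phi> x))\<^sup>2)" by simp
    also have "\<dots> \<le> (LINT x:?S|lebesgue. Re (dw x) + (norm (f x))\<^sup>2 / \<alpha>)"
      using pw by (intro set_integral_mono set_integrable_mult_right[OF i1] set_integral_add j2 j3) auto
    also have "\<dots> = (LINT x:?S|lebesgue. Re (dw x)) + (LINT x:?S|lebesgue. (norm (f x))\<^sup>2) / \<alpha>"
      using j2 j3 by (subst set_integral_add) auto
    also have "(LINT x:?S|lebesgue. Re (dw x)) = Re (LINT x:?S|lebesgue. dw x)"
      using i2 by (simp add: set_lebesgue_integral_def set_integrable_def flip: integral_Re)
    also have "(LINT x:?S|lebesgue. dw x) = w (real n) - w (- real n)" by (rule AC_loc_increment[OF wAC wd]) simp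
    also have "Re (w (real n) - w (- real n)) \<le> (norm (\<phi> (real n)))\<^sup>2"
      unfolding w_def cmod_power2 by (simp add: power2_eq_square)
    also have "(norm (\<phi> (real n)))\<^sup>2 \<le> B\<^sup>2" using \<phi>_bound by (intro power_mono) auto
    also have "(LINT x:?S|lebesgue. (norm (f x))\<^sup>2) \<le> F"
      unfolding F_def set_lebesgue_integral_def
      using i3 f2 by (intro integral_mono) (auto simp: set_integrable_def indicator_def)
    finally have "\<alpha> * (LINT x:?S|lebesgue. (norm (\<phi> x))\<^sup>2) \<le> B\<^sup>2 + F / \<alpha>" using \<alpha> by (simp add: divide_right_mono)
    then have "(LINT x:?S|lebesgue. (norm (\<phi> x))\<^sup>2) \<le> C" using \<alpha> by (simp add: C_def le_divide_eq mult.commute)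
    moreover have "(\<integral>\<^sup>+x. ennreal (indicator ?S x *\<^sub>R (norm (\<phi> x))\<^sup>2) \<partial>lebesgue) = ennreal (LINT x:?S|lebesgue. (norm (\<phi> x))\<^sup>2)"
      unfolding set_lebesgue_integral_def using i1 by (intro nn_integral_eq_integral) (auto simp: set_integrable_def)
    ultimately show ?thesis by (simp add: ennreal_leI)
  qed
  have "integrable lebesgue (\<lambda>x. (norm (\<phi> x))\<^sup>2)"
  proof (rule integrableI_bounded)
    show "(\<lambda>x. (norm (\<phi> x))\<^sup>2) \<in> borel_measurable lebesgue" using \<phi>m by measurable
    let ?k = "\<lambda>n x. ennreal (indicator {- real n..real n} x *\<^sub>R (norm (\<phi> x))\<^sup>2)"
    have "ennreal (norm ((norm (\<phi> x))\<^sup>2)) \<le> (SUP n. ?k n x)" for x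
    proof -
      obtain n where "\<bar>x\<bar> \<le> real n" using real_arch_simple by blast
      then have "ennreal (norm ((norm (\<phi> x))\<^sup>2)) = ?k n x" by (auto simp: indicator_def)
      also have "\<dots> \<le> (SUP n. ?k n x)" by (rule SUP_upper) simp
      finally show ?thesis .
    qed
    then have "(\<integral>\<^sup>+x. ennreal (norm ((norm (\<phi> x))\<^sup>2)) \<partial>lebesgue) \<le> (\<integral>\<^sup>+x. (SUP n. ?k n x) \<partial>lebesgue)"
      by (intro nn_integral_mono) auto
    also have "\<dots> = (SUP n. \<integral>\<^sup>+x. ?k n x \<partial>lebesgue)"
    proof (rule nn_integral_monotone_convergence_SUP)
      show "incseq ?k" by (intro incseq_SucI le_funI ennreal_leI scaleR_right_mono) (auto simp: indicator_def)
      show "?k n \<in> borel_measurable lebesgue" for n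
        using \<phi>m by (intro measurable_compose[OF _ measurable_ennreal] borel_measurable_scaleR borel_measurable_indicator) auto
    qed
    also have "\<dots> \<le> ennreal C" using loc by (rule SUP_least)
    finally show "(\<integral>\<^sup>+x. ennreal (norm ((norm (\<phi> x))\<^sup>2)) \<partial>lebesgue) < \<infinity>" by (rule le_less_trans) simp
  qed
  then have "sq_integrable \<phi>" using \<phi>m by (simp add: sq_integrable_def)
  then show thesis using \<phi>AC \<phi>d by (intro that[of \<phi>])
qed

lemma sq_integrable_first_order_ode:
  fixes f :: "real \<Rightarrow> complex"
  assumes f: "sq_integrable f" and a: "Re a \<noteq> 0"
  obtains \<phi> where "\<phi> \<in> AC_loc" "sq_integrable \<phi>" "AE x in lebesgue. (\<phi> has_vector_derivative f x - a * \<phi> x) (at x)"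
proof (cases "Re a < 0")
  case True
  from sq_integrable_first_order_ode_growing[OF f this] that show thesis .
next
  case False
  with a have a': "Re (- a) < 0" by simp
  have f': "sq_integrable (\<lambda>x. - f (- x))" by (intro sq_integrable_uminus sq_integrable_reflect f)
  obtain \<psi> where \<psi>: "\<psi> \<in> AC_loc" "sq_integrable \<psi>"
     "AE x in lebesgue. (\<psi> has_vector_derivative - f (- x) - (- a) * \<psi> x) (at x)"
    by (rule sq_integrable_first_order_ode_growing[OF f' a']) (rule that)
  define N where "N = {x. \<not> (\<psi> has_vector_derivative - f (- x) - (- a) * \<psi> x) (at x)}"
  have "negligible N" using \<psi>(3) unfolding AE_lebesgue_iff_negligible N_def .
  then have "negligible (uminus ` N)" by (rule negligible_differentiable_image_negligible[OF order_refl]) (simp add: linear_imp_differentiable_on linear_uminus)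
  moreover have "((\<lambda>x. \<psi> (- x)) has_vector_derivative f x - a * \<psi> (- x)) (at x)" if x: "x \<notin> uminus ` N" for x
  proof -
    have "- x \<notin> N" using x by (metis imageI minus_minus)
    then have "(\<psi> has_vector_derivative - f x + a * \<psi> (- x)) (at (- x))" by (simp add: N_def)
    moreover have "(uminus has_vector_derivative - 1) (at x)" by (auto intro!: derivative_eq_intros simp: has_vector_derivative_def)
    ultimately have "(\<psi> \<circ> uminus has_vector_derivative - 1 *\<^sub>R (- f x + a * \<psi> (- x))) (at x)"
      by (intro vector_diff_chain_at) auto
    then show ?thesis by (simp add: o_def)
  qed
  ultimately have "AE x in lebesgue. ((\<lambda>x. \<psi> (- x)) has_vector_derivative f x - a * \<psi> (- x)) (at x)"
    unfolding AE_lebesgue_iff_negligible by (elim negligible_subset) blast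
  then show thesis using that[OF AC_loc_reflect[OF \<psi>(1)] sq_integrable_reflect[OF \<psi>(2)]] by simp
qed

section \<open>Energy estimates for the Dirac system\<close>

text \<open>Passage from a pointwise inequality to an estimate: the derivative \<open>dw\<close> integrates to zero.\<close>

lemma energy_inequality_integrated:
  fixes u v F1 F2 w dw :: "real \<Rightarrow> complex"
  assumes "sq_integrable u" "sq_integrable v" "sq_integrable F1" "sq_integrable F2"
    and w: "w \<in> AC_loc" "integrable lebesgue w" "integrable lebesgue dw" "AE x in lebesgue. (w has_vector_derivative dw x) (at x)"
    and le: "AE x in lebesgue. a * ((norm (u x))\<^sup>2 + (norm (v x))\<^sup>2) \<le> Re (dw x) + C * ((norm (F1 x))\<^sup>2 + (norm (F2 x))\<^sup>2)"
  shows "a * (LINT x|lebesgue. (norm (u x))\<^sup>2 + (norm (v x))\<^sup>2) \<le> C * (LINT x|lebesgue. (norm (F1 x))\<^sup>2 + (norm (F2 x))\<^sup>2)"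
proof -
  have i: "integrable lebesgue (\<lambda>x. (norm (u x))\<^sup>2 + (norm (v x))\<^sup>2)" "integrable lebesgue (\<lambda>x. (norm (F1 x))\<^sup>2 + (norm (F2 x))\<^sup>2)"
    using assms(1-4) by (auto simp: sq_integrable_def)
  have "a * (LINT x|lebesgue. (norm (u x))\<^sup>2 + (norm (v x))\<^sup>2) = (LINT x|lebesgue. a * ((norm (u x))\<^sup>2 + (norm (v x))\<^sup>2))"
    by simp
  also have "\<dots> \<le> (LINT x|lebesgue. Re (dw x) + C * ((norm (F1 x))\<^sup>2 + (norm (F2 x))\<^sup>2))"
    by (rule integral_mono_AE[OF _ _ le]) (use i w(3) in auto)
  also have "\<dots> = (LINT x|lebesgue. Re (dw x)) + C * (LINT x|lebesgue. (norm (F1 x))\<^sup>2 + (norm (F2 x))\<^sup>2)"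
    using i(2) w(3) by (subst Bochner_Integration.integral_add) auto
  also have "(LINT x|lebesgue. Re (dw x)) = Re (LINT x|lebesgue. dw x)" using w(3) by simp
  also have "(LINT x|lebesgue. dw x) = 0" by (rule AC_loc_integral_derivative_eq_0[OF w])
  finally show ?thesis by simp
qed

text \<open>The equation \<open>(D - z)(u, v) = (F1, F2)\<close> solved for the derivatives of the two components.\<close>

definition dirac_solution :: "real \<Rightarrow> (real \<Rightarrow> complex) \<Rightarrow> (real \<Rightarrow> complex) \<Rightarrow> complex \<Rightarrow>
    (real \<Rightarrow> complex) \<Rightarrow> (real \<Rightarrow> complex) \<Rightarrow> (real \<Rightarrow> complex) \<Rightarrow> (real \<Rightarrow> complex) \<Rightarrow> bool" where
  "dirac_solution h p q z F1 F2 u v \<longleftrightarrow>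
     (AE x in lebesgue. (u has_vector_derivative (q x * v x - \<i> * z * u x - \<i> * F1 x) / h) (at x)) \<and>
     (AE x in lebesgue. (v has_vector_derivative (p x * u x + \<i> * z * v x + \<i> * F2 x) / h) (at x))"

text \<open>The imaginary part of \<open>F1 cnj u + F2 cnj v\<close>, rearranged. Here \<open>U\<close> and \<open>V\<close> stand for \<open>h u'\<close> and \<open>h v'\<close>, and
the term with \<open>s\<close> is the derivative of \<open>s h (|u|\<^sup>2 - |v|\<^sup>2) / 2\<close>. Young's inequality gives up half of the
available gap \<open>\<kappa>\<close> in order to absorb \<open>F1\<close> and \<open>F2\<close>.\<close>

lemma energy_pointwise_imaginary_part:
  fixes u v U V p q z F1 F2 :: complex and s P Q \<kappa> :: real
  assumes U: "U = q * v - \<i> * z * u - \<i> * F1" and V: "V = p * u + \<i> * z * v + \<i> * F2"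
    and s: "s * Im z = \<bar>Im z\<bar>" "\<bar>s\<bar> = 1" and P: "norm p \<le> P" "norm q \<le> Q"
    and \<kappa>: "\<kappa> = \<bar>Im z\<bar> - (P + Q) / 2" "\<kappa> > 0"
  shows "\<kappa> / 2 * ((norm u)\<^sup>2 + (norm v)\<^sup>2) \<le> 
     Re (of_real s / 2 * (U * cnj u + u * cnj U - (V * cnj v + v * cnj V))) + 1 / (2 * \<kappa>) * ((norm F1)\<^sup>2 + (norm F2)\<^sup>2)"
proof -
  define R where "R = Re (p * u * cnj v - q * v * cnj u) - Im (F1 * cnj u + F2 * cnj v)"
  have "Im z * ((norm u)\<^sup>2 + (norm v)\<^sup>2) = Re (1 / 2 * (U * cnj u + u * cnj U - (V * cnj v + v * cnj V))) + R"
    unfolding U V R_def cmod_power2 by (simp add: power2_eq_square field_simps)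
  then have "s * (Im z * ((norm u)\<^sup>2 + (norm v)\<^sup>2)) = s * Re (1 / 2 * (U * cnj u + u * cnj U - (V * cnj v + v * cnj V))) + s * R"
    by (simp only: distrib_left)
  also have "s * (Im z * ((norm u)\<^sup>2 + (norm v)\<^sup>2)) = \<bar>Im z\<bar> * ((norm u)\<^sup>2 + (norm v)\<^sup>2)"
    using s(1) by (metis mult.assoc)
  also have "s * Re (1 / 2 * (U * cnj u + u * cnj U - (V * cnj v + v * cnj V))) = Re (of_real s / 2 * (U * cnj u + u * cnj U - (V * cnj v + v * cnj V)))"
    by (simp add: field_simps)
  finally have 1: "\<bar>Im z\<bar> * ((norm u)\<^sup>2 + (norm v)\<^sup>2) = Re (of_real s / 2 * (U * cnj u + u * cnj U - (V * cnj v + v * cnj V))) + s * R" .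
  have "s * R \<le> \<bar>R\<bar>" using s(2) by (metis abs_ge_self abs_mult mult_1)
  also have "\<dots> \<le> norm (p * u * cnj v - q * v * cnj u) + norm (F1 * cnj u + F2 * cnj v)"
    unfolding R_def using abs_Re_le_cmod[of "p * u * cnj v - q * v * cnj u"] abs_Im_le_cmod[of "F1 * cnj u + F2 * cnj v"] by linarith
  also have "\<dots> \<le> (norm p * norm u * norm v + norm q * norm v * norm u) + (norm F1 * norm u + norm F2 * norm v)"
    by (intro add_mono norm_triangle_le norm_triangle_le_diff) (auto simp: norm_mult)
  also have "\<dots> \<le> (P + Q) * (norm u * norm v) + (norm F1 * norm u + norm F2 * norm v)"
  proof -
    have "norm p * (norm u * norm v) \<le> P * (norm u * norm v)" "norm q * (norm u * norm v) \<le> Q * (norm u * norm v)"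
      using P by (intro mult_right_mono; simp)+
    then show ?thesis by (simp add: algebra_simps)
  qed
  also have "(P + Q) * (norm u * norm v) \<le> (P + Q) * (((norm u)\<^sup>2 + (norm v)\<^sup>2) / 2)"
  proof (intro mult_left_mono)
    show "norm u * norm v \<le> ((norm u)\<^sup>2 + (norm v)\<^sup>2) / 2" using sum_squares_bound[of "norm u" "norm v"] by simp
    show "0 \<le> P + Q" using P order_trans[OF norm_ge_zero] by (meson add_nonneg_nonneg)
  qed
  also have "norm F1 * norm u \<le> \<kappa> / 2 * (norm u)\<^sup>2 + (norm F1)\<^sup>2 / (2 * \<kappa>)" using weighted_young_inequality[OF \<kappa>(2), of "norm u" "norm F1"] by (simp add: mult.commute)
  also have "norm F2 * norm v \<le> \<kappa> / 2 * (norm v)\<^sup>2 + (norm F2)\<^sup>2 / (2 * \<kappa>)" using weighted_young_inequality[OF \<kappa>(2), of "norm v" "norm F2"] by (simp add: mult.commute)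
  finally have "s * R \<le> (P + Q) / 2 * ((norm u)\<^sup>2 + (norm v)\<^sup>2) + \<kappa> / 2 * ((norm u)\<^sup>2 + (norm v)\<^sup>2) + 1 / (2 * \<kappa>) * ((norm F1)\<^sup>2 + (norm F2)\<^sup>2)"
    by (simp add: algebra_simps add_divide_distrib)
  moreover have "\<bar>Im z\<bar> * ((norm u)\<^sup>2 + (norm v)\<^sup>2) = \<kappa> * ((norm u)\<^sup>2 + (norm v)\<^sup>2) + (P + Q) / 2 * ((norm u)\<^sup>2 + (norm v)\<^sup>2)"
    unfolding \<kappa>(1) by (simp add: algebra_simps)
  ultimately show ?thesis using 1 by (simp add: algebra_simps)
qed

text \<open>The imaginary part of \<open>F \<bullet> (D\<^sup>* + cnj z)\<Psi>\<close> with \<open>(D\<^sup>* + cnj z)\<Psi> = F + (Q\<^sup>* - Q + 2 Re z)\<Psi>\<close>. The contribution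
\<open>F \<bullet> F\<close> is real and has dropped out; the products \<open>p U cnj v + ...\<close> are the derivative of
\<open>h (p u cnj v + q v cnj u)\<close> apart from the terms that contain derivatives of \<open>p\<close> and \<open>q\<close>.\<close>

lemma dirac_square_identity:
  fixes u v U V p q z F1 F2 :: complex
  assumes U: "U = q * v - \<i> * z * u - \<i> * F1" and V: "V = p * u + \<i> * z * v + \<i> * F2" and pq: "Im (p * q) = 0"
  shows "2 * Re z * Im z * ((norm u)\<^sup>2 + (norm v)\<^sup>2) =
     Im (\<i> * z * (U * cnj u + u * cnj U - (V * cnj v + v * cnj V)) - (p * U * cnj v + p * u * cnj V + q * V * cnj u + q * v * cnj U))
     - Im (F1 * cnj (\<i> * (q - cnj p) * v + 2 * Re z * u) + F2 * cnj (\<i> * (cnj q - p) * u + 2 * Re z * v))"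
proof -
  have "Re p * Im q + Im p * Re q = 0" using pq by simp
  then show ?thesis
    unfolding U V cmod_power2 
    apply (simp add: power2_eq_square)
    by algebra
qed

text \<open>The argument of \<open>Re\<close> is \<open>- i s\<close> times the derivative of \<open>i h z (|u|\<^sup>2 - |v|\<^sup>2) - h (p u cnj v + q v cnj u)\<close>.
Completing this derivative costs the terms with \<open>dp\<close> and \<open>dq\<close>, which is why the derivatives of the
potentials enter the second inequality of the region.\<close>

lemma energy_pointwise_square:
  fixes u v U V p q dp dq z F1 F2 :: complex and h s P Q P' Q' \<kappa> K :: real
  assumes U: "U = q * v - \<i> * z * u - \<i> * F1" and V: "V = p * u + \<i> * z * v + \<i> * F2" and pq: "Im (p * q) = 0"
    and s: "s * (Re z * Im z) = \<bar>Re z * Im z\<bar>" "\<bar>s\<bar> = 1" and P: "norm p \<le> P" "norm q \<le> Q"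
    and P': "norm dp \<le> P'" "norm dq \<le> Q'" and h: "h > 0"
    and \<kappa>: "\<kappa> = 2 * \<bar>Re z * Im z\<bar> - h * (P' + Q') / 2" "\<kappa> > 0" and K: "K = P + Q + 2 * \<bar>Re z\<bar>"
  shows "\<kappa> / 2 * ((norm u)\<^sup>2 + (norm v)\<^sup>2) \<le>
     Re (- \<i> * of_real s * (\<i> * z * (U * cnj u + u * cnj U - (V * cnj v + v * cnj V))
        - (p * U * cnj v + p * u * cnj V + q * V * cnj u + q * v * cnj U) - of_real h * (dp * u * cnj v + dq * v * cnj u)))
      + 2 * K\<^sup>2 / \<kappa> * ((norm F1)\<^sup>2 + (norm F2)\<^sup>2)"
proof -
  define S where "S = (norm u)\<^sup>2 + (norm v)\<^sup>2"
  define X where "X = \<i> * z * (U * cnj u + u * cnj U - (V * cnj v + v * cnj V)) - (p * U * cnj v + p * u * cnj V + q * V * cnj u + q * v * cnj U)"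
  define D where "D = dp * u * cnj v + dq * v * cnj u"
  define Y where "Y = F1 * cnj (\<i> * (q - cnj p) * v + 2 * Re z * u) + F2 * cnj (\<i> * (cnj q - p) * u + 2 * Re z * v)"
  have "2 * Re z * Im z * S = Im X - Im Y"
    unfolding S_def X_def Y_def by (rule dirac_square_identity[OF U V pq])
  then have "s * (2 * Re z * Im z * S) = s * (Im X - Im Y)" by (rule arg_cong)
  then have "2 * (s * (Re z * Im z)) * S = s * Im X - s * Im Y" by (simp add: algebra_simps)
  also have "s * (Re z * Im z) = \<bar>Re z * Im z\<bar>" by (rule s(1))
  finally have 1: "2 * \<bar>Re z * Im z\<bar> * S = Re (- \<i> * of_real s * (X - of_real h * D)) + s * (h * Im D) - s * Im Y"
    by (simp add: algebra_simps)
  have sle: "s * t \<le> \<bar>t\<bar>" "- (s * t) \<le> \<bar>t\<bar>" for t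
  proof -
    have "\<bar>s * t\<bar> = \<bar>t\<bar>" using s(2) by (simp add: abs_mult)
    then show "s * t \<le> \<bar>t\<bar>" "- (s * t) \<le> \<bar>t\<bar>" by linarith+
  qed
  have uv: "norm u * norm v \<le> S / 2" using sum_squares_bound[of "norm u" "norm v"] by (simp add: S_def)
  have P0: "0 \<le> P" "0 \<le> Q" "0 \<le> P'" "0 \<le> Q'" using P P' order_trans[OF norm_ge_zero] by blast+
  have "\<bar>Im D\<bar> \<le> norm dp * norm u * norm v + norm dq * norm v * norm u"
    unfolding D_def by (rule order_trans[OF abs_Im_le_cmod]) (intro norm_triangle_le add_mono, auto simp: norm_mult)
  also have "\<dots> \<le> (P' + Q') * (norm u * norm v)"
  proof -
    have "norm dp * (norm u * norm v) \<le> P' * (norm u * norm v)" "norm dq * (norm u * norm v) \<le> Q' * (norm u * norm v)"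
      using P' by (intro mult_right_mono; simp)+
    then show ?thesis by (simp add: algebra_simps)
  qed
  also have "\<dots> \<le> (P' + Q') * (S / 2)" using uv P0 by (intro mult_left_mono) auto
  finally have "h * \<bar>Im D\<bar> \<le> h * ((P' + Q') * (S / 2))" using h by (intro mult_left_mono) auto
  then have 2: "s * (h * Im D) \<le> h * (P' + Q') / 2 * S"
    using sle(1)[of "h * Im D"] h by (simp add: abs_mult)
  have K0: "K \<ge> 0" using P0 K by simp
  have n1: "norm (\<i> * (q - cnj p) * v + 2 * Re z * u) \<le> K * (norm u + norm v)"
          "norm (\<i> * (cnj q - p) * u + 2 * Re z * v) \<le> K * (norm u + norm v)"
  proof -
    have a: "norm (q - cnj p) \<le> P + Q" "norm (cnj q - p) \<le> P + Q"
      using P norm_triangle_ineq4[of q "cnj p"] norm_triangle_ineq4[of "cnj q" p] by simp_all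
    have "norm (\<i> * (q - cnj p) * v + 2 * Re z * u) \<le> norm (q - cnj p) * norm v + 2 * \<bar>Re z\<bar> * norm u"
         "norm (\<i> * (cnj q - p) * u + 2 * Re z * v) \<le> norm (cnj q - p) * norm u + 2 * \<bar>Re z\<bar> * norm v"
      by (intro norm_triangle_le add_mono; simp add: norm_mult)+
    moreover have "norm (q - cnj p) * norm v \<le> K * norm v" "norm (cnj q - p) * norm u \<le> K * norm u"
      "2 * \<bar>Re z\<bar> * norm u \<le> K * norm u" "2 * \<bar>Re z\<bar> * norm v \<le> K * norm v"
      using a K P0 by (intro mult_right_mono; simp)+
    ultimately show "norm (\<i> * (q - cnj p) * v + 2 * Re z * u) \<le> K * (norm u + norm v)"
          "norm (\<i> * (cnj q - p) * u + 2 * Re z * v) \<le> K * (norm u + norm v)" by (simp_all add: distrib_left)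
  qed
  have \<kappa>2: "\<kappa> / 2 > 0" using \<kappa>(2) by simp
  have y: "norm a * (K * (norm u + norm v)) \<le> \<kappa> / 4 * S + 2 * K\<^sup>2 / \<kappa> * (norm a)\<^sup>2" for a :: complex
    using weighted_young_inequality[OF \<kappa>2, of "norm u" "K * norm a"] weighted_young_inequality[OF \<kappa>2, of "norm v" "K * norm a"]
    by (simp add: S_def power_mult_distrib algebra_simps)
  have "\<bar>Im Y\<bar> \<le> norm F1 * norm (\<i> * (q - cnj p) * v + 2 * Re z * u) + norm F2 * norm (\<i> * (cnj q - p) * u + 2 * Re z * v)"
    unfolding Y_def by (rule order_trans[OF abs_Im_le_cmod]) (intro norm_triangle_le add_mono, simp_all only: norm_mult complex_mod_cnj order_refl)
  also have "\<dots> \<le> norm F1 * (K * (norm u + norm v)) + norm F2 * (K * (norm u + norm v))"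
    by (intro add_mono mult_left_mono n1) auto
  also have "\<dots> \<le> (\<kappa> / 4 * S + 2 * K\<^sup>2 / \<kappa> * (norm F1)\<^sup>2) + (\<kappa> / 4 * S + 2 * K\<^sup>2 / \<kappa> * (norm F2)\<^sup>2)"
    by (intro add_mono y)
  finally have 3: "- (s * Im Y) \<le> \<kappa> / 2 * S + 2 * K\<^sup>2 / \<kappa> * ((norm F1)\<^sup>2 + (norm F2)\<^sup>2)"
    using sle(2)[of "Im Y"] by (simp add: algebra_simps)
  have "2 * \<bar>Re z * Im z\<bar> * S = \<kappa> * S + h * (P' + Q') / 2 * S" unfolding \<kappa>(1) by (simp add: algebra_simps)
  then have "\<kappa> / 2 * S \<le> Re (- \<i> * of_real s * (X - of_real h * D)) + 2 * K\<^sup>2 / \<kappa> * ((norm F1)\<^sup>2 + (norm F2)\<^sup>2)"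
    using 1 2 3 by simp
  then show ?thesis unfolding S_def X_def D_def .
qed

lemma dirac_apriori_imaginary_part:
  assumes h: "h > 0" and ac: "u \<in> AC_loc" "v \<in> AC_loc" and sq: "sq_integrable u" "sq_integrable v" "sq_integrable F1" "sq_integrable F2"
    and pq: "p \<in> borel_measurable lebesgue" "q \<in> borel_measurable lebesgue" "AE x in lebesgue. norm (p x) \<le> P" "AE x in lebesgue. norm (q x) \<le> Q"
    and sol: "dirac_solution h p q z F1 F2 u v" and \<kappa>: "\<kappa> = \<bar>Im z\<bar> - (P + Q) / 2" "\<kappa> > 0"
  shows "\<kappa>\<^sup>2 * (LINT x|lebesgue. (norm (u x))\<^sup>2 + (norm (v x))\<^sup>2) \<le> (LINT x|lebesgue. (norm (F1 x))\<^sup>2 + (norm (F2 x))\<^sup>2)"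
proof -
  define s where "s = (if Im z < 0 then - 1 else 1 :: real)"
  have s: "s * Im z = \<bar>Im z\<bar>" "\<bar>s\<bar> = 1" by (auto simp: s_def)
  define U where "U = (\<lambda>x. q x * v x - \<i> * z * u x - \<i> * F1 x)"
  define V where "V = (\<lambda>x. p x * u x + \<i> * z * v x + \<i> * F2 x)"
  have sqUV: "sq_integrable U" "sq_integrable V"
    unfolding U_def V_def using sq pq
    by (intro sq_integrable_add sq_integrable_diff sq_integrable_cmult sq_integrable_bounded_mult_AE; simp)+
  define w where "w = (\<lambda>x. of_real s / 2 * h * (u x * cnj (u x) - v x * cnj (v x)))"
  define dw where "dw = (\<lambda>x. of_real s / 2 * (U x * cnj (u x) + u x * cnj (U x) - (V x * cnj (v x) + v x * cnj (V x))))"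
  have "\<kappa> / 2 * (LINT x|lebesgue. (norm (u x))\<^sup>2 + (norm (v x))\<^sup>2) \<le> 1 / (2 * \<kappa>) * (LINT x|lebesgue. (norm (F1 x))\<^sup>2 + (norm (F2 x))\<^sup>2)"
  proof (rule energy_inequality_integrated[OF sq])
    show "w \<in> AC_loc" unfolding w_def by (intro AC_loc_cmult AC_loc_diff AC_loc_mult AC_loc_cnj ac)
    show "integrable lebesgue w" unfolding w_def
      by (intro integrable_mult_right Bochner_Integration.integrable_diff integrable_mult_sq_integrable sq_integrable_cnj sq)
    show "integrable lebesgue dw" unfolding dw_def
      by (intro integrable_mult_right Bochner_Integration.integrable_add Bochner_Integration.integrable_diff integrable_mult_sq_integrable sq_integrable_cnj sq sqUV)
    show "AE x in lebesgue. (w has_vector_derivative dw x) (at x)"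
      using conjunct1[OF sol[unfolded dirac_solution_def]] conjunct2[OF sol[unfolded dirac_solution_def]]
    proof eventually_elim
      case (elim x)
      have "(u has_vector_derivative U x / h) (at x)" "(v has_vector_derivative V x / h) (at x)"
        using elim by (simp_all add: U_def V_def)
      then have "(w has_vector_derivative of_real s / 2 * h * (U x / h * cnj (u x) + u x * cnj (U x / h) - (V x / h * cnj (v x) + v x * cnj (V x / h)))) (at x)"
        unfolding w_def by (intro has_vector_derivative_mult_right has_vector_derivative_diff has_vector_derivative_mult_cnj)
      also have "of_real s / 2 * h * (U x / h * cnj (u x) + u x * cnj (U x / h) - (V x / h * cnj (v x) + v x * cnj (V x / h))) = dw x"
        using h by (simp add: dw_def field_simps)
      finally show ?case .
    qed
    show "AE x in lebesgue. \<kappa> / 2 * ((norm (u x))\<^sup>2 + (norm (v x))\<^sup>2) \<le> Re (dw x) + 1 / (2 * \<kappa>) * ((norm (F1 x))\<^sup>2 + (norm (F2 x))\<^sup>2)"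
      using pq(3,4)
    proof eventually_elim
      case (elim x)
      show ?case unfolding dw_def
        by (rule energy_pointwise_imaginary_part[OF _ _ s elim \<kappa>]) (simp_all add: U_def V_def)
    qed
  qed
  then have "2 * \<kappa> * (\<kappa> / 2 * (LINT x|lebesgue. (norm (u x))\<^sup>2 + (norm (v x))\<^sup>2)) \<le> 2 * \<kappa> * (1 / (2 * \<kappa>) * (LINT x|lebesgue. (norm (F1 x))\<^sup>2 + (norm (F2 x))\<^sup>2))"
    using \<kappa>(2) by (intro mult_left_mono) auto
  then show ?thesis using \<kappa>(2) by (simp add: power2_eq_square)
qed

lemma dirac_apriori_square:
  assumes h: "h > 0" and ac: "u \<in> AC_loc" "v \<in> AC_loc" "p \<in> AC_loc" "q \<in> AC_loc"
    and sq: "sq_integrable u" "sq_integrable v" "sq_integrable F1" "sq_integrable F2"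
    and pq: "AE x in lebesgue. norm (p x) \<le> P" "AE x in lebesgue. norm (q x) \<le> Q" and pq_real: "\<And>x. Im (p x * q x) = 0"
    and dpq: "dp \<in> borel_measurable lebesgue" "dq \<in> borel_measurable lebesgue" "AE x in lebesgue. norm (dp x) \<le> P'" "AE x in lebesgue. norm (dq x) \<le> Q'"
    and dpq': "AE x in lebesgue. (p has_vector_derivative dp x) (at x)" "AE x in lebesgue. (q has_vector_derivative dq x) (at x)"
    and sol: "dirac_solution h p q z F1 F2 u v" and \<kappa>: "\<kappa> = 2 * \<bar>Re z * Im z\<bar> - h * (P' + Q') / 2" "\<kappa> > 0"
  shows "\<kappa>\<^sup>2 * (LINT x|lebesgue. (norm (u x))\<^sup>2 + (norm (v x))\<^sup>2) \<le> 4 * (P + Q + 2 * \<bar>Re z\<bar>)\<^sup>2 * (LINT x|lebesgue. (norm (F1 x))\<^sup>2 + (norm (F2 x))\<^sup>2)"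
proof -
  define s where "s = (if Re z * Im z < 0 then - 1 else 1 :: real)"
  have s: "s * (Re z * Im z) = \<bar>Re z * Im z\<bar>" "\<bar>s\<bar> = 1" by (auto simp: s_def)
  define K where "K = P + Q + 2 * \<bar>Re z\<bar>"
  define U where "U = (\<lambda>x. q x * v x - \<i> * z * u x - \<i> * F1 x)"
  define V where "V = (\<lambda>x. p x * u x + \<i> * z * v x + \<i> * F2 x)"
  have m: "p \<in> borel_measurable lebesgue" "q \<in> borel_measurable lebesgue" using ac by (auto intro: AC_loc_measurable)
  have sqUV: "sq_integrable U" "sq_integrable V"
    unfolding U_def V_def using sq pq m
    by (intro sq_integrable_add sq_integrable_diff sq_integrable_cmult sq_integrable_bounded_mult_AE; simp)+
  have pu: "sq_integrable (\<lambda>x. p x * u x)" "sq_integrable (\<lambda>x. q x * v x)" "sq_integrable (\<lambda>x. dp x * u x)" "sq_integrable (\<lambda>x. dq x * v x)"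
     "sq_integrable (\<lambda>x. p x * U x)" "sq_integrable (\<lambda>x. q x * V x)"
    using sq pq m sqUV dpq by (intro sq_integrable_bounded_mult_AE; simp)+
  define w where "w = (\<lambda>x. - \<i> * of_real s * (\<i> * h * z * (u x * cnj (u x) - v x * cnj (v x)) - h * (p x * u x * cnj (v x) + q x * v x * cnj (u x))))"
  define dw where "dw = (\<lambda>x. - \<i> * of_real s * (\<i> * z * (U x * cnj (u x) + u x * cnj (U x) - (V x * cnj (v x) + v x * cnj (V x)))
        - (p x * U x * cnj (v x) + p x * u x * cnj (V x) + q x * V x * cnj (u x) + q x * v x * cnj (U x)) - of_real h * (dp x * u x * cnj (v x) + dq x * v x * cnj (u x))))"
  have "\<kappa> / 2 * (LINT x|lebesgue. (norm (u x))\<^sup>2 + (norm (v x))\<^sup>2) \<le> 2 * K\<^sup>2 / \<kappa> * (LINT x|lebesgue. (norm (F1 x))\<^sup>2 + (norm (F2 x))\<^sup>2)"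
  proof (rule energy_inequality_integrated[OF sq])
    show "w \<in> AC_loc" unfolding w_def by (intro AC_loc_cmult AC_loc_diff AC_loc_add AC_loc_mult AC_loc_cnj ac)
    show "integrable lebesgue w" unfolding w_def
      by (intro integrable_mult_right Bochner_Integration.integrable_add Bochner_Integration.integrable_diff integrable_mult_sq_integrable sq_integrable_cnj sq pu)
    show "integrable lebesgue dw" unfolding dw_def
      by (intro integrable_mult_right Bochner_Integration.integrable_add Bochner_Integration.integrable_diff integrable_mult_sq_integrable sq_integrable_cnj sq sqUV pu)
    show "AE x in lebesgue. (w has_vector_derivative dw x) (at x)"
      using conjunct1[OF sol[unfolded dirac_solution_def]] conjunct2[OF sol[unfolded dirac_solution_def]] dpq'
    proof eventually_elim
      case (elim x)
      have du: "(u has_vector_derivative U x / h) (at x)" "(v has_vector_derivative V x / h) (at x)"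
        using elim by (simp_all add: U_def V_def)
      have "((\<lambda>x. p x * u x) has_vector_derivative p x * (U x / h) + dp x * u x) (at x)"
        "((\<lambda>x. q x * v x) has_vector_derivative q x * (V x / h) + dq x * v x) (at x)"
        by (rule has_vector_derivative_mult, fact, fact)+
      with du have "(w has_vector_derivative - \<i> * of_real s * (\<i> * h * z * (U x / h * cnj (u x) + u x * cnj (U x / h) - (V x / h * cnj (v x) + v x * cnj (V x / h)))
          - h * ((p x * (U x / h) + dp x * u x) * cnj (v x) + p x * u x * cnj (V x / h) + ((q x * (V x / h) + dq x * v x) * cnj (u x) + q x * v x * cnj (U x / h))))) (at x)"
        unfolding w_def by (intro has_vector_derivative_mult_right has_vector_derivative_diff has_vector_derivative_add has_vector_derivative_mult_cnj)
      also have "- \<i> * of_real s * (\<i> * h * z * (U x / h * cnj (u x) + u x * cnj (U x / h) - (V x / h * cnj (v x) + v x * cnj (V x / h)))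
          - h * ((p x * (U x / h) + dp x * u x) * cnj (v x) + p x * u x * cnj (V x / h) + ((q x * (V x / h) + dq x * v x) * cnj (u x) + q x * v x * cnj (U x / h)))) = dw x"
        using h by (simp add: dw_def field_simps)
      finally show ?case .
    qed
    show "AE x in lebesgue. \<kappa> / 2 * ((norm (u x))\<^sup>2 + (norm (v x))\<^sup>2) \<le> Re (dw x) + 2 * K\<^sup>2 / \<kappa> * ((norm (F1 x))\<^sup>2 + (norm (F2 x))\<^sup>2)"
      using pq dpq(3,4)
    proof eventually_elim
      case (elim x)
      show ?case unfolding dw_def
        by (rule energy_pointwise_square[OF _ _ pq_real s elim h \<kappa> K_def]) (simp_all add: U_def V_def)
    qed
  qed
  then have "2 * \<kappa> * (\<kappa> / 2 * (LINT x|lebesgue. (norm (u x))\<^sup>2 + (norm (v x))\<^sup>2)) \<le> 2 * \<kappa> * (2 * K\<^sup>2 / \<kappa> * (LINT x|lebesgue. (norm (F1 x))\<^sup>2 + (norm (F2 x))\<^sup>2))"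
    using \<kappa>(2) by (intro mult_left_mono) auto
  then show ?thesis using \<kappa>(2) by (simp add: power2_eq_square K_def)
qed

section \<open>Coercivity and solvability\<close>

definition L2_energy :: "(real \<Rightarrow> complex) \<Rightarrow> (real \<Rightarrow> complex) \<Rightarrow> real" where
  "L2_energy u v = (LINT x|lebesgue. (norm (u x))\<^sup>2 + (norm (v x))\<^sup>2)"

text \<open>The a priori bound on \<open>L\<^sup>2\<close> norms, with the constant \<open>C\<close> on the level of squared norms.\<close>

definition dirac_coercive :: "real \<Rightarrow> (real \<Rightarrow> complex) \<Rightarrow> (real \<Rightarrow> complex) \<Rightarrow> complex \<Rightarrow> real \<Rightarrow> bool" where
  "dirac_coercive h p q z C \<longleftrightarrow> (\<forall>u v F1 F2. u \<in> AC_loc \<and> v \<in> AC_loc \<and> sq_integrable u \<and> sq_integrable v \<and>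
     sq_integrable F1 \<and> sq_integrable F2 \<and> dirac_solution h p q z F1 F2 u v \<longrightarrow> L2_energy u v \<le> C * L2_energy F1 F2)"

definition dirac_solvable :: "real \<Rightarrow> (real \<Rightarrow> complex) \<Rightarrow> (real \<Rightarrow> complex) \<Rightarrow> complex \<Rightarrow> bool" where
  "dirac_solvable h p q z \<longleftrightarrow> (\<forall>F1 F2. sq_integrable F1 \<and> sq_integrable F2 \<longrightarrow> (\<exists>u v. u \<in> AC_loc \<and> v \<in> AC_loc \<and>
     sq_integrable u \<and> sq_integrable v \<and> dirac_solution h p q z F1 F2 u v))"

lemma L2_energy_nonneg: "0 \<le> L2_energy u v"
  unfolding L2_energy_def by (intro integral_nonneg_AE) auto

lemma dirac_coerciveD:
  assumes "dirac_coercive h p q z C" "dirac_solution h p q z F1 F2 u v" "u \<in> AC_loc" "v \<in> AC_loc"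
    "sq_integrable u" "sq_integrable v" "sq_integrable F1" "sq_integrable F2"
  shows "L2_energy u v \<le> C * L2_energy F1 F2"
  using assms unfolding dirac_coercive_def by blast

lemma dirac_solution_diff:
  assumes "dirac_solution h p q z F1 F2 u v" "dirac_solution h p q z G1 G2 u' v'"
  shows "dirac_solution h p q z (\<lambda>x. F1 x - G1 x) (\<lambda>x. F2 x - G2 x) (\<lambda>x. u x - u' x) (\<lambda>x. v x - v' x)"
  unfolding dirac_solution_def
proof
  show "AE x in lebesgue. ((\<lambda>x. u x - u' x) has_vector_derivative
      (q x * (v x - v' x) - \<i> * z * (u x - u' x) - \<i> * (F1 x - G1 x)) / h) (at x)"
    using conjunct1[OF assms(1)[unfolded dirac_solution_def]] conjunct1[OF assms(2)[unfolded dirac_solution_def]]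
  proof eventually_elim
    case (elim x)
    from has_vector_derivative_diff[OF this] show ?case by (simp add: diff_divide_distrib add_divide_distrib right_diff_distrib algebra_simps)
  qed
  show "AE x in lebesgue. ((\<lambda>x. v x - v' x) has_vector_derivative
      (p x * (u x - u' x) + \<i> * z * (v x - v' x) + \<i> * (F2 x - G2 x)) / h) (at x)"
    using conjunct2[OF assms(1)[unfolded dirac_solution_def]] conjunct2[OF assms(2)[unfolded dirac_solution_def]]
  proof eventually_elim
    case (elim x)
    from has_vector_derivative_diff[OF this] show ?case by (simp add: diff_divide_distrib add_divide_distrib right_diff_distrib algebra_simps)
  qed
qed

lemma sq_integrable_Pair_iff:
  fixes f :: "real \<Rightarrow> complex \<times> complex"
  shows "sq_integrable f \<longleftrightarrow> sq_integrable (\<lambda>x. fst (f x)) \<and> sq_integrable (\<lambda>x. snd (f x))"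
proof
  assume f: "sq_integrable f"
  have "(\<lambda>x. fst (f x)) \<in> borel_measurable lebesgue" "(\<lambda>x. snd (f x)) \<in> borel_measurable lebesgue"
    using f by (auto simp: sq_integrable_def borel_prod[symmetric])
  moreover have "integrable lebesgue (\<lambda>x. (norm (f x))\<^sup>2)" using f by (simp add: sq_integrable_def)
  moreover have "AE x in lebesgue. (norm (fst (f x)))\<^sup>2 \<le> (norm (f x))\<^sup>2" "AE x in lebesgue. (norm (snd (f x)))\<^sup>2 \<le> (norm (f x))\<^sup>2"
    by (intro AE_I2; simp add: norm_prod_def)+
  ultimately show "sq_integrable (\<lambda>x. fst (f x)) \<and> sq_integrable (\<lambda>x. snd (f x))"
    by (blast intro: sq_integrable_bound)
next
  assume f: "sq_integrable (\<lambda>x. fst (f x)) \<and> sq_integrable (\<lambda>x. snd (f x))"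
  have "(\<lambda>x. (fst (f x), snd (f x))) \<in> borel_measurable lebesgue"
    using f by (intro borel_measurable_Pair) (auto simp: sq_integrable_def)
  then show "sq_integrable f"
    using f by (intro sq_integrable_bound[where k = "\<lambda>x. (norm (fst (f x)))\<^sup>2 + (norm (snd (f x)))\<^sup>2"])
       (auto simp: sq_integrable_def norm_prod_def)
qed

text \<open>Moving all differences to the right-hand side turns the equation for \<open>(p, q, z)\<close> into a fixed point
problem for the solution operator at \<open>(p0, q0, z0)\<close>, which is a contraction when the perturbation is
small compared with the coercivity constant. The solution operator is linear only up to the choice of
solutions, but coercivity applies to differences of any two solutions.\<close>

lemma dirac_solvable_perturbation:
  fixes p q p0 q0 :: "real \<Rightarrow> complex"
  assumes solv: "dirac_solvable h p0 q0 z0" and coer: "dirac_coercive h p0 q0 z0 C" and C: "C \<ge> 0"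
    and m: "p \<in> borel_measurable lebesgue" "q \<in> borel_measurable lebesgue" "p0 \<in> borel_measurable lebesgue" "q0 \<in> borel_measurable lebesgue"
    and M: "AE x in lebesgue. norm (p x - p0 x) \<le> M" "AE x in lebesgue. norm (q x - q0 x) \<le> M"
    and small: "C * (2 * ((norm (z - z0))\<^sup>2 + M\<^sup>2)) < 1"
  shows "dirac_solvable h p q z"
  unfolding dirac_solvable_def
proof (intro allI impI; elim conjE)
  fix F1 F2 :: "real \<Rightarrow> complex" assume F: "sq_integrable F1" "sq_integrable F2"
  define K1 where "K1 = (\<lambda>(f :: real \<Rightarrow> complex \<times> complex) x. (z - z0) * fst (f x) + \<i> * ((q x - q0 x) * snd (f x)))"
  define K2 where "K2 = (\<lambda>(f :: real \<Rightarrow> complex \<times> complex) x. (z - z0) * snd (f x) - \<i> * ((p x - p0 x) * fst (f x)))"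
  have sqK: "sq_integrable (K1 f)" "sq_integrable (K2 f)" if "sq_integrable f" for f
    unfolding K1_def K2_def using that m M
    by (intro sq_integrable_add sq_integrable_diff sq_integrable_cmult sq_integrable_bounded_mult_AE; simp add: sq_integrable_Pair_iff)+
  define good where "good = (\<lambda>f g. (\<lambda>x. fst (g x)) \<in> AC_loc \<and> (\<lambda>x. snd (g x)) \<in> AC_loc \<and> sq_integrable (\<lambda>x. fst (g x)) \<and> sq_integrable (\<lambda>x. snd (g x)) \<and>
     dirac_solution h p0 q0 z0 (\<lambda>x. F1 x + K1 f x) (\<lambda>x. F2 x + K2 f x) (\<lambda>x. fst (g x)) (\<lambda>x. snd (g x)))"
  have ex: "\<exists>g. good f g" if "sq_integrable f" for f
  proof -
    have "sq_integrable (\<lambda>x. F1 x + K1 f x)" "sq_integrable (\<lambda>x. F2 x + K2 f x)"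
      using sqK[OF that] F by (auto intro: sq_integrable_add)
    then obtain u v where "u \<in> AC_loc" "v \<in> AC_loc" "sq_integrable u" "sq_integrable v"
        "dirac_solution h p0 q0 z0 (\<lambda>x. F1 x + K1 f x) (\<lambda>x. F2 x + K2 f x) u v"
      using solv unfolding dirac_solvable_def by blast
    then have "good f (\<lambda>x. (u x, v x))" by (simp add: good_def)
    then show ?thesis by blast
  qed
  define T where "T = (\<lambda>f. SOME g. good f g)"
  have T: "good f (T f)" if "sq_integrable f" for f unfolding T_def using someI_ex[OF ex[OF that]] .
  have sqT: "sq_integrable (T f)" if "sq_integrable f" for f
    using T[OF that] by (simp add: good_def sq_integrable_Pair_iff)
  \<comment> \<open>The fixed point lemma divides by powers of its constant, hence a positive lower bound.\<close>
  define k where "k = max (1 / 2) (C * (2 * ((norm (z - z0))\<^sup>2 + M\<^sup>2)))"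
  have lip: "(LINT x|lebesgue. (norm (T f x - T g x))\<^sup>2) \<le> k * (LINT x|lebesgue. (norm (f x - g x))\<^sup>2)"
    if f: "sq_integrable f" and g: "sq_integrable g" for f g
  proof -
    define d where "d = (\<lambda>x. f x - g x)"
    have sqd: "sq_integrable d" unfolding d_def by (rule sq_integrable_diff[OF f g])
    have "dirac_solution h p0 q0 z0 (\<lambda>x. F1 x + K1 f x - (F1 x + K1 g x)) (\<lambda>x. F2 x + K2 f x - (F2 x + K2 g x))
       (\<lambda>x. fst (T f x) - fst (T g x)) (\<lambda>x. snd (T f x) - snd (T g x))"
      using T[OF f] T[OF g] unfolding good_def by (intro dirac_solution_diff) auto
    moreover have "(\<lambda>x. F1 x + K1 f x - (F1 x + K1 g x)) = K1 d" "(\<lambda>x. F2 x + K2 f x - (F2 x + K2 g x)) = K2 d"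
      by (auto simp: K1_def K2_def d_def algebra_simps)
    ultimately have sol: "dirac_solution h p0 q0 z0 (K1 d) (K2 d) (\<lambda>x. fst (T f x) - fst (T g x)) (\<lambda>x. snd (T f x) - snd (T g x))" by simp
    have "L2_energy (\<lambda>x. fst (T f x) - fst (T g x)) (\<lambda>x. snd (T f x) - snd (T g x)) \<le> C * L2_energy (K1 d) (K2 d)"
      by (rule dirac_coerciveD[OF coer sol])
         (use T[OF f] T[OF g] sqK[OF sqd] in \<open>auto simp: good_def intro!: AC_loc_diff sq_integrable_diff\<close>)
    also have "L2_energy (K1 d) (K2 d) \<le> (LINT x|lebesgue. 2 * ((norm (z - z0))\<^sup>2 + M\<^sup>2) * (norm (d x))\<^sup>2)"
      unfolding L2_energy_def
    proof (rule integral_mono_AE)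
      show "AE x in lebesgue. (norm (K1 d x))\<^sup>2 + (norm (K2 d x))\<^sup>2 \<le> 2 * ((norm (z - z0))\<^sup>2 + M\<^sup>2) * (norm (d x))\<^sup>2"
        using M
      proof eventually_elim
        case (elim x)
        let ?D = "(norm (z - z0))\<^sup>2" and ?u = "(norm (fst (d x)))\<^sup>2" and ?v = "(norm (snd (d x)))\<^sup>2"
        have "(norm (K1 d x))\<^sup>2 \<le> 2 * (?D * ?u) + 2 * ((norm (q x - q0 x))\<^sup>2 * ?v)"
          unfolding K1_def using norm_add_squared_le[of "(z - z0) * fst (d x)" "\<i> * ((q x - q0 x) * snd (d x))"]
          by (simp add: norm_mult power_mult_distrib)
        moreover have "(norm (K2 d x))\<^sup>2 \<le> 2 * (?D * ?v) + 2 * ((norm (p x - p0 x))\<^sup>2 * ?u)"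
          unfolding K2_def using norm_add_squared_le[of "(z - z0) * snd (d x)" "- (\<i> * ((p x - p0 x) * fst (d x)))"]
          by (simp add: norm_mult power_mult_distrib)
        moreover have "(norm (q x - q0 x))\<^sup>2 * ?v \<le> M\<^sup>2 * ?v" "(norm (p x - p0 x))\<^sup>2 * ?u \<le> M\<^sup>2 * ?u"
          using elim by (intro mult_right_mono power_mono; simp)+
        moreover have "(norm (d x))\<^sup>2 = ?u + ?v" by (simp add: norm_prod_def)
        ultimately show ?case by (simp add: algebra_simps)
      qed
    qed (use sqK[OF sqd] sqd in \<open>auto simp: sq_integrable_def\<close>)
    also have "\<dots> = 2 * ((norm (z - z0))\<^sup>2 + M\<^sup>2) * (LINT x|lebesgue. (norm (d x))\<^sup>2)" by simp
    finally have "L2_energy (\<lambda>x. fst (T f x) - fst (T g x)) (\<lambda>x. snd (T f x) - snd (T g x))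
        \<le> C * (2 * ((norm (z - z0))\<^sup>2 + M\<^sup>2) * (LINT x|lebesgue. (norm (d x))\<^sup>2))" using C by (simp add: mult_left_mono)
    also have "\<dots> \<le> k * (LINT x|lebesgue. (norm (d x))\<^sup>2)"
      unfolding mult.assoc[symmetric] by (intro mult_right_mono integral_nonneg_AE) (auto simp: k_def mult.assoc)
    also have "L2_energy (\<lambda>x. fst (T f x) - fst (T g x)) (\<lambda>x. snd (T f x) - snd (T g x)) = (LINT x|lebesgue. (norm (T f x - T g x))\<^sup>2)"
      unfolding L2_energy_def by (simp add: norm_prod_def)
    finally show ?thesis by (simp add: d_def)
  qed
  obtain f where f: "sq_integrable f" "AE x in lebesgue. T f x = f x"
    by (rule sq_integrable_contraction_fixed_point[of T k, OF sqT lip]) (use small in \<open>auto simp: k_def\<close>)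
  define u where "u = (\<lambda>x. fst (T f x))"
  define v where "v = (\<lambda>x. snd (T f x))"
  have uv: "u \<in> AC_loc" "v \<in> AC_loc" "sq_integrable u" "sq_integrable v"
     and sol: "dirac_solution h p0 q0 z0 (\<lambda>x. F1 x + K1 f x) (\<lambda>x. F2 x + K2 f x) u v"
    using T[OF f(1)] by (auto simp: good_def u_def v_def)
  have "dirac_solution h p q z F1 F2 u v"
    unfolding dirac_solution_def
  proof
    show "AE x in lebesgue. (u has_vector_derivative (q x * v x - \<i> * z * u x - \<i> * F1 x) / h) (at x)"
      using conjunct1[OF sol[unfolded dirac_solution_def]] f(2)
    proof eventually_elim
      case (elim x)
      have "q0 x * v x - \<i> * z0 * u x - \<i> * (F1 x + K1 f x) = q x * v x - \<i> * z * u x - \<i> * F1 x"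
        using elim(2)[symmetric] by (simp add: K1_def u_def v_def algebra_simps)
      with elim(1) show ?case by simp
    qed
    show "AE x in lebesgue. (v has_vector_derivative (p x * u x + \<i> * z * v x + \<i> * F2 x) / h) (at x)"
      using conjunct2[OF sol[unfolded dirac_solution_def]] f(2)
    proof eventually_elim
      case (elim x)
      have "p0 x * u x + \<i> * z0 * v x + \<i> * (F2 x + K2 f x) = p x * u x + \<i> * z * v x + \<i> * F2 x"
        using elim(2)[symmetric] by (simp add: K2_def u_def v_def algebra_simps)
      with elim(1) show ?case by simp
    qed
  qed
  with uv show "\<exists>u v. u \<in> AC_loc \<and> v \<in> AC_loc \<and> sq_integrable u \<and> sq_integrable v \<and> dirac_solution h p q z F1 F2 u v" by blast
qed

text \<open>For \<open>Q = 0\<close> the components decouple, and the sign of \<open>Im z\<close> decides in which direction each of them decays.\<close>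

lemma free_dirac_solvable:
  assumes h: "h > 0" and z: "Im z \<noteq> 0"
  shows "dirac_solvable h (\<lambda>_. 0) (\<lambda>_. 0) z"
  unfolding dirac_solvable_def
proof (intro allI impI; elim conjE)
  fix F1 F2 :: "real \<Rightarrow> complex" assume F: "sq_integrable F1" "sq_integrable F2"
  have a: "Re (\<i> * z / h) \<noteq> 0" "Re (- \<i> * z / h) \<noteq> 0" using h z by simp_all
  obtain u where u: "u \<in> AC_loc" "sq_integrable u" "AE x in lebesgue. (u has_vector_derivative (- \<i> / h) * F1 x - (\<i> * z / h) * u x) (at x)"
    by (rule sq_integrable_first_order_ode[OF sq_integrable_cmult[OF F(1)] a(1)]) (rule that)
  obtain v where v: "v \<in> AC_loc" "sq_integrable v" "AE x in lebesgue. (v has_vector_derivative (\<i> / h) * F2 x - (- \<i> * z / h) * v x) (at x)"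
    by (rule sq_integrable_first_order_ode[OF sq_integrable_cmult[OF F(2)] a(2)]) (rule that)
  have "dirac_solution h (\<lambda>_. 0) (\<lambda>_. 0) z F1 F2 u v"
    unfolding dirac_solution_def
  proof
    show "AE x in lebesgue. (u has_vector_derivative (0 * v x - \<i> * z * u x - \<i> * F1 x) / h) (at x)"
      using u(3)
    proof eventually_elim
      case (elim x)
      have "(- \<i> / h) * F1 x - (\<i> * z / h) * u x = (0 * v x - \<i> * z * u x - \<i> * F1 x) / h" using h by (simp add: field_simps)
      with elim show ?case by simp
    qed
    show "AE x in lebesgue. (v has_vector_derivative (0 * u x + \<i> * z * v x + \<i> * F2 x) / h) (at x)"
      using v(3)
    proof eventually_elim
      case (elim x)
      have "(\<i> / h) * F2 x - (- \<i> * z / h) * v x = (0 * u x + \<i> * z * v x + \<i> * F2 x) / h" using h by (simp add: field_simps)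
      with elim show ?case by simp
    qed
  qed
  with u v show "\<exists>u v. u \<in> AC_loc \<and> v \<in> AC_loc \<and> sq_integrable u \<and> sq_integrable v \<and> dirac_solution h (\<lambda>_. 0) (\<lambda>_. 0) z F1 F2 u v" by blast
qed

lemma free_dirac_coercive:
  assumes h: "h > 0" and z: "Im z \<noteq> 0"
  shows "dirac_coercive h (\<lambda>_. 0) (\<lambda>_. 0) z (1 / (Im z)\<^sup>2)"
  unfolding dirac_coercive_def
proof (intro allI impI; elim conjE)
  fix u v F1 F2 assume *: "u \<in> AC_loc" "v \<in> AC_loc" "sq_integrable u" "sq_integrable v" "sq_integrable F1" "sq_integrable F2"
    "dirac_solution h (\<lambda>_. 0) (\<lambda>_. 0) z F1 F2 u v"
  have "\<bar>Im z\<bar>\<^sup>2 * L2_energy u v \<le> L2_energy F1 F2"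
    unfolding L2_energy_def
    by (rule dirac_apriori_imaginary_part[OF h *(1-6) _ _ _ _ *(7), of 0 0]) (use z in auto)
  then show "L2_energy u v \<le> 1 / (Im z)\<^sup>2 * L2_energy F1 F2" using z by (simp add: field_simps)
qed

text \<open>The minimum of \<open>(\<mu> P + Q / \<mu>) / 2\<close> is the geometric mean, attained at \<open>\<mu> = sqrt (Q / P)\<close>; if exactly one
of \<open>P\<close>, \<open>Q\<close> vanishes, the infimum zero is approached but not attained.\<close>

lemma weight_below_geometric_mean:
  fixes P Q Y :: real
  assumes "0 \<le> P" "0 \<le> Q" "sqrt (P * Q) < Y"
  obtains \<mu> where "\<mu> > 0" "(\<mu> * P + Q / \<mu>) / 2 < Y"
proof -
  have Y: "Y > 0" using assms by (meson mult_nonneg_nonneg order_le_less_trans real_sqrt_ge_zero)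
  consider "P = 0" | "Q = 0" "P > 0" | "P > 0" "Q > 0" using assms by linarith
  then show thesis
  proof cases
    case 1
    define m where "m = (Q + 1) / Y"
    have "Q / m = Y * (Q / (Q + 1))" using Y assms by (simp add: m_def field_simps)
    also have "\<dots> \<le> Y * 1" using Y assms by (intro mult_left_mono) (auto simp: divide_le_eq)
    finally have "Q / m \<le> Y" by simp
    then have "(m * P + Q / m) / 2 < Y" using 1 Y by simp
    moreover have "m > 0" using Y assms by (simp add: m_def)
    ultimately show thesis by (intro that[of m])
  next
    case 2
    then show thesis using Y by (intro that[of "Y / P"]) auto
  next
    case 3
    define a b where "a = sqrt P" and "b = sqrt Q"
    have ab: "a > 0" "b > 0" "P = a * a" "Q = b * b" using 3 by (simp_all add: a_def b_def)
    have "sqrt (P * Q) = a * b" using 3 by (simp add: a_def b_def real_sqrt_mult)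
    moreover have "b / a * P = a * b" "Q / (b / a) = a * b" using ab by (simp_all add: ab(3,4))
    ultimately show thesis using assms(3) ab by (intro that[of "b / a"]) auto
  qed
qed

text \<open>The substitution \<open>(u, v) \<mapsto> (u, \<mu> v)\<close> conjugates the system to the one with potentials \<open>(\<mu> p, q / \<mu>)\<close>.\<close>

lemma dirac_coercive_scale:
  fixes \<mu> :: real and p q :: "real \<Rightarrow> complex"
  assumes \<mu>: "\<mu> > 0" and C: "C \<ge> 0" and c: "dirac_coercive h (\<lambda>x. \<mu> * p x) (\<lambda>x. q x / \<mu>) z C"
  shows "dirac_coercive h p q z (C * (max 1 \<mu>)\<^sup>2 / (min 1 \<mu>)\<^sup>2)"
  unfolding dirac_coercive_def
proof (intro allI impI; elim conjE)
  fix u v F1 F2 assume *: "u \<in> AC_loc" "v \<in> AC_loc" "sq_integrable u" "sq_integrable v" "sq_integrable F1" "sq_integrable F2"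
    "dirac_solution h p q z F1 F2 u v"
  have sq: "sq_integrable (\<lambda>x. \<mu> * v x)" "sq_integrable (\<lambda>x. \<mu> * F2 x)" using * by (auto intro: sq_integrable_cmult)
  have "dirac_solution h (\<lambda>x. \<mu> * p x) (\<lambda>x. q x / \<mu>) z F1 (\<lambda>x. \<mu> * F2 x) u (\<lambda>x. \<mu> * v x)"
    unfolding dirac_solution_def
  proof
    show "AE x in lebesgue. (u has_vector_derivative (q x / \<mu> * (\<mu> * v x) - \<i> * z * u x - \<i> * F1 x) / h) (at x)"
      using conjunct1[OF *(7)[unfolded dirac_solution_def]] \<mu> by simp
    show "AE x in lebesgue. ((\<lambda>x. \<mu> * v x) has_vector_derivative (\<mu> * p x * u x + \<i> * z * (\<mu> * v x) + \<i> * (\<mu> * F2 x)) / h) (at x)"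
      using conjunct2[OF *(7)[unfolded dirac_solution_def]]
    proof eventually_elim
      case (elim x)
      from has_vector_derivative_mult_right[OF this, of "of_real \<mu>"] show ?case
        by (simp add: algebra_simps)
    qed
  qed
  from dirac_coerciveD[OF c this *(1) AC_loc_cmult[OF *(2)] *(3) sq(1) *(5) sq(2)]
  have 1: "L2_energy u (\<lambda>x. \<mu> * v x) \<le> C * L2_energy F1 (\<lambda>x. \<mu> * F2 x)" .
  have "(min 1 \<mu>)\<^sup>2 * L2_energy u v = (LINT x|lebesgue. (min 1 \<mu>)\<^sup>2 * ((norm (u x))\<^sup>2 + (norm (v x))\<^sup>2))" by (simp add: L2_energy_def)
  also have "\<dots> \<le> L2_energy u (\<lambda>x. \<mu> * v x)"
    unfolding L2_energy_def
  proof (rule integral_mono_AE)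
    have "(min 1 \<mu>)\<^sup>2 * a \<le> a" "(min 1 \<mu>)\<^sup>2 * a \<le> \<mu>\<^sup>2 * a" if "a \<ge> 0" for a
      using \<mu> that by (intro mult_left_le_one_le mult_right_mono power_mono; auto simp: power_le_one)+
    then show "AE x in lebesgue. (min 1 \<mu>)\<^sup>2 * ((norm (u x))\<^sup>2 + (norm (v x))\<^sup>2) \<le> (norm (u x))\<^sup>2 + (norm (\<mu> * v x))\<^sup>2"
      by (intro AE_I2) (auto simp: norm_mult power_mult_distrib distrib_left intro: add_mono)
  qed (use * sq in \<open>auto simp: sq_integrable_def\<close>)
  also note 1
  also have "L2_energy F1 (\<lambda>x. \<mu> * F2 x) \<le> (LINT x|lebesgue. (max 1 \<mu>)\<^sup>2 * ((norm (F1 x))\<^sup>2 + (norm (F2 x))\<^sup>2))"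
    unfolding L2_energy_def
  proof (rule integral_mono_AE)
    have m1: "1 \<le> (max 1 \<mu>)\<^sup>2" by (simp add: one_le_power)
    have "a \<le> (max 1 \<mu>)\<^sup>2 * a" if "a \<ge> 0" for a using mult_right_mono[OF m1 that] by simp
    moreover have "\<mu>\<^sup>2 * a \<le> (max 1 \<mu>)\<^sup>2 * a" if "a \<ge> 0" for a
      using \<mu> that by (intro mult_right_mono power_mono) auto
    ultimately show "AE x in lebesgue. (norm (F1 x))\<^sup>2 + (norm (\<mu> * F2 x))\<^sup>2 \<le> (max 1 \<mu>)\<^sup>2 * ((norm (F1 x))\<^sup>2 + (norm (F2 x))\<^sup>2)"
      by (intro AE_I2) (auto simp: norm_mult power_mult_distrib distrib_left intro: add_mono)
  qed (use * sq in \<open>auto simp: sq_integrable_def\<close>)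
  also have "(LINT x|lebesgue. (max 1 \<mu>)\<^sup>2 * ((norm (F1 x))\<^sup>2 + (norm (F2 x))\<^sup>2)) = (max 1 \<mu>)\<^sup>2 * L2_energy F1 F2" by (simp add: L2_energy_def)
  finally have 2: "(min 1 \<mu>)\<^sup>2 * L2_energy u v \<le> C * ((max 1 \<mu>)\<^sup>2 * L2_energy F1 F2)" using C by (simp add: mult_left_mono)
  have "(min 1 \<mu>)\<^sup>2 > 0" using \<mu> by simp
  with 2 show "L2_energy u v \<le> C * (max 1 \<mu>)\<^sup>2 / (min 1 \<mu>)\<^sup>2 * L2_energy F1 F2" by (simp add: field_simps)
qed

text \<open>Along the vertical ray that starts at \<open>z\<close> and points away from the real axis, the gaps \<open>|Im z| - ...\<close> and \<open>2 |Re z| |Im z| - ...\<close>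
grow, while the factor in front of \<open>F\<close> depends on \<open>z\<close> through \<open>Re z\<close> only. One constant therefore serves
the whole ray.\<close>

lemma dirac_coercive_ray:
  fixes P Q P' Q' :: real
  assumes h: "h > 0" and ac: "p \<in> AC_loc" "q \<in> AC_loc" and pq_real: "\<And>x. Im (p x * q x) = 0"
    and pq: "AE x in lebesgue. norm (p x) \<le> P" "AE x in lebesgue. norm (q x) \<le> Q"
    and dpq: "dp \<in> borel_measurable lebesgue" "dq \<in> borel_measurable lebesgue" "AE x in lebesgue. norm (dp x) \<le> P'" "AE x in lebesgue. norm (dq x) \<le> Q'"
    and dpq': "AE x in lebesgue. (p has_vector_derivative dp x) (at x)" "AE x in lebesgue. (q has_vector_derivative dq x) (at x)"
    and nonneg: "0 \<le> P" "0 \<le> Q" "0 \<le> P'" "0 \<le> Q'"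
    and z: "sqrt (P * Q) < \<bar>Im z\<bar> \<or> h / 2 * sqrt (P' * Q') < \<bar>Re z\<bar> * \<bar>Im z\<bar>"
  obtains C where "C \<ge> 0" "\<And>z'. Re z' = Re z \<Longrightarrow> \<bar>Im z\<bar> \<le> \<bar>Im z'\<bar> \<Longrightarrow> dirac_coercive h p q z' C"
  using z
proof
  assume "sqrt (P * Q) < \<bar>Im z\<bar>"
  then obtain \<mu> where \<mu>: "\<mu> > 0" "(\<mu> * P + Q / \<mu>) / 2 < \<bar>Im z\<bar>" by (rule weight_below_geometric_mean[OF nonneg(1,2)])
  define \<kappa> where "\<kappa> = \<bar>Im z\<bar> - (\<mu> * P + Q / \<mu>) / 2"
  have \<kappa>: "\<kappa> > 0" using \<mu> by (simp add: \<kappa>_def)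
  have m: "(\<lambda>x. of_real \<mu> * p x) \<in> borel_measurable lebesgue" "(\<lambda>x. q x / of_real \<mu>) \<in> borel_measurable lebesgue"
    using ac[THEN AC_loc_measurable] by auto
  have n: "AE x in lebesgue. norm (of_real \<mu> * p x) \<le> \<mu> * P" "AE x in lebesgue. norm (q x / of_real \<mu>) \<le> Q / \<mu>"
    using pq \<mu> by (auto simp: norm_mult norm_divide divide_right_mono)
  have co: "dirac_coercive h (\<lambda>x. \<mu> * p x) (\<lambda>x. q x / \<mu>) z' (1 / \<kappa>\<^sup>2)" if z': "Re z' = Re z" "\<bar>Im z\<bar> \<le> \<bar>Im z'\<bar>" for z'
    unfolding dirac_coercive_def
  proof (intro allI impI; elim conjE)
    fix u v F1 F2 assume *: "u \<in> AC_loc" "v \<in> AC_loc" "sq_integrable u" "sq_integrable v" "sq_integrable F1" "sq_integrable F2"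
      "dirac_solution h (\<lambda>x. \<mu> * p x) (\<lambda>x. q x / \<mu>) z' F1 F2 u v"
    define \<kappa>' where "\<kappa>' = \<bar>Im z'\<bar> - (\<mu> * P + Q / \<mu>) / 2"
    have \<kappa>': "\<kappa> \<le> \<kappa>'" using z' by (simp add: \<kappa>_def \<kappa>'_def)
    have "\<kappa>\<^sup>2 * L2_energy u v \<le> \<kappa>'\<^sup>2 * L2_energy u v" using \<kappa> \<kappa>' by (intro mult_right_mono power_mono L2_energy_nonneg) auto
    also have "\<dots> \<le> L2_energy F1 F2"
      unfolding L2_energy_def by (rule dirac_apriori_imaginary_part[OF h *(1-6) m n *(7) \<kappa>'_def]) (use \<kappa> \<kappa>' in auto)
    finally show "L2_energy u v \<le> 1 / \<kappa>\<^sup>2 * L2_energy F1 F2" using \<kappa> by (simp add: field_simps)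
  qed
  have "dirac_coercive h p q z' (1 / \<kappa>\<^sup>2 * (max 1 \<mu>)\<^sup>2 / (min 1 \<mu>)\<^sup>2)" if z': "Re z' = Re z" "\<bar>Im z\<bar> \<le> \<bar>Im z'\<bar>" for z'
    by (rule dirac_coercive_scale[OF \<mu>(1) _ co[OF z']]) simp
  then show thesis by (rule that[rotated]) auto
next
  assume "h / 2 * sqrt (P' * Q') < \<bar>Re z\<bar> * \<bar>Im z\<bar>"
  then have "sqrt (P' * Q') < 2 * \<bar>Re z * Im z\<bar> / h" using h by (simp add: field_simps abs_mult)
  then obtain \<mu> where \<mu>: "\<mu> > 0" "(\<mu> * P' + Q' / \<mu>) / 2 < 2 * \<bar>Re z * Im z\<bar> / h" by (rule weight_below_geometric_mean[OF nonneg(3,4)])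
  define \<kappa> where "\<kappa> = 2 * \<bar>Re z * Im z\<bar> - h * (\<mu> * P' + Q' / \<mu>) / 2"
  have "h * ((\<mu> * P' + Q' / \<mu>) / 2) < h * (2 * \<bar>Re z * Im z\<bar> / h)" using \<mu>(2) h by (intro mult_strict_left_mono) auto
  then have \<kappa>: "\<kappa> > 0" using h by (simp add: \<kappa>_def)
  define K where "K = \<mu> * P + Q / \<mu> + 2 * \<bar>Re z\<bar>"
  have ac': "(\<lambda>x. of_real \<mu> * p x) \<in> AC_loc" "(\<lambda>x. q x / of_real \<mu>) \<in> AC_loc"
    using AC_loc_cmult[OF ac(1)] AC_loc_cmult[OF ac(2), of "1 / of_real \<mu>"] by auto
  have n: "AE x in lebesgue. norm (of_real \<mu> * p x) \<le> \<mu> * P" "AE x in lebesgue. norm (q x / of_real \<mu>) \<le> Q / \<mu>"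
    using pq \<mu> by (auto simp: norm_mult norm_divide divide_right_mono)
  have m: "(\<lambda>x. of_real \<mu> * dp x) \<in> borel_measurable lebesgue" "(\<lambda>x. dq x / of_real \<mu>) \<in> borel_measurable lebesgue"
    using dpq by auto
  have n': "AE x in lebesgue. norm (of_real \<mu> * dp x) \<le> \<mu> * P'" "AE x in lebesgue. norm (dq x / of_real \<mu>) \<le> Q' / \<mu>"
    using dpq(3,4) \<mu> by (auto simp: norm_mult norm_divide divide_right_mono)
  have d: "AE x in lebesgue. ((\<lambda>x. of_real \<mu> * p x) has_vector_derivative of_real \<mu> * dp x) (at x)"
    "AE x in lebesgue. ((\<lambda>x. q x / of_real \<mu>) has_vector_derivative dq x / of_real \<mu>) (at x)"
    using dpq' by (auto intro: has_vector_derivative_mult_right has_vector_derivative_divide)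
  have r: "Im (of_real \<mu> * p x * (q x / of_real \<mu>)) = 0" for x using pq_real[of x] \<mu> by simp
  have co: "dirac_coercive h (\<lambda>x. \<mu> * p x) (\<lambda>x. q x / \<mu>) z' (4 * K\<^sup>2 / \<kappa>\<^sup>2)" if z': "Re z' = Re z" "\<bar>Im z\<bar> \<le> \<bar>Im z'\<bar>" for z'
    unfolding dirac_coercive_def
  proof (intro allI impI; elim conjE)
    fix u v F1 F2 assume *: "u \<in> AC_loc" "v \<in> AC_loc" "sq_integrable u" "sq_integrable v" "sq_integrable F1" "sq_integrable F2"
      "dirac_solution h (\<lambda>x. \<mu> * p x) (\<lambda>x. q x / \<mu>) z' F1 F2 u v"
    define \<kappa>' where "\<kappa>' = 2 * \<bar>Re z' * Im z'\<bar> - h * (\<mu> * P' + Q' / \<mu>) / 2"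
    have "\<bar>Re z * Im z\<bar> \<le> \<bar>Re z' * Im z'\<bar>" using z' by (simp add: abs_mult mult_left_mono)
    then have \<kappa>': "\<kappa> \<le> \<kappa>'" by (simp add: \<kappa>_def \<kappa>'_def)
    have "\<kappa>\<^sup>2 * L2_energy u v \<le> \<kappa>'\<^sup>2 * L2_energy u v" using \<kappa> \<kappa>' by (intro mult_right_mono power_mono L2_energy_nonneg) auto
    also have "\<dots> \<le> 4 * (\<mu> * P + Q / \<mu> + 2 * \<bar>Re z'\<bar>)\<^sup>2 * L2_energy F1 F2"
      unfolding L2_energy_def by (rule dirac_apriori_square[OF h *(1,2) ac' *(3-6) n r m n' d *(7) \<kappa>'_def]) (use \<kappa> \<kappa>' in auto)
    finally show "L2_energy u v \<le> 4 * K\<^sup>2 / \<kappa>\<^sup>2 * L2_energy F1 F2" using \<kappa> z' by (simp add: field_simps K_def)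
  qed
  have "dirac_coercive h p q z' (4 * K\<^sup>2 / \<kappa>\<^sup>2 * (max 1 \<mu>)\<^sup>2 / (min 1 \<mu>)\<^sup>2)" if z': "Re z' = Re z" "\<bar>Im z\<bar> \<le> \<bar>Im z'\<bar>" for z'
    by (rule dirac_coercive_scale[OF \<mu>(1) _ co[OF z']]) simp
  then show thesis by (rule that[rotated]) auto
qed

text \<open>The method of continuity: solvability holds at the distant point \<open>Z T\<close> by comparison with \<open>Q = 0\<close> and is
carried down to \<open>z = Z 0\<close> in \<open>N\<close> equal steps whose length is dictated by the uniform constant.\<close>

lemma dirac_solvable_of_coercive_ray:
  assumes h: "h > 0" and m: "p \<in> borel_measurable lebesgue" "q \<in> borel_measurable lebesgue"
    and pq: "AE x in lebesgue. norm (p x) \<le> M" "AE x in lebesgue. norm (q x) \<le> M"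
    and z: "Im z \<noteq> 0" and C: "C \<ge> 0" "\<And>z'. Re z' = Re z \<Longrightarrow> \<bar>Im z\<bar> \<le> \<bar>Im z'\<bar> \<Longrightarrow> dirac_coercive h p q z' C"
  shows "dirac_solvable h p q z"
proof -
  \<comment> \<open>The ray points away from the real axis.\<close>
  define Z where "Z = (\<lambda>t :: real. Complex (Re z) (Im z + sgn (Im z) * t))"
  have ImZ: "\<bar>Im (Z t)\<bar> = \<bar>Im z\<bar> + t" if "t \<ge> 0" for t using that z by (auto simp: Z_def sgn_if)
  have coer: "dirac_coercive h p q (Z t) C" if "t \<ge> 0" for t
    using that ImZ[OF that] by (intro C) (auto simp: Z_def)
  \<comment> \<open>Free coercivity has the constant \<open>1 / (Im z)\<^sup>2\<close>, so \<open>T\<^sup>2 > 2 M\<^sup>2\<close> makes the potential a small perturbation.\<close>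
  define T where "T = 2 * \<bar>M\<bar> + 1"
  have T: "T > 0" by (simp add: T_def)
  have top: "dirac_solvable h p q (Z T)"
  proof (rule dirac_solvable_perturbation[of h "\<lambda>_. 0" "\<lambda>_. 0" "Z T" "1 / (Im (Z T))\<^sup>2" p q M])
    have i: "\<bar>Im (Z T)\<bar> = \<bar>Im z\<bar> + T" using T by (intro ImZ) auto
    then have nz: "Im (Z T) \<noteq> 0" using T by auto
    show "dirac_solvable h (\<lambda>_. 0) (\<lambda>_. 0) (Z T)" by (rule free_dirac_solvable[OF h nz])
    show "dirac_coercive h (\<lambda>_. 0) (\<lambda>_. 0) (Z T) (1 / (Im (Z T))\<^sup>2)" by (rule free_dirac_coercive[OF h nz])
    have "2 * M\<^sup>2 < T\<^sup>2" unfolding T_def power2_sum by (simp add: power_mult_distrib add_strict_increasing2 add_pos_nonneg)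
    also have "T\<^sup>2 \<le> (Im (Z T))\<^sup>2"
      using i T by (subst power2_abs[of "Im (Z T)", symmetric], intro power_mono) auto
    finally show "1 / (Im (Z T))\<^sup>2 * (2 * ((norm (Z T - Z T))\<^sup>2 + M\<^sup>2)) < 1" using nz by (simp add: divide_less_eq)
  qed (use m pq in auto)
  \<comment> \<open>A step of length \<open>T / N\<close> is a contraction if \<open>2 C T\<^sup>2 < N\<^sup>2\<close>, and \<open>N \<le> N\<^sup>2\<close>.\<close>
  obtain N :: nat where N: "N > 0" "2 * C * T\<^sup>2 < real N"
  proof -
    obtain N0 :: nat where "2 * C * T\<^sup>2 < real N0" using reals_Archimedean2 by blast
    then show thesis by (intro that[of "Suc N0"]) auto
  qed
  have step: "dirac_solvable h p q (Z t')" if s: "dirac_solvable h p q (Z t)" and t: "t \<ge> 0" "\<bar>t' - t\<bar> = T / N" for t t'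
  proof (rule dirac_solvable_perturbation[OF s coer[OF t(1)] C(1), where M = 0])
    have "Z t' - Z t = Complex 0 (sgn (Im z) * (t' - t))" by (simp add: Z_def complex_eq_iff algebra_simps)
    then have "norm (Z t' - Z t) = T / N" using z t(2) by (simp add: cmod_def abs_mult sgn_if)
    then have "C * (2 * ((norm (Z t' - Z t))\<^sup>2 + 0\<^sup>2)) = (2 * C * T\<^sup>2) / (real N)\<^sup>2" by (simp add: power_divide)
    also have "\<dots> < 1"
    proof -
      have "2 * C * T\<^sup>2 < (real N)\<^sup>2"
        using N(2) order_less_le_trans[OF N(2), of "(real N)\<^sup>2"] N(1) by (simp add: power2_eq_square)
      then show ?thesis using N(1) by (simp add: divide_less_eq)
    qed
    finally show "C * (2 * ((norm (Z t' - Z t))\<^sup>2 + 0\<^sup>2)) < 1" .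
  qed (use m in auto)
  have "dirac_solvable h p q (Z (T - real j * (T / N)))" if "j \<le> N" for j
    using that
  proof (induction j)
    case 0
    then show ?case using top by simp
  next
    case (Suc j)
    have "real j * (T / N) \<le> real N * (T / N)" using Suc.prems T by (intro mult_right_mono) auto
    then have "T - real j * (T / N) \<ge> 0" using N by simp
    moreover have "\<bar>(T - real (Suc j) * (T / N)) - (T - real j * (T / N))\<bar> = T / N"
    proof -
      have "(T - real (Suc j) * (T / N)) - (T - real j * (T / N)) = - (T / N)" by (simp add: algebra_simps add_divide_distrib)
      then show ?thesis using T by simp
    qed
    moreover have "dirac_solvable h p q (Z (T - real j * (T / N)))" using Suc by simp
    ultimately show ?case by (rule step[rotated])
  qed
  from this[of N] have "dirac_solvable h p q (Z 0)" using N by simp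
  moreover have "Z 0 = z" by (simp add: Z_def complex_eq_iff)
  ultimately show ?thesis by simp
qed

section \<open>Return to the operator\<close>

text \<open>Needed because \<^const>\<open>dirac_expr\<close> is only known almost everywhere, whereas membership in \<^const>\<open>L2\<close>
asks for measurability of the function itself.\<close>

lemma borel_measurable_lebesgue_cong_AE:
  fixes f g :: "real \<Rightarrow> 'a::topological_space"
  assumes f: "f \<in> borel_measurable lebesgue" and fg: "AE x in lebesgue. f x = g x"
  shows "g \<in> borel_measurable lebesgue"
proof (rule measurableI)
  define N where "N = {x. f x \<noteq> g x}"
  have N: "negligible N" using fg by (simp add: AE_lebesgue_iff_negligible N_def)
  fix A :: "'a set" assume A: "A \<in> sets borel"
  have "g -` A \<inter> space lebesgue = (f -` A \<inter> space lebesgue - N) \<union> (g -` A \<inter> N)" by (auto simp: N_def)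
  moreover have "f -` A \<inter> space lebesgue \<in> sets lebesgue" by (rule measurable_sets[OF f A])
  moreover have "N \<in> sets lebesgue" "g -` A \<inter> N \<in> sets lebesgue"
    using N negligible_subset[OF N] by (auto intro: negligible_imp_sets)
  ultimately show "g -` A \<inter> space lebesgue \<in> sets lebesgue" by (metis sets.Diff sets.Un)
qed simp

lemma norm_vec2_squared: "(norm w)\<^sup>2 = (norm (w $ 1))\<^sup>2 + (norm (w $ 2))\<^sup>2" for w :: "complex^2"
  by (simp add: norm_vec_def L2_set_def sum_2 sum_nonneg)

lemma vec2_axis_decomposition: "w = axis 1 (w $ 1) + axis 2 (w $ 2)" for w :: "complex^2"
  by (simp add: vec_eq_iff forall_2 axis_def)

lemma bounded_linear_axis: "bounded_linear (axis i :: complex \<Rightarrow> complex^2)"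
  unfolding linear_conv_bounded_linear[symmetric] by (intro linearI) (auto simp: vec_eq_iff axis_def)

lemma L2_iff_components: "\<Psi> \<in> L2 \<longleftrightarrow> sq_integrable (\<lambda>x. \<Psi> x $ 1) \<and> sq_integrable (\<lambda>x. \<Psi> x $ 2)"
proof
  assume "\<Psi> \<in> L2"
  then have \<Psi>: "\<Psi> \<in> borel_measurable lebesgue" "integrable lebesgue (\<lambda>x. (norm (\<Psi> x))\<^sup>2)" by (auto simp: L2_def)
  have "(\<lambda>x. \<Psi> x $ i) \<in> borel_measurable lebesgue" for i
    by (rule measurable_compose[OF \<Psi>(1) borel_measurable_continuous_onI]) (intro continuous_intros)
  moreover have "AE x in lebesgue. (norm (\<Psi> x $ 1))\<^sup>2 \<le> (norm (\<Psi> x))\<^sup>2" "AE x in lebesgue. (norm (\<Psi> x $ 2))\<^sup>2 \<le> (norm (\<Psi> x))\<^sup>2"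
    by (auto simp: norm_vec2_squared)
  ultimately show "sq_integrable (\<lambda>x. \<Psi> x $ 1) \<and> sq_integrable (\<lambda>x. \<Psi> x $ 2)"
    using \<Psi>(2) by (blast intro: sq_integrable_bound)
next
  assume c: "sq_integrable (\<lambda>x. \<Psi> x $ 1) \<and> sq_integrable (\<lambda>x. \<Psi> x $ 2)"
  have m: "(axis i :: complex \<Rightarrow> complex^2) \<in> borel_measurable borel" for i
    by (rule borel_measurable_continuous_onI) (rule linear_continuous_on[OF bounded_linear_axis])
  have "(\<lambda>x. axis 1 (\<Psi> x $ 1) + axis 2 (\<Psi> x $ 2) :: complex^2) \<in> borel_measurable lebesgue"
    using c by (intro borel_measurable_add measurable_compose[OF _ m]) (auto simp: sq_integrable_def)
  then have "\<Psi> \<in> borel_measurable lebesgue" by (simp flip: vec2_axis_decomposition)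
  then show "\<Psi> \<in> L2" using c by (simp add: L2_def norm_vec2_squared sq_integrable_def)
qed

lemma L2_norm_eq_energy: "L2_norm \<Psi> = sqrt (L2_energy (\<lambda>x. \<Psi> x $ 1) (\<lambda>x. \<Psi> x $ 2))"
  by (simp add: L2_norm_def L2_energy_def norm_vec2_squared)

lemma has_vector_derivative_vec2:
  fixes \<Psi> :: "real \<Rightarrow> complex^2"
  assumes "((\<lambda>x. \<Psi> x $ 1) has_vector_derivative a) (at x)" "((\<lambda>x. \<Psi> x $ 2) has_vector_derivative b) (at x)"
  shows "vector_derivative \<Psi> (at x) $ 1 = a" "vector_derivative \<Psi> (at x) $ 2 = b"
proof -
  have "((\<lambda>x. axis 1 (\<Psi> x $ 1) + axis 2 (\<Psi> x $ 2) :: complex^2) has_vector_derivative axis 1 a + axis 2 b) (at x)"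
    by (intro has_vector_derivative_add bounded_linear.has_vector_derivative[OF bounded_linear_axis] assms)
  then have "vector_derivative \<Psi> (at x) = axis 1 a + axis 2 b"
    by (simp flip: vec2_axis_decomposition add: vector_derivative_at)
  then show "vector_derivative \<Psi> (at x) $ 1 = a" "vector_derivative \<Psi> (at x) $ 2 = b" by (simp_all add: axis_def)
qed

lemma dirac_expr_components:
  "dirac_expr h p q \<Psi> x $ 1 = \<i> * h * vector_derivative \<Psi> (at x) $ 1 - \<i> * q x * \<Psi> x $ 2"
  "dirac_expr h p q \<Psi> x $ 2 = - \<i> * h * vector_derivative \<Psi> (at x) $ 2 + \<i> * p x * \<Psi> x $ 1"
  by (simp_all add: dirac_expr_def sigma3_def potential_def matrix_vector_mult_def sum_2)

lemma dirac_solution_of_domain: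
  assumes h: "h > 0" and \<Psi>: "\<And>i. (\<lambda>x. \<Psi> x $ i) \<in> AC_loc"
    and F_def: "F = (\<lambda>x. dirac_expr h p q \<Psi> x - z *s \<Psi> x)"
  shows "dirac_solution h p q z (\<lambda>x. F x $ 1) (\<lambda>x. F x $ 2) (\<lambda>x. \<Psi> x $ 1) (\<lambda>x. \<Psi> x $ 2)"
proof -
  note d = AC_loc_vector_derivative_AE[OF \<Psi>[of 1]] AC_loc_vector_derivative_AE[OF \<Psi>[of 2]]
  show ?thesis unfolding dirac_solution_def
  proof
    show "AE x in lebesgue. ((\<lambda>x. \<Psi> x $ 1) has_vector_derivative (q x * \<Psi> x $ 2 - \<i> * z * \<Psi> x $ 1 - \<i> * F x $ 1) / h) (at x)"
      using d
    proof eventually_elim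
      case (elim x)
      have "F x $ 1 = \<i> * h * vector_derivative (\<lambda>x. \<Psi> x $ 1) (at x) - \<i> * q x * \<Psi> x $ 2 - z * \<Psi> x $ 1"
        using has_vector_derivative_vec2[OF elim] by (simp add: F_def dirac_expr_components)
      then have "q x * \<Psi> x $ 2 - \<i> * z * \<Psi> x $ 1 - \<i> * F x $ 1 = h * vector_derivative (\<lambda>x. \<Psi> x $ 1) (at x)"
        by (simp only:) (simp add: algebra_simps)
      then have "(q x * \<Psi> x $ 2 - \<i> * z * \<Psi> x $ 1 - \<i> * F x $ 1) / h = vector_derivative (\<lambda>x. \<Psi> x $ 1) (at x)"
        using h by simp
      with elim(1) show ?case by simp
    qed
    show "AE x in lebesgue. ((\<lambda>x. \<Psi> x $ 2) has_vector_derivative (p x * \<Psi> x $ 1 + \<i> * z * \<Psi> x $ 2 + \<i> * F x $ 2) / h) (at x)"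
      using d
    proof eventually_elim
      case (elim x)
      have "F x $ 2 = - \<i> * h * vector_derivative (\<lambda>x. \<Psi> x $ 2) (at x) + \<i> * p x * \<Psi> x $ 1 - z * \<Psi> x $ 2"
        using has_vector_derivative_vec2[OF elim] by (simp add: F_def dirac_expr_components)
      then have "p x * \<Psi> x $ 1 + \<i> * z * \<Psi> x $ 2 + \<i> * F x $ 2 = h * vector_derivative (\<lambda>x. \<Psi> x $ 2) (at x)"
        by (simp only:) (simp add: algebra_simps)
      then have "(p x * \<Psi> x $ 1 + \<i> * z * \<Psi> x $ 2 + \<i> * F x $ 2) / h = vector_derivative (\<lambda>x. \<Psi> x $ 2) (at x)"
        using h by simp
      with elim(2) show ?case by simp
    qed
  qed
qed

lemma domain_of_dirac_solution:
  assumes h: "h > 0" and uv: "u \<in> AC_loc" "v \<in> AC_loc" "sq_integrable u" "sq_integrable v" and F: "F \<in> L2"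
    and pq: "p \<in> borel_measurable lebesgue" "q \<in> borel_measurable lebesgue" "AE x in lebesgue. norm (p x) \<le> M" "AE x in lebesgue. norm (q x) \<le> M"
    and sol: "dirac_solution h p q z (\<lambda>x. F x $ 1) (\<lambda>x. F x $ 2) u v"
  obtains \<Psi> where "\<Psi> \<in> dirac_domain h p q" "AE x in lebesgue. dirac_expr h p q \<Psi> x - z *s \<Psi> x = F x"
proof -
  define \<Psi> where "\<Psi> = (\<lambda>x. axis 1 (u x) + axis 2 (v x) :: complex^2)"
  have \<Psi>c: "\<Psi> x $ 1 = u x" "\<Psi> x $ 2 = v x" for x by (simp_all add: \<Psi>_def axis_def)
  have \<Psi>2: "\<Psi> \<in> L2" using uv by (simp add: L2_iff_components \<Psi>c)
  have \<Psi>ac: "(\<lambda>x. \<Psi> x $ i) \<in> AC_loc" for i using uv exhaust_2[of i] by (auto simp: \<Psi>c)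
  have eq: "AE x in lebesgue. dirac_expr h p q \<Psi> x = F x + z *s \<Psi> x"
    using conjunct1[OF sol[unfolded dirac_solution_def]] conjunct2[OF sol[unfolded dirac_solution_def]]
  proof eventually_elim
    case (elim x)
    have "((\<lambda>x. \<Psi> x $ 1) has_vector_derivative (q x * v x - \<i> * z * u x - \<i> * F x $ 1) / h) (at x)"
      "((\<lambda>x. \<Psi> x $ 2) has_vector_derivative (p x * u x + \<i> * z * v x + \<i> * F x $ 2) / h) (at x)"
      using elim by (simp_all add: \<Psi>c)
    note d = has_vector_derivative_vec2[OF this]
    have "dirac_expr h p q \<Psi> x $ 1 = F x $ 1 + z * u x" "dirac_expr h p q \<Psi> x $ 2 = F x $ 2 + z * v x"
      unfolding dirac_expr_components d using h by (simp_all add: \<Psi>c field_simps)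
    then show ?case by (simp add: vec_eq_iff forall_2 \<Psi>c)
  qed
  have FL: "(\<lambda>x. F x + z *s \<Psi> x) \<in> L2"
    using F \<Psi>2 by (auto simp: L2_iff_components intro!: sq_integrable_add sq_integrable_cmult)
  have "dirac_expr h p q \<Psi> \<in> L2"
  proof -
    have Fm: "(\<lambda>x. F x + z *s \<Psi> x) \<in> borel_measurable lebesgue" "integrable lebesgue (\<lambda>x. (norm (F x + z *s \<Psi> x))\<^sup>2)"
      using FL unfolding L2_def by blast+
    have "AE x in lebesgue. F x + z *s \<Psi> x = dirac_expr h p q \<Psi> x" using eq by eventually_elim (rule sym)
    from borel_measurable_lebesgue_cong_AE[OF Fm(1) this]
    have m: "dirac_expr h p q \<Psi> \<in> borel_measurable lebesgue" .
    have "integrable lebesgue (\<lambda>x. (norm (dirac_expr h p q \<Psi> x))\<^sup>2)"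
    proof (rule integrable_cong_AE_imp[OF Fm(2)])
      show "(\<lambda>x. (norm (dirac_expr h p q \<Psi> x))\<^sup>2) \<in> borel_measurable lebesgue" using m by measurable
      show "AE x in lebesgue. (norm (F x + z *s \<Psi> x))\<^sup>2 = (norm (dirac_expr h p q \<Psi> x))\<^sup>2" using eq by eventually_elim simp
    qed
    with m show ?thesis by (simp add: L2_def)
  qed
  then have "\<Psi> \<in> dirac_domain h p q" using \<Psi>2 \<Psi>ac by (simp add: dirac_domain_def)
  then show thesis using eq by (intro that) auto
qed

lemma AE_le_Linf_norm:
  assumes "Linf_seminorm f < \<infinity>"
  shows "AE x in lebesgue. norm (f x) \<le> Linf_norm f"
proof -
  have "AE x in lebesgue. ennreal (norm (f x)) \<le> Linf_seminorm f" unfolding Linf_seminorm_def by (rule esssup_AE)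
  then show ?thesis
  proof eventually_elim
    case (elim x)
    have "0 \<le> Linf_norm f" by (simp add: Linf_norm_def)
    moreover have "Linf_seminorm f = ennreal (Linf_norm f)" using assms by (simp add: Linf_norm_def)
    ultimately show ?case using elim by simp
  qed
qed

text \<open>Finiteness matters because \<^const>\<open>Linf_norm\<close> sends an infinite seminorm to zero.\<close>

lemma periodic_continuous_Linf_seminorm_finite:
  fixes f :: "real \<Rightarrow> complex"
  assumes c: "continuous_on UNIV f" and per: "\<And>x. f (x + 1) = f x"
  shows "Linf_seminorm f < \<infinity>"
proof -
  have nat: "f (x + real n) = f x" for x n
  proof (induction n)
    case (Suc n)
    have "f (x + real (Suc n)) = f (x + real n + 1)" by (simp add: algebra_simps)
    then show ?case using per Suc by simp
  qed simp
  have int: "f (x + of_int k) = f x" for x k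
  proof (cases "k \<ge> 0")
    case True
    then show ?thesis using nat[of x "nat k"] by simp
  next
    case False
    then show ?thesis using nat[of "x + of_int k" "nat (- k)"] by simp
  qed
  have "bounded (f ` {0..1})" by (intro compact_imp_bounded compact_continuous_image continuous_on_subset[OF c]) auto
  then obtain B where "\<forall>y\<in>f ` {0..1}. norm y \<le> B" unfolding bounded_iff by blast
  then have B: "norm (f x) \<le> B" if "x \<in> {0..1}" for x using that by blast
  have "norm (f x) \<le> B" for x
  proof -
    have "norm (f (x - of_int \<lfloor>x\<rfloor>)) \<le> B" by (rule B) (simp, linarith)
    then show ?thesis using int[of x "- \<lfloor>x\<rfloor>"] by simp
  qed
  then have "AE x in lebesgue. ennreal (norm (f x)) \<le> ennreal B" by (intro AE_I2 ennreal_leI)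
  moreover have "(\<lambda>x. ennreal (norm (f x))) \<in> borel_measurable lebesgue"
    using borel_measurable_continuous_onI[OF c] by (simp add: measurable_completion)
  ultimately have "Linf_seminorm f \<le> ennreal B" unfolding Linf_seminorm_def by (intro esssup_I)
  then show ?thesis by (auto intro: le_less_trans)
qed

lemma dirac_resolvent_setI:
  assumes h: "h > 0" and coer: "dirac_coercive h p q z C" "C \<ge> 0" and solv: "dirac_solvable h p q z"
    and pq: "p \<in> borel_measurable lebesgue" "q \<in> borel_measurable lebesgue" "AE x in lebesgue. norm (p x) \<le> M" "AE x in lebesgue. norm (q x) \<le> M"
  shows "z \<in> resolvent_set (dirac_domain h p q) (dirac_expr h p q)"
proof -
  define R where "R = (\<lambda>\<Psi> x. dirac_expr h p q \<Psi> x - z *s \<Psi> x)"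
  have bound: "L2_norm \<Psi> \<le> sqrt C * L2_norm (R \<Psi>)" if \<Psi>: "\<Psi> \<in> dirac_domain h p q" for \<Psi>
  proof -
    from \<Psi> have \<Psi>': "\<Psi> \<in> L2" "\<And>i. (\<lambda>x. \<Psi> x $ i) \<in> AC_loc" "dirac_expr h p q \<Psi> \<in> L2" by (auto simp: dirac_domain_def)
    have "R \<Psi> \<in> L2" unfolding R_def using \<Psi>'(1,3)
      by (auto simp: L2_iff_components intro!: sq_integrable_diff sq_integrable_cmult)
    then have "L2_energy (\<lambda>x. \<Psi> x $ 1) (\<lambda>x. \<Psi> x $ 2) \<le> C * L2_energy (\<lambda>x. R \<Psi> x $ 1) (\<lambda>x. R \<Psi> x $ 2)"
      using \<Psi>' unfolding L2_iff_components R_def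
      by (intro dirac_coerciveD[OF coer(1) dirac_solution_of_domain[OF h _ refl]]) auto
    then show ?thesis unfolding L2_norm_eq_energy real_sqrt_mult[symmetric] by (rule real_sqrt_le_mono)
  qed
  have inj: "AE x in lebesgue. \<Psi> x = 0" if \<Psi>: "\<Psi> \<in> dirac_domain h p q" "AE x in lebesgue. R \<Psi> x = 0" for \<Psi>
  proof -
    have \<Psi>2: "\<Psi> \<in> L2" using \<Psi>(1) by (simp add: dirac_domain_def)
    have "(LINT x|lebesgue. (norm (R \<Psi> x))\<^sup>2) = 0" using \<Psi>(2) by (intro integral_eq_zero_AE) auto
    then have "L2_norm (R \<Psi>) = 0" by (simp add: L2_norm_def)
    with bound[OF \<Psi>(1)] have "L2_norm \<Psi> \<le> 0" by simp
    then have "(LINT x|lebesgue. (norm (\<Psi> x))\<^sup>2) \<le> 0" by (simp add: L2_norm_def)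
    moreover have "(LINT x|lebesgue. (norm (\<Psi> x))\<^sup>2) \<ge> 0" by (intro integral_nonneg_AE) auto
    ultimately have "AE x in lebesgue. (norm (\<Psi> x))\<^sup>2 = 0"
      using \<Psi>2 by (subst integral_nonneg_eq_0_iff_AE[symmetric]) (auto simp: L2_def)
    then show ?thesis by simp
  qed
  have surj: "\<exists>\<Psi>\<in>dirac_domain h p q. AE x in lebesgue. R \<Psi> x = F x" if F: "F \<in> L2" for F
  proof -
    obtain u v where uv: "u \<in> AC_loc" "v \<in> AC_loc" "sq_integrable u" "sq_integrable v" "dirac_solution h p q z (\<lambda>x. F x $ 1) (\<lambda>x. F x $ 2) u v"
      using solv F unfolding dirac_solvable_def L2_iff_components by blast
    obtain \<Psi> where "\<Psi> \<in> dirac_domain h p q" "AE x in lebesgue. dirac_expr h p q \<Psi> x - z *s \<Psi> x = F x"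
      by (rule domain_of_dirac_solution[OF h uv(1-4) F pq uv(5)]) (rule that)
    then show ?thesis unfolding R_def by blast
  qed
  show ?thesis unfolding resolvent_set_def using inj surj bound unfolding R_def by blast
qed

theorem theorem5p2:
  fixes h :: real and p q :: "real \<Rightarrow> complex"
  assumes "h > 0"
    and "\<forall>x. p (x + 1) = p x" and "\<forall>x. q (x + 1) = q x"
    and "p \<in> AC_loc" and "q \<in> AC_loc"
    and "(\<lambda>x. vector_derivative p (at x)) \<in> Linf"
    and "(\<lambda>x. vector_derivative q (at x)) \<in> Linf"
    and "\<forall>x. cnj (p x) * cnj (q x) = p x * q x"
  shows "dirac_spectrum h p q \<subseteq> Lambda_tilde h p q"
proof
  fix z assume spec: "z \<in> dirac_spectrum h p q"
  define dp where "dp = (\<lambda>x. vector_derivative p (at x))"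
  define dq where "dq = (\<lambda>x. vector_derivative q (at x))"
  have pq_real: "Im (p x * q x) = 0" for x
  proof -
    have "cnj (p x * q x) = p x * q x" using assms(8) by simp
    then show ?thesis by (metis complex_is_Real_iff Reals_cnj_iff)
  qed
  have pq: "AE x in lebesgue. norm (p x) \<le> Linf_norm p" "AE x in lebesgue. norm (q x) \<le> Linf_norm q"
    using assms(2-5) by (auto intro!: AE_le_Linf_norm periodic_continuous_Linf_seminorm_finite AC_loc_continuous)
  have dpq: "dp \<in> borel_measurable lebesgue" "dq \<in> borel_measurable lebesgue"
    "AE x in lebesgue. norm (dp x) \<le> Linf_norm dp" "AE x in lebesgue. norm (dq x) \<le> Linf_norm dq"
    using assms(6,7) by (auto simp: Linf_def dp_def dq_def intro!: AE_le_Linf_norm)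
  have dpq': "AE x in lebesgue. (p has_vector_derivative dp x) (at x)" "AE x in lebesgue. (q has_vector_derivative dq x) (at x)"
    unfolding dp_def dq_def using assms(4,5) by (auto intro: AC_loc_vector_derivative_AE)
  have nonneg: "0 \<le> Linf_norm f" for f by (simp add: Linf_norm_def)
  define M where "M = max (Linf_norm p) (Linf_norm q)"
  have pM: "AE x in lebesgue. norm (p x) \<le> M" "AE x in lebesgue. norm (q x) \<le> M"
    using pq by (auto simp: M_def elim: eventually_mono)
  have m: "p \<in> borel_measurable lebesgue" "q \<in> borel_measurable lebesgue"
    using assms(4,5) by (auto intro: AC_loc_measurable)
  show "z \<in> Lambda_tilde h p q"
  proof (rule ccontr)
    assume "z \<notin> Lambda_tilde h p q"
    then have z: "sqrt (Linf_norm p * Linf_norm q) < \<bar>Im z\<bar> \<or> h / 2 * sqrt (Linf_norm dp * Linf_norm dq) < \<bar>Re z\<bar> * \<bar>Im z\<bar>"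
      by (auto simp: Lambda_tilde_def c_bound_def dp_def dq_def not_le)
    have "Im z \<noteq> 0"
    proof
      assume "Im z = 0"
      moreover have "0 \<le> sqrt (Linf_norm p * Linf_norm q)" "0 \<le> h / 2 * sqrt (Linf_norm dp * Linf_norm dq)"
        using nonneg assms(1) by auto
      ultimately show False using z by auto
    qed
    obtain C where C: "C \<ge> 0" "\<And>z'. Re z' = Re z \<Longrightarrow> \<bar>Im z\<bar> \<le> \<bar>Im z'\<bar> \<Longrightarrow> dirac_coercive h p q z' C"
      by (rule dirac_coercive_ray[OF assms(1,4,5) pq_real pq dpq dpq' nonneg nonneg nonneg nonneg z]) (rule that)
    have "dirac_solvable h p q z"
      by (rule dirac_solvable_of_coercive_ray[OF assms(1) m pM \<open>Im z \<noteq> 0\<close> C])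
    then have "z \<in> resolvent_set (dirac_domain h p q) (dirac_expr h p q)"
      by (intro dirac_resolvent_setI[OF assms(1) C(2) C(1) _ m pM]) auto
    then show False using spec by (simp add: dirac_spectrum_def spectrum_def)
  qed
qed

end
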